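(* Let $H\in(\frac12,1)$, $a\in\mathbb{R}\setminus\{0\}$, $b\in\mathbb{R}^d$, and let $f:\mathbb{R}^d\to\mathbb{R}^d$ satisfy the linear growth condition, the one-sided dissipative Lipschitz condition and the integrability condition recalled in the context. Consider the stochastic differential equation $$dX_t=f(X_t)\,dt+(aX_t+b)\,dB^H_t \qquad (\mathrm{SDE})$$ and the random differential equation $$\frac{dU}{dt}=e^{-aO_t}f\Big(U_te^{aO_t}+\frac{b}{a}(e^{aO_t}-1)\Big)+(aU_t+b)O_t. \qquad (\mathrm{RDE})$$ Then: 1. Any two solutions $U_1,U_2$ of (RDE) satisfy $\lim_{t\to\infty}\|U_1(t)-U_2(t)\|^2=0$ pathwise. 2. The solution of (RDE) generates a random dynamical system $\psi(t,\omega,U_0):=U(t,\omega)$ on $\mathbb{R}^d$, where $U_0$ is the value of the solution at time $t=0$, and $\psi$ has a random attractor consisting of singleton sets $\mathcal{A}(\omega)=\{a(\omega)\}$ (here $a(\omega)$ denotes a random point of $\mathbb{R}^d$, not the constant $a$). 3. The equation (SDE) has the pathwise singleton set attractor $$a(\theta_t\omega)+\frac{b}{a}e^{O_t(\omega)}-\frac{b}{a},$$ which is a stationary solution; (SDE) has a unique stochastic stationary solution.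
   Context: Norm and inner product are Euclidean on $\mathbb{R}^d$. Conditions on $f$: (linear growth) there are $l,M>0$ with $\|f(x)\|\le l\|x\|+M$ for all $x\in\mathbb{R}^d$; (one-sided dissipative Lipschitz) there is $L>0$ with $\langle x-y,f(x)-f(y)\rangle\le -L\|x-y\|^2$ for all $x,y\in\mathbb{R}^d$; (integrability) there is $m_0>0$ such that $\int_{-\infty}^0 e^{ms}\|f(u(s))\|^2ds<\infty$ for every $m\in(0,m_0]$ and every continuous $u:\mathbb{R}\to\mathbb{R}^d$ of sub-exponential growth (for every $\epsilon>0$ there are $C>0$ and $t_0$ with $\|u(t)\|\le Ce^{\epsilon|t|}$ for $|t|\ge t_0$). Noise: $B^H_t$, $t\in\mathbb{R}$, is a two-sided one-dimensional fractional Brownian motion with Hurst parameter $H$ (continuous centered Gaussian process with covariance $\frac12(|t|^{2H}+|s|^{2H}-|t-s|^{2H})$), realized canonically: $B^H_t(\omega)=\omega(t)$, with $\omega\in C_0(\mathbb{R},\mathbb{R})$ (continuous functions vanishing at $0$, compact-open topology, Borel $\sigma$-algebra $\mathcal{F}$), $\mathbb{P}$ the law of $B^H$, and $\theta_t\omega(\cdot)=\omega(\cdot+t)-\omega(t)$. $\Omega$ is the restriction of this space to a $\theta$-invariant set of full measure of paths that are $\alpha$-Hölder continuous on every bounded interval, where $\frac12<\alpha<H$, and have sub-linear growth as $|t|\to\infty$. "Pathwise" means for every $\omega\in\Omega$. Fractional Ornstein–Uhlenbeck process: $O_t(\omega)=e^{-t}\int_{-\infty}^te^{s}\,dB^H_s(\omega)$,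 the stationary solution of $dO_t=-O_t\,dt+dB^H_t$. Integrals with respect to $B^H$ are pathwise Young integrals, i.e. limits of Riemann–Stieltjes sums $\sum Y_s(X_t-X_s)$ over partitions with mesh tending to $0$. Solutions of (SDE) are taken in the space of functions that are $\alpha$-Hölder continuous on bounded intervals. Solutions of (SDE) and (RDE) correspond to each other via $U_t=e^{-aO_t}(X_t+\frac ba)-\frac ba$. Random dynamical system: a measurable map $\phi:\mathbb{R}\times\Omega\times\mathbb{R}^d\to\mathbb{R}^d$ with $\phi(0,\omega,\cdot)=\mathrm{id}$ and $\phi(t+s,\omega,\cdot)=\phi(t,\theta_s\omega,\cdot)\circ\phi(s,\omega,\cdot)$ for all $s,t\in\mathbb{R}$, $\omega\in\Omega$. A random variable $X\ge0$ is tempered if $\lim_{t\to\pm\infty}\log^+X(\theta_t\omega)/|t|=0$ for $\omega\in\Omega$. A random set is a map $\omega\mapsto D(\omega)$ into nonempty Borel subsets of $\mathbb{R}^d$ such that $\omega\mapsto \inf_{y\in D(\omega)}\|x-y\|$ is measurable for each $x$; it is tempered if $\sup_{x\in D(\omega)}\|x\|$ is tempered. $\mathcal{D}$ is the family of tempered closed random sets. A random (pullback) attractor is a compact random set $\mathcal{A}\in\mathcal{D}$ with $\phi(t,\omega,\mathcal{A}(\omega))=\mathcal{A}(\theta_t\omega)$ for all $t>0$ and $\lim_{t\to\infty}d(\phi(t,\theta_{-t}\omega,D(\theta_{-t}\omega)),\mathcal{A}(\omega))=0$ for all $D\in\mathcal{D}$, where $d(X,Y)=\sup_{x\in X}\inf_{y\in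 Y}\|x-y\|$. A stationary solution is a solution of the form $t\mapsto x(\theta_t\omega)$ for a random variable $x$.
   Formalization: f is additionally assumed locally Lipschitz (otherwise solutions may merge or fail to exist, so no random dynamical system on time set R); the attractor in part 3 is corrected to e^{aO_t}a(θ_tω)+(b/a)e^{aO_t}-b/a; uniqueness of the stationary solution is almost sure. *)

theory Defs
  imports "HOL-Probability.Probability"
begin

section \<open>Path space and two-sided fractional Brownian motion\<close>

definition C0 :: "(real \<Rightarrow> real) set" where
  "C0 = {\<omega>. continuous_on UNIV \<omega> \<and> \<omega> 0 = 0}"

definition compact_open_C0 :: "(real \<Rightarrow> real) topology" where
  "compact_open_C0 =
     topology_generated_by {{\<omega> \<in> C0. \<omega> ` K \<subseteq> V} | K V. compact K \<and> open V}"

definition borel_C0 :: "(real \<Rightarrow> real) measure" where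
  "borel_C0 = sigma C0 {W. openin compact_open_C0 W}"

definition wiener_shift :: "real \<Rightarrow> (real \<Rightarrow> real) \<Rightarrow> real \<Rightarrow> real" where
  "wiener_shift t \<omega> = (\<lambda>s. \<omega> (s + t) - \<omega> t)"

text \<open>The Dirac measures are the degenerate normal laws.\<close>

definition gaussian_law :: "real measure \<Rightarrow> bool" where
  "gaussian_law \<mu> \<longleftrightarrow>
     (\<exists>m. \<mu> = return borel m \<or> (\<exists>\<sigma>>0. \<mu> = density lborel (\<lambda>x. ennreal (normal_density m \<sigma> x))))"

text \<open>The process is the canonical one, evaluation of the path at each time.\<close>

definition fbm_law :: "real \<Rightarrow> (real \<Rightarrow> real) measure \<Rightarrow> bool" where
  "fbm_law H P \<longleftrightarrow>
     prob_space P \<and> space P = C0 \<and> sets P = sets borel_C0 \<and>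
     (\<forall>T c. finite T \<longrightarrow> gaussian_law (distr P borel (\<lambda>\<omega>. \<Sum>t\<in>T. c t * \<omega> t))) \<and>
     (\<forall>t. prob_space.expectation P (\<lambda>\<omega>. \<omega> t) = 0) \<and>
     (\<forall>s t. prob_space.expectation P (\<lambda>\<omega>. \<omega> s * \<omega> t) =
        (\<bar>t\<bar> powr (2 * H) + \<bar>s\<bar> powr (2 * H) - \<bar>t - s\<bar> powr (2 * H)) / 2)"

definition locally_holder :: "real \<Rightarrow> (real \<Rightarrow> 'v::real_normed_vector) \<Rightarrow> bool" where
  "locally_holder \<alpha> x \<longleftrightarrow>
     (\<forall>R. \<exists>K. \<forall>s\<in>{-R..R}. \<forall>t\<in>{-R..R}. norm (x s - x t) \<le> K * \<bar>s - t\<bar> powr \<alpha>)"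

definition sublinear_growth :: "(real \<Rightarrow> real) \<Rightarrow> bool" where
  "sublinear_growth \<omega> \<longleftrightarrow> ((\<lambda>t. \<omega> t / \<bar>t\<bar>) \<longlongrightarrow> 0) at_infinity"

definition admissible_paths ::
    "real \<Rightarrow> (real \<Rightarrow> real) measure \<Rightarrow> (real \<Rightarrow> real) set \<Rightarrow> bool" where
  "admissible_paths \<alpha> P \<Omega> \<longleftrightarrow>
     \<Omega> \<in> sets P \<and> measure P \<Omega> = 1 \<and> (\<forall>t. wiener_shift t ` \<Omega> = \<Omega>) \<and>
     (\<forall>\<omega>\<in>\<Omega>. locally_holder \<alpha> \<omega> \<and> sublinear_growth \<omega>)"


section \<open>Pathwise integrals and the fractional Ornstein--Uhlenbeck process\<close>

definition has_young_integral ::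
    "(real \<Rightarrow> 'v::real_normed_vector) \<Rightarrow> (real \<Rightarrow> real) \<Rightarrow> real \<Rightarrow> real \<Rightarrow> 'v \<Rightarrow> bool" where
  "has_young_integral y x s t I \<longleftrightarrow>
     (\<forall>\<epsilon>>0. \<exists>\<delta>>0. \<forall>p n.
        p 0 = s \<and> p n = t \<and> (\<forall>i<n. p i \<le> p (Suc i) \<and> p (Suc i) - p i < \<delta>) \<longrightarrow>
        norm ((\<Sum>i<n. (x (p (Suc i)) - x (p i)) *\<^sub>R y (p i)) - I) < \<epsilon>)"

definition young_integral ::
    "(real \<Rightarrow> 'v::real_normed_vector) \<Rightarrow> (real \<Rightarrow> real) \<Rightarrow> real \<Rightarrow> real \<Rightarrow> 'v" where
  "young_integral y x s t = (THE I. has_young_integral y x s t I)"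

definition OU :: "real \<Rightarrow> (real \<Rightarrow> real) \<Rightarrow> real" where
  "OU t \<omega> = exp (- t) * Lim at_bot (\<lambda>s. young_integral exp \<omega> s t)"


section \<open>Conditions on the drift\<close>

definition linear_growth :: "('v::euclidean_space \<Rightarrow> 'v) \<Rightarrow> bool" where
  "linear_growth f \<longleftrightarrow> (\<exists>l>0. \<exists>M>0. \<forall>x. norm (f x) \<le> l * norm x + M)"

definition dissipative_one_sided_lipschitz :: "('v::euclidean_space \<Rightarrow> 'v) \<Rightarrow> bool" where
  "dissipative_one_sided_lipschitz f \<longleftrightarrow>
     (\<exists>L>0. \<forall>x y. (x - y) \<bullet> (f x - f y) \<le> - L * (norm (x - y))\<^sup>2)"

definition subexponential_growth :: "(real \<Rightarrow> 'v::euclidean_space) \<Rightarrow> bool" where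
  "subexponential_growth u \<longleftrightarrow>
     (\<forall>\<epsilon>>0. \<exists>C>0. \<exists>t0. \<forall>t. \<bar>t\<bar> \<ge> t0 \<longrightarrow> norm (u t) \<le> C * exp (\<epsilon> * \<bar>t\<bar>))"

definition integrability_condition :: "('v::euclidean_space \<Rightarrow> 'v) \<Rightarrow> bool" where
  "integrability_condition f \<longleftrightarrow>
     (\<exists>m0>0. \<forall>m u. 0 < m \<and> m \<le> m0 \<and> continuous_on UNIV u \<and> subexponential_growth u \<longrightarrow>
        set_integrable lborel {..0} (\<lambda>s. exp (m * s) * (norm (f (u s)))\<^sup>2))"


section \<open>The two equations\<close>

definition rde_field ::
    "('v::euclidean_space \<Rightarrow> 'v) \<Rightarrow> real \<Rightarrow> 'v \<Rightarrow> (real \<Rightarrow> real) \<Rightarrow> real \<Rightarrow> 'v \<Rightarrow> 'v" where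
  "rde_field f a b \<omega> t u =
     exp (- a * OU t \<omega>) *\<^sub>R
       f (exp (a * OU t \<omega>) *\<^sub>R u + (exp (a * OU t \<omega>) - 1) *\<^sub>R (b /\<^sub>R a))
     + OU t \<omega> *\<^sub>R (a *\<^sub>R u + b)"

definition rde_solution_on ::
    "real set \<Rightarrow> ('v::euclidean_space \<Rightarrow> 'v) \<Rightarrow> real \<Rightarrow> 'v \<Rightarrow> (real \<Rightarrow> real) \<Rightarrow> (real \<Rightarrow> 'v) \<Rightarrow> bool"
  where
  "rde_solution_on S f a b \<omega> U \<longleftrightarrow>
     (\<forall>t\<in>S. (U has_vector_derivative rde_field f a b \<omega> t (U t)) (at t within S))"

definition sde_solution ::
    "real \<Rightarrow> ('v::euclidean_space \<Rightarrow> 'v) \<Rightarrow> real \<Rightarrow> 'v \<Rightarrow> (real \<Rightarrow> real) \<Rightarrow> (real \<Rightarrow> 'v) \<Rightarrow> bool"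
  where
  "sde_solution \<alpha> f a b \<omega> X \<longleftrightarrow>
     locally_holder \<alpha> X \<and>
     (\<forall>s t. s \<le> t \<longrightarrow>
        (\<exists>I J. ((\<lambda>r. f (X r)) has_integral I) {s..t} \<and>
               has_young_integral (\<lambda>r. a *\<^sub>R X r + b) \<omega> s t J \<and>
               X t = X s + I + J))"


section \<open>Random dynamical systems over the shift\<close>

definition rds ::
    "(real \<Rightarrow> real) measure \<Rightarrow> (real \<Rightarrow> (real \<Rightarrow> real) \<Rightarrow> 'v \<Rightarrow> 'v::euclidean_space) \<Rightarrow> bool" where
  "rds M \<phi> \<longleftrightarrow>
     (\<lambda>(t, \<omega>, x). \<phi> t \<omega> x) \<in> borel_measurable (borel \<Otimes>\<^sub>M (M \<Otimes>\<^sub>M borel)) \<and>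
     (\<forall>\<omega>\<in>space M. \<phi> 0 \<omega> = id \<and> (\<forall>s t. \<phi> (t + s) \<omega> = \<phi> t (wiener_shift s \<omega>) \<circ> \<phi> s \<omega>))"

text \<open>The equivalence expresses that each initial value at time \<open>0\<close> has exactly one solution
  on the whole line, namely the orbit of \<open>\<phi>\<close>.\<close>

definition generated_by ::
    "(real \<Rightarrow> real) measure \<Rightarrow> ((real \<Rightarrow> real) \<Rightarrow> (real \<Rightarrow> 'v) \<Rightarrow> bool) \<Rightarrow>
     (real \<Rightarrow> (real \<Rightarrow> real) \<Rightarrow> 'v \<Rightarrow> 'v) \<Rightarrow> bool" where
  "generated_by M sol \<phi> \<longleftrightarrow>
     (\<forall>\<omega>\<in>space M. \<forall>x X. sol \<omega> X \<and> X 0 = x \<longleftrightarrow> X = (\<lambda>t. \<phi> t \<omega> x))"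

definition tempered :: "(real \<Rightarrow> real) measure \<Rightarrow> ((real \<Rightarrow> real) \<Rightarrow> real) \<Rightarrow> bool" where
  "tempered M X \<longleftrightarrow>
     X \<in> borel_measurable M \<and>
     (\<forall>\<omega>\<in>space M. X \<omega> \<ge> 0 \<and>
        ((\<lambda>t. max 0 (ln (X (wiener_shift t \<omega>))) / \<bar>t\<bar>) \<longlongrightarrow> 0) at_infinity)"

definition random_set ::
    "(real \<Rightarrow> real) measure \<Rightarrow> ((real \<Rightarrow> real) \<Rightarrow> 'v::euclidean_space set) \<Rightarrow> bool" where
  "random_set M D \<longleftrightarrow>
     (\<forall>\<omega>\<in>space M. D \<omega> \<noteq> {} \<and> D \<omega> \<in> sets borel) \<and>
     (\<forall>x. (\<lambda>\<omega>. infdist x (D \<omega>)) \<in> borel_measurable M)"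

text \<open>Boundedness makes the real-valued supremum meaningful.\<close>

definition tempered_set ::
    "(real \<Rightarrow> real) measure \<Rightarrow> ((real \<Rightarrow> real) \<Rightarrow> 'v::euclidean_space set) \<Rightarrow> bool" where
  "tempered_set M D \<longleftrightarrow>
     (\<forall>\<omega>\<in>space M. bounded (D \<omega>)) \<and> tempered M (\<lambda>\<omega>. SUP x\<in>D \<omega>. norm x)"

definition tempered_closed_sets ::
    "(real \<Rightarrow> real) measure \<Rightarrow> ((real \<Rightarrow> real) \<Rightarrow> 'v::euclidean_space set) set" where
  "tempered_closed_sets M =
     {D. random_set M D \<and> (\<forall>\<omega>\<in>space M. closed (D \<omega>)) \<and> tempered_set M D}"

definition semidist :: "'v::euclidean_space set \<Rightarrow> 'v set \<Rightarrow> ennreal" where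
  "semidist X Y = (SUP x\<in>X. ennreal (infdist x Y))"

definition random_attractor ::
    "(real \<Rightarrow> real) measure \<Rightarrow> (real \<Rightarrow> (real \<Rightarrow> real) \<Rightarrow> 'v \<Rightarrow> 'v::euclidean_space) \<Rightarrow>
     ((real \<Rightarrow> real) \<Rightarrow> 'v set) \<Rightarrow> bool" where
  "random_attractor M \<phi> A \<longleftrightarrow>
     A \<in> tempered_closed_sets M \<and>
     (\<forall>\<omega>\<in>space M. compact (A \<omega>)) \<and>
     (\<forall>\<omega>\<in>space M. \<forall>t>0. \<phi> t \<omega> ` A \<omega> = A (wiener_shift t \<omega>)) \<and>
     (\<forall>D\<in>tempered_closed_sets M. \<forall>\<omega>\<in>space M.
        ((\<lambda>t. semidist (\<phi> t (wiener_shift (- t) \<omega>) ` D (wiener_shift (- t) \<omega>)) (A \<omega>)) \<longlongrightarrow> 0) at_top)"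

definition stationary_solution ::
    "(real \<Rightarrow> real) measure \<Rightarrow> ((real \<Rightarrow> real) \<Rightarrow> (real \<Rightarrow> 'v) \<Rightarrow> bool) \<Rightarrow>
     ((real \<Rightarrow> real) \<Rightarrow> 'v::euclidean_space) \<Rightarrow> bool" where
  "stationary_solution M sol x \<longleftrightarrow>
     x \<in> borel_measurable M \<and> (\<forall>\<omega>\<in>space M. sol \<omega> (\<lambda>t. x (wiener_shift t \<omega>)))"

end

theory Submission
  imports Defs "HOL-Real_Asymp.Real_Asymp"
begin

text \<open>
  Everything except the last uniqueness claim is proved path by path. Write \<open>O\<close> for the
  Ornstein--Uhlenbeck process of a path \<open>\<omega>\<close> and \<open>Y = \<omega> - O\<close>. Integration by parts in the Young
  integral shows that \<open>Y\<close> is differentiable with derivative \<open>O\<close>, and that \<open>Y\<close> and \<open>O\<close> inherit the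
  sublinear growth of \<open>\<omega>\<close>. So the integral of \<open>O\<close> over a time interval is an increment of \<open>Y\<close> and
  is negligible against the length of the interval; no ergodic theorem is involved.

  \<^bold>\<open>Contraction.\<close> The state enters the random differential equation through an affine change of
  variables. In the difference of two solutions the noise therefore appears only in the scalar
  factor \<open>a * O\<close>, and with the dissipativity constant \<open>\<mu>\<close> the quantity
  \<open>\<bar>U - V\<bar>\<^sup>2 exp (2 (\<mu> t - a Y t))\<close> does not increase (\<open>contraction\<close>). This gives the first claim.

  \<^bold>\<open>Attractor.\<close> The same computation against the zero state bounds all solutions that start from
  zero in the past, with a subexponential bound that does not depend on the starting time
  (\<open>apriori\<close>). By contraction these solutions converge exponentially as the starting time tends to
  minus infinity (\<open>pullback_rate\<close>). The limit \<open>p\<close> is invariant and tempered, and contraction beats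
  the size of every tempered set (\<open>pullback_invariant\<close>, \<open>pullback_growth\<close>, \<open>pullback_attracts\<close>).
  Global solutions are limits of Picard iterates, which depend measurably on time, path and
  initial value together, so the flow and \<open>p\<close> are measurable.

  \<^bold>\<open>The stochastic equation.\<close> With \<open>Z = exp (- a \<omega>) (X + b / a)\<close>, both equations are equivalent to
  \<open>Z' = exp (- a \<omega>) f X\<close>. For the random equation this is the chain rule, as
  \<open>U + b / a = exp (a Y) Z\<close>. For the stochastic one it is a comparison of local expansions: an error
  of order \<open>2 \<alpha> > 1\<close> is invisible both to Riemann sums (\<open>has_young_integralI\<close>) and to derivatives
  (\<open>zero_derivative_of_superlinear\<close>), and \<open>young_loeve\<close> provides the expansion of an integral that
  is only known to exist. So the flow and the attractor carry over (\<open>sde_iff_rde\<close>).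

  \<^bold>\<open>Uniqueness.\<close> The distance between \<open>p\<close> and a stationary solution, in the variables of the random
  equation, tends to zero along every orbit and is itself stationary, so it vanishes almost surely (\<open>stationary_unique\<close>). This needs that the
  law of fractional Brownian motion is invariant under the shift (\<open>fbm_stationary_increments\<close>): the
  Borel sets of path space are generated by evaluations, and finite-dimensional laws are determined
  by the laws of linear functionals (\<open>cramer_wold\<close>), which are centred Gaussian with the same
  variance before and after the shift.
\<close>

section \<open>Calculus on the line\<close>

lemma antiderivative_exists:
  fixes g :: "real \<Rightarrow> 'v::euclidean_space"
  assumes "continuous_on UNIV g"
  obtains G where "\<And>t. (G has_vector_derivative g t) (at t)"
proof -
  have "\<exists>F. \<forall>x :: real. -\<infinity> < ereal x \<longrightarrow> ereal x < \<infinity> \<longrightarrow> (F has_vector_derivative g x) (at x)"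
    by (rule einterval_antiderivative) (use assms in \<open>auto simp: continuous_on_eq_continuous_at\<close>)
  then show ?thesis using that by auto
qed

lemma has_vector_derivative_continuous_on:
  fixes G :: "real \<Rightarrow> 'v::real_normed_vector"
  assumes "\<And>t. (G has_vector_derivative g t) (at t)"
  shows "continuous_on S G"
  using assms has_vector_derivative_continuous continuous_at_imp_continuous_on by blast

lemma norm_increment_le:
  fixes G :: "real \<Rightarrow> 'v::real_normed_vector"
  assumes "s \<le> t" and "\<And>r. (G has_vector_derivative g r) (at r)"
    and "\<And>r. s < r \<Longrightarrow> r < t \<Longrightarrow> norm (g r) \<le> B"
  shows "norm (G t - G s) \<le> B * (t - s)"
proof (cases "s = t")
  case False
  have "norm (G t - G s) \<le> B * t - B * s"
  proof (rule differentiable_bound_general[where f' = g and \<phi>' = "\<lambda>_. B"])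
    show "\<And>x. ((*) B has_vector_derivative B) (at x)"
      by (auto intro!: derivative_eq_intros simp: has_real_derivative_iff_has_vector_derivative[symmetric])
  qed (use assms False in \<open>auto intro!: has_vector_derivative_continuous_on continuous_intros\<close>)
  then show ?thesis by (simp add: algebra_simps)
qed simp

lemma continuous_bounded_on_interval:
  fixes g :: "real \<Rightarrow> 'v::real_normed_vector"
  assumes "continuous_on UNIV g"
  obtains B where "B > 0" "\<And>t. \<bar>t\<bar> \<le> R \<Longrightarrow> norm (g t) \<le> B"
proof -
  have "compact (g ` {-R..R})"
    using assms by (intro compact_continuous_image) (auto intro: continuous_on_subset)
  then have "bounded (g ` {-R..R})" by (rule compact_imp_bounded)
  then obtain B where "B > 0" "\<And>y. y \<in> g ` {-R..R} \<Longrightarrow> norm y \<le> B"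
    by (auto simp: bounded_pos)
  then show ?thesis using that[of B] by (auto simp: abs_le_iff)
qed


lemma convergent_of_tail_bound:
  fixes X :: "nat \<Rightarrow> 'v::banach"
  assumes tail: "\<And>m n. m \<le> n \<Longrightarrow> norm (X m - X n) \<le> h m" and h: "h \<longlonglongrightarrow> 0"
  shows "convergent X"
proof -
  have "Cauchy X"
  proof (rule metric_CauchyI)
    fix e :: real assume "e > 0"
    then obtain N where N: "\<And>n. n \<ge> N \<Longrightarrow> h n < e"
      using order_tendstoD(2)[OF h] by (auto simp: eventually_sequentially)
    have *: "dist (X m) (X n) < e" if "N \<le> m" "m \<le> n" for m n
      using tail[OF that(2)] N[OF that(1)] by (simp add: dist_norm)
    show "\<exists>M. \<forall>m\<ge>M. \<forall>n\<ge>M. dist (X m) (X n) < e"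
      using * by (metis dist_commute nle_le)
  qed
  then show ?thesis by (simp add: Cauchy_convergent_iff)
qed

lemma tendsto_zero_of_norm_power2:
  fixes g :: "'a \<Rightarrow> 'v::real_normed_vector"
  assumes "((\<lambda>t. (norm (g t))\<^sup>2) \<longlongrightarrow> 0) F"
  shows "(g \<longlongrightarrow> 0) F"
  using tendsto_real_sqrt[OF assms] by (simp add: tendsto_norm_zero_iff)


section \<open>Pathwise integrals from local expansions\<close>

lemma partition_mono:
  fixes p :: "nat \<Rightarrow> real"
  assumes "\<And>i. i < n \<Longrightarrow> p i \<le> p (Suc i)" "i \<le> j" "j \<le> n"
  shows "p i \<le> p j"
  using assms(2,3)
proof (induction j)
  case (Suc j)
  then show ?case using assms(1)[of j] by (cases "i = Suc j") auto
qed simp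

text \<open>A local remainder of order larger than one sums to at most a power of the mesh, so every
  primitive with such a local expansion is the limit of the Riemann sums. All integrals against
  the path are obtained from explicit primitives in this way.\<close>

lemma has_young_integralI:
  fixes y :: "real \<Rightarrow> 'v::real_normed_vector"
  assumes "\<gamma> > 1"
    and est: "\<And>u v. s \<le> u \<Longrightarrow> u \<le> v \<Longrightarrow> v \<le> t \<Longrightarrow>
      norm (\<Gamma> v - \<Gamma> u - (x v - x u) *\<^sub>R y u) \<le> C * (v - u) powr \<gamma>"
  shows "has_young_integral y x s t (\<Gamma> t - \<Gamma> s)"
  unfolding has_young_integral_def
proof (intro allI impI)
  fix \<epsilon> :: real assume "\<epsilon> > 0"
  define D where "D = (\<bar>C\<bar> + 1) * (\<bar>t - s\<bar> + 1)"
  have "D > 0" by (simp add: D_def add_nonneg_pos)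
  \<comment> \<open>A mesh below \<open>\<delta>\<close> makes the total error at most \<open>C \<delta> powr (\<gamma> - 1) (t - s)\<close>.\<close>
  define \<delta> where "\<delta> = (\<epsilon> / D) powr (1 / (\<gamma> - 1))"
  have "\<delta> > 0" using \<open>\<epsilon> > 0\<close> \<open>D > 0\<close> by (simp add: \<delta>_def)
  have \<delta>: "\<delta> powr (\<gamma> - 1) = \<epsilon> / D"
    using \<open>\<gamma> > 1\<close> \<open>\<epsilon> > 0\<close> \<open>D > 0\<close> by (simp add: \<delta>_def powr_powr)
  show "\<exists>\<delta>>0. \<forall>p n. p 0 = s \<and> p n = t \<and> (\<forall>i<n. p i \<le> p (Suc i) \<and> p (Suc i) - p i < \<delta>) \<longrightarrow>
      norm ((\<Sum>i<n. (x (p (Suc i)) - x (p i)) *\<^sub>R y (p i)) - (\<Gamma> t - \<Gamma> s)) < \<epsilon>"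
  proof (intro exI[of _ \<delta>] conjI allI impI \<open>\<delta> > 0\<close>, elim conjE)
    fix p :: "nat \<Rightarrow> real" and n
    assume p0: "p 0 = s" and pn: "p n = t" and p: "\<forall>i<n. p i \<le> p (Suc i) \<and> p (Suc i) - p i < \<delta>"
    have mono: "p i \<le> p j" if "i \<le> j" "j \<le> n" for i j
      using partition_mono[of n p i j] p that by blast
    have "s \<le> t" using mono[of 0 n] p0 pn by simp
    have tele: "\<Gamma> t - \<Gamma> s = (\<Sum>i<n. \<Gamma> (p (Suc i)) - \<Gamma> (p i))"
      using sum_lessThan_telescope[of "\<lambda>i. \<Gamma> (p i)" n] p0 pn by simp
    have telep: "t - s = (\<Sum>i<n. p (Suc i) - p i)"
      using sum_lessThan_telescope[of p n] p0 pn by simp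
    have "norm ((\<Sum>i<n. (x (p (Suc i)) - x (p i)) *\<^sub>R y (p i)) - (\<Gamma> t - \<Gamma> s))
        = norm (\<Sum>i<n. \<Gamma> (p (Suc i)) - \<Gamma> (p i) - (x (p (Suc i)) - x (p i)) *\<^sub>R y (p i))"
      unfolding tele sum_subtractf by (rule norm_minus_commute)
    also have "\<dots> \<le> (\<Sum>i<n. (\<bar>C\<bar> + 1) * (\<epsilon> / D) * (p (Suc i) - p i))"
    proof (rule sum_norm_le)
      fix i assume "i \<in> {..<n}"
      then have i: "i < n" by simp
      define h where "h = p (Suc i) - p i"
      have h: "0 \<le> h" "h < \<delta>" using p i by (auto simp: h_def)
      have "h powr \<gamma> = h * h powr (\<gamma> - 1)"
        using h powr_mult_base[of h "\<gamma> - 1"] by simp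
      also have "\<dots> \<le> h * (\<epsilon> / D)"
        unfolding \<delta>[symmetric] using h \<open>\<gamma> > 1\<close> by (intro mult_left_mono powr_mono2) auto
      finally have hp: "h powr \<gamma> \<le> h * (\<epsilon> / D)" .
      have "norm (\<Gamma> (p (Suc i)) - \<Gamma> (p i) - (x (p (Suc i)) - x (p i)) *\<^sub>R y (p i)) \<le> C * h powr \<gamma>"
        unfolding h_def using mono[of 0 i] mono[of i "Suc i"] mono[of "Suc i" n] i p0 pn by (intro est) auto
      also have "\<dots> \<le> (\<bar>C\<bar> + 1) * h powr \<gamma>" by (intro mult_right_mono) auto
      also have "\<dots> \<le> (\<bar>C\<bar> + 1) * (h * (\<epsilon> / D))" using hp by (intro mult_left_mono) auto
      finally show "norm (\<Gamma> (p (Suc i)) - \<Gamma> (p i) - (x (p (Suc i)) - x (p i)) *\<^sub>R y (p i))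
          \<le> (\<bar>C\<bar> + 1) * (\<epsilon> / D) * (p (Suc i) - p i)"
        by (simp add: h_def mult_ac)
    qed
    also have "\<dots> = (\<bar>C\<bar> + 1) * (\<epsilon> / D) * (t - s)" by (simp add: telep sum_distrib_left)
    also have "\<dots> < (\<bar>C\<bar> + 1) * (\<epsilon> / D) * (\<bar>t - s\<bar> + 1)"
      using \<open>\<epsilon> > 0\<close> \<open>D > 0\<close> by (intro mult_strict_left_mono) (auto intro!: mult_pos_pos)
    also have "\<dots> = \<epsilon>" using \<open>D > 0\<close> by (simp add: D_def field_simps)
    finally show "norm ((\<Sum>i<n. (x (p (Suc i)) - x (p i)) *\<^sub>R y (p i)) - (\<Gamma> t - \<Gamma> s)) < \<epsilon>" .
  qed
qed

text \<open>Equidistant partitions identify the value of an integral that is known to exist; their sums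
  are explicit, hence measurable in the path, and the dyadic ones are nested.\<close>

definition uniform_sum :: "(real \<Rightarrow> 'v::real_normed_vector) \<Rightarrow> (real \<Rightarrow> real) \<Rightarrow> real \<Rightarrow> real \<Rightarrow> nat \<Rightarrow> 'v" where
  "uniform_sum y x s t n =
     (\<Sum>i<n. (x (s + real (Suc i) * ((t - s) / n)) - x (s + real i * ((t - s) / n)))
        *\<^sub>R y (s + real i * ((t - s) / n)))"

lemma uniform_sum_tendsto:
  assumes "has_young_integral y x s t I" "s \<le> t"
  shows "uniform_sum y x s t \<longlonglongrightarrow> I"
proof (rule LIMSEQ_I)
  fix r :: real assume "r > 0"
  then obtain \<delta> where "\<delta> > 0" and \<delta>: "\<And>p n. p 0 = s \<Longrightarrow> p n = t \<Longrightarrow>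
      (\<forall>i<n. p i \<le> p (Suc i) \<and> p (Suc i) - p i < \<delta>) \<Longrightarrow>
      norm ((\<Sum>i<n. (x (p (Suc i)) - x (p i)) *\<^sub>R y (p i)) - I) < r"
    using assms(1) unfolding has_young_integral_def by meson
  obtain N :: nat where N: "(t - s) / \<delta> < N" using reals_Archimedean2 by blast
  show "\<exists>no. \<forall>n\<ge>no. norm (uniform_sum y x s t n - I) < r"
  proof (intro exI[of _ "Suc N"] allI impI)
    fix n assume "Suc N \<le> n"
    then have n: "n > 0" "(t - s) / \<delta> < n" using N by auto
    then have "(t - s) / n < \<delta>" using \<open>\<delta> > 0\<close> by (simp add: field_simps)
    moreover have "s + real (Suc i) * ((t - s) / n) = s + real i * ((t - s) / n) + (t - s) / n" for i
      using n by (simp add: field_simps)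
    ultimately show "norm (uniform_sum y x s t n - I) < r"
      unfolding uniform_sum_def
      using \<delta>[of "\<lambda>i. s + real i * ((t - s) / n)" n] n \<open>s \<le> t\<close> by simp
  qed
qed

lemma young_integral_eq:
  assumes "has_young_integral y x s t I" "s \<le> t"
  shows "young_integral y x s t = I"
  unfolding young_integral_def
proof (rule the_equality)
  show "has_young_integral y x s t I" by fact
  fix J assume "has_young_integral y x s t J"
  then show "J = I"
    using uniform_sum_tendsto[OF _ \<open>s \<le> t\<close>] assms(1) LIMSEQ_unique by metis
qed


section \<open>Growth and the Ornstein--Uhlenbeck process of a path\<close>

definition sublinearly_bounded :: "(real \<Rightarrow> real) \<Rightarrow> bool" where
  "sublinearly_bounded x \<longleftrightarrow> (\<forall>\<epsilon>>0. \<exists>C>0. \<forall>t. \<bar>x t\<bar> \<le> C + \<epsilon> * \<bar>t\<bar>)"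

lemma sublinearly_boundedE:
  assumes "sublinearly_bounded x" "\<epsilon> > 0"
  obtains C where "C > 0" "\<And>t. \<bar>x t\<bar> \<le> C + \<epsilon> * \<bar>t\<bar>"
  using assms unfolding sublinearly_bounded_def by meson

lemma sublinearly_bounded_diff:
  assumes "sublinearly_bounded x" "sublinearly_bounded y"
  shows "sublinearly_bounded (\<lambda>t. x t - y t)"
  unfolding sublinearly_bounded_def
proof (intro allI impI)
  fix \<epsilon> :: real assume "\<epsilon> > 0"
  then have e: "\<epsilon> / 2 > 0" by simp
  obtain C D where CD: "C > 0" "\<And>t. \<bar>x t\<bar> \<le> C + \<epsilon> / 2 * \<bar>t\<bar>" "D > 0" "\<And>t. \<bar>y t\<bar> \<le> D + \<epsilon> / 2 * \<bar>t\<bar>"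
    using sublinearly_boundedE[OF assms(1) e] sublinearly_boundedE[OF assms(2) e] by metis
  have "\<bar>x t - y t\<bar> \<le> (C + D) + \<epsilon> * \<bar>t\<bar>" for t
    using CD(2,4)[of t] by (simp add: field_simps)
  then show "\<exists>C>0. \<forall>t. \<bar>x t - y t\<bar> \<le> C + \<epsilon> * \<bar>t\<bar>"
    using CD(1,3) by (intro exI[of _ "C + D"]) auto
qed

locale regular_path =
  fixes \<alpha> :: real and \<omega> :: "real \<Rightarrow> real"
  assumes alpha: "1/2 < \<alpha>" "\<alpha> < 1"
    and cont: "continuous_on UNIV \<omega>"
    and holder: "locally_holder \<alpha> \<omega>"
    and sublinear: "sublinear_growth \<omega>"
begin

lemma path_bounded: "sublinearly_bounded \<omega>"
  unfolding sublinearly_bounded_def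
proof (intro allI impI)
  fix \<epsilon> :: real assume "\<epsilon> > 0"
  then have "\<forall>\<^sub>F t in at_infinity. dist (\<omega> t / \<bar>t\<bar>) 0 < \<epsilon>"
    using sublinear tendstoD unfolding sublinear_growth_def by blast
  then obtain R where R: "\<And>t. R \<le> \<bar>t\<bar> \<Longrightarrow> \<bar>\<omega> t / \<bar>t\<bar>\<bar> < \<epsilon>"
    by (auto simp: eventually_at_infinity dist_real_def)
  obtain B where "B > 0" and B: "\<And>t. \<bar>t\<bar> \<le> max R 1 \<Longrightarrow> norm (\<omega> t) \<le> B"
    using continuous_bounded_on_interval[OF cont] by metis
  have "\<bar>\<omega> t\<bar> \<le> B + \<epsilon> * \<bar>t\<bar>" for t
  proof (cases "\<bar>t\<bar> \<le> max R 1")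
    case True
    then show ?thesis using B[of t] \<open>\<epsilon> > 0\<close> by (smt (verit) real_norm_def mult_nonneg_nonneg)
  next
    case False
    then have "R \<le> \<bar>t\<bar>" "\<bar>t\<bar> > 0" by auto
    then have "\<bar>\<omega> t\<bar> \<le> \<epsilon> * \<bar>t\<bar>"
      using R[of t] by (simp add: abs_divide divide_less_eq)
    then show ?thesis using \<open>B > 0\<close> by simp
  qed
  then show "\<exists>C>0. \<forall>t. \<bar>\<omega> t\<bar> \<le> C + \<epsilon> * \<bar>t\<bar>" using \<open>B > 0\<close> by blast
qed

lemma holderE:
  obtains K where "K > 0" "\<And>s t. \<bar>s\<bar> \<le> R \<Longrightarrow> \<bar>t\<bar> \<le> R \<Longrightarrow> \<bar>\<omega> s - \<omega> t\<bar> \<le> K * \<bar>s - t\<bar> powr \<alpha>"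
proof -
  obtain K where K: "\<forall>s\<in>{-R..R}. \<forall>t\<in>{-R..R}. norm (\<omega> s - \<omega> t) \<le> K * \<bar>s - t\<bar> powr \<alpha>"
    using holder unfolding locally_holder_def by meson
  show ?thesis
  proof (rule that[of "\<bar>K\<bar> + 1"])
    fix s t :: real assume "\<bar>s\<bar> \<le> R" "\<bar>t\<bar> \<le> R"
    then have "\<bar>\<omega> s - \<omega> t\<bar> \<le> K * \<bar>s - t\<bar> powr \<alpha>" using K by (auto simp: abs_le_iff)
    also have "\<dots> \<le> (\<bar>K\<bar> + 1) * \<bar>s - t\<bar> powr \<alpha>" by (intro mult_right_mono) auto
    finally show "\<bar>\<omega> s - \<omega> t\<bar> \<le> (\<bar>K\<bar> + 1) * \<bar>s - t\<bar> powr \<alpha>" .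
  qed simp
qed

text \<open>The remainder \<open>Hf v - Hf u\<close> is the integral of \<open>exp r * (\<omega> v - \<omega> r)\<close> over \<open>[u, v]\<close>, which
  Holder continuity makes of order \<open>1 + \<alpha>\<close>.\<close>

lemma young_integral_exp:
  assumes G: "\<And>t. (G has_vector_derivative exp t * \<omega> t) (at t)" and "s \<le> t"
  shows "has_young_integral exp \<omega> s t ((exp t * \<omega> t - G t) - (exp s * \<omega> s - G s))"
proof -
  obtain K where "K > 0"
    and K: "\<And>u v. \<bar>u\<bar> \<le> max \<bar>s\<bar> \<bar>t\<bar> \<Longrightarrow> \<bar>v\<bar> \<le> max \<bar>s\<bar> \<bar>t\<bar> \<Longrightarrow> \<bar>\<omega> u - \<omega> v\<bar> \<le> K * \<bar>u - v\<bar> powr \<alpha>"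
    using holderE by metis
  show ?thesis
  proof (rule has_young_integralI[where \<Gamma> = "\<lambda>r. exp r * \<omega> r - G r" and \<gamma> = "1 + \<alpha>" and C = "exp t * K"])
    fix u v assume uv: "s \<le> u" "u \<le> v" "v \<le> t"
    define Hf where "Hf r = exp r * \<omega> v - G r" for r
    have "norm (Hf v - Hf u) \<le> (exp t * (K * (v - u) powr \<alpha>)) * (v - u)"
    proof (rule norm_increment_le[where g = "\<lambda>r. exp r * (\<omega> v - \<omega> r)"])
      show "(Hf has_vector_derivative exp r * (\<omega> v - \<omega> r)) (at r)" for r
        unfolding Hf_def right_diff_distrib
        by (intro has_vector_derivative_diff G)
          (auto intro!: derivative_eq_intros simp: has_real_derivative_iff_has_vector_derivative[symmetric])
      fix r assume r: "u < r" "r < v"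
      have "\<bar>\<omega> v - \<omega> r\<bar> \<le> K * \<bar>v - r\<bar> powr \<alpha>" using uv r by (intro K) auto
      also have "\<dots> \<le> K * (v - u) powr \<alpha>"
        using \<open>K > 0\<close> r alpha by (intro mult_left_mono powr_mono2) auto
      finally have "\<bar>\<omega> v - \<omega> r\<bar> \<le> K * (v - u) powr \<alpha>" .
      then show "norm (exp r * (\<omega> v - \<omega> r)) \<le> exp t * (K * (v - u) powr \<alpha>)"
        using r uv \<open>K > 0\<close> by (auto simp: abs_mult intro!: mult_mono)
    qed fact
    also have "\<dots> = exp t * K * (v - u) powr (1 + \<alpha>)"
      using uv powr_mult_base[of "v - u" \<alpha>] by (simp add: mult.assoc mult.commute)
    also have "Hf v - Hf u = exp v * \<omega> v - G v - (exp u * \<omega> u - G u) - (\<omega> v - \<omega> u) *\<^sub>R exp u"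
      by (simp add: Hf_def algebra_simps)
    finally show "norm (exp v * \<omega> v - G v - (exp u * \<omega> u - G u) - (\<omega> v - \<omega> u) *\<^sub>R exp u)
        \<le> exp t * K * (v - u) powr (1 + \<alpha>)" .
  qed (use alpha in auto)
qed

text \<open>The comparison function \<open>\<phi>\<close> is an explicit primitive of the bound on the integrand after
  \<open>\<bar>r\<bar>\<close> has been estimated by \<open>\<bar>t\<bar> + (t - r)\<close>.\<close>

lemma weighted_tail:
  assumes G: "\<And>t. (G has_vector_derivative exp t * \<omega> t) (at t)" and "s \<le> t"
    and C: "C > 0" "\<epsilon> > 0" "\<And>t. \<bar>\<omega> t\<bar> \<le> C + \<epsilon> * \<bar>t\<bar>"
  shows "\<bar>G t - G s\<bar> \<le> exp t * (C + \<epsilon> + \<epsilon> * \<bar>t\<bar>)"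
proof (cases "s = t")
  case False
  define \<phi> where "\<phi> r = exp r * (C + \<epsilon> * \<bar>t\<bar> + \<epsilon> * (t - r) + \<epsilon>)" for r
  have der: "(\<phi> has_vector_derivative exp r * (C + \<epsilon> * \<bar>t\<bar> + \<epsilon> * (t - r))) (at r)" for r
    unfolding \<phi>_def has_real_derivative_iff_has_vector_derivative[symmetric]
    by (auto intro!: derivative_eq_intros simp: algebra_simps)
  have "norm (G t - G s) \<le> \<phi> t - \<phi> s"
  proof (rule differentiable_bound_general[OF _ _ _ G der])
    show "s < t" using False \<open>s \<le> t\<close> by simp
    show "continuous_on {s..t} G" "continuous_on {s..t} \<phi>"
      by (rule has_vector_derivative_continuous_on, rule G)
        (rule has_vector_derivative_continuous_on, rule der)
    fix r assume r: "s < r" "r < t"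
    have "\<bar>\<omega> r\<bar> \<le> C + \<epsilon> * \<bar>r\<bar>" by (rule C)
    also have "\<dots> \<le> C + \<epsilon> * (\<bar>t\<bar> + (t - r))" using r C by (intro add_left_mono mult_left_mono) auto
    also have "\<dots> = C + \<epsilon> * \<bar>t\<bar> + \<epsilon> * (t - r)" by (simp add: distrib_left)
    finally show "norm (exp r * \<omega> r) \<le> exp r * (C + \<epsilon> * \<bar>t\<bar> + \<epsilon> * (t - r))"
      by (simp add: abs_mult)
  qed
  also have "\<dots> \<le> \<phi> t" using C \<open>s \<le> t\<close> by (simp add: \<phi>_def)
  finally show ?thesis by (simp add: \<phi>_def algebra_simps)
qed (use C in simp)

text \<open>Integration by parts: the Young integral defining the process is a boundary term minus
  an ordinary integral, and the latter is what converges at minus infinity.\<close>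

lemma OU_representation:
  "\<exists>G l. (\<forall>t. (G has_vector_derivative exp t * \<omega> t) (at t)) \<and> (G \<longlongrightarrow> l) at_bot \<and>
     (\<forall>t. ((\<lambda>s. young_integral exp \<omega> s t) \<longlongrightarrow> exp t * \<omega> t - (G t - l)) at_bot) \<and>
     (\<forall>t. OU t \<omega> = \<omega> t - exp (- t) * (G t - l))"
proof -
  have "continuous_on UNIV (\<lambda>t. exp t * \<omega> t)" by (intro continuous_intros cont)
  then obtain G where G: "\<And>t. (G has_vector_derivative exp t * \<omega> t) (at t)"
    by (rule antiderivative_exists) (rule that)
  obtain C where C: "C > 0" "\<And>t. \<bar>\<omega> t\<bar> \<le> C + 1 * \<bar>t\<bar>"
    using sublinearly_boundedE[OF path_bounded, of 1] by auto
  define h where "h t = exp t * (C + 1 + 1 * \<bar>t\<bar>)" for t :: real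
  have tail: "\<bar>G t - G s\<bar> \<le> h t" if "s \<le> t" for s t
    unfolding h_def using weighted_tail[OF G that C(1) _ C(2)] by simp
  have h0: "(h \<longlongrightarrow> 0) at_bot"
  proof -
    have "((\<lambda>t. exp t * (C + 1 - t)) \<longlongrightarrow> 0) at_bot" for C :: real by real_asymp
    then show ?thesis
    proof (rule Lim_transform_eventually)
      show "\<forall>\<^sub>F t in at_bot. exp t * (C + 1 - t) = h t"
        using eventually_le_at_bot[of 0] by eventually_elim (auto simp: h_def)
    qed
  qed
  have "convergent (\<lambda>n. G (- real n))"
  proof (rule convergent_of_tail_bound)
    show "norm (G (- real m) - G (- real n)) \<le> h (- real m)" if "m \<le> n" for m n
      using tail[of "- real n" "- real m"] that by simp
    have "filterlim (\<lambda>n. - real n) at_bot sequentially" by real_asymp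
    then show "(\<lambda>n. h (- real n)) \<longlonglongrightarrow> 0" by (rule filterlim_compose[OF h0])
  qed
  then obtain l where l: "(\<lambda>n. G (- real n)) \<longlonglongrightarrow> l" by (auto simp: convergent_def)
  have Gl: "norm (G t - l) \<le> h t" for t
  proof (rule Lim_norm_ubound)
    show "(\<lambda>n. G t - G (- real n)) \<longlonglongrightarrow> G t - l" by (intro tendsto_intros l)
    show "\<forall>\<^sub>F n in sequentially. norm (G t - G (- real n)) \<le> h t"
    proof -
      obtain M :: nat where "- t \<le> M" using real_arch_simple by blast
      then show ?thesis
        by (intro eventually_sequentiallyI[of M]) (use tail in \<open>auto\<close>)
    qed
  qed simp
  have Glim: "(G \<longlongrightarrow> l) at_bot"
    by (rule Lim_transform_eventually[OF tendsto_add[OF Lim_null_comparison[OF _ h0] tendsto_const[of l]], of "\<lambda>t. G t - l", simplified])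
      (use Gl in auto)
  have w0: "((\<lambda>s. exp s * \<omega> s) \<longlongrightarrow> 0) at_bot"
  proof (rule Lim_null_comparison[OF _ h0], intro always_eventually allI)
    fix s show "norm (exp s * \<omega> s) \<le> h s" using C(2)[of s] by (simp add: h_def abs_mult)
  qed
  have lim: "((\<lambda>s. young_integral exp \<omega> s t) \<longlongrightarrow> exp t * \<omega> t - (G t - l)) at_bot" for t
  proof (rule Lim_transform_eventually)
    show "((\<lambda>s. (exp t * \<omega> t - G t) - (exp s * \<omega> s - G s)) \<longlongrightarrow> exp t * \<omega> t - (G t - l)) at_bot"
      by (rule tendsto_eq_intros w0 Glim refl)+ simp
    show "\<forall>\<^sub>F s in at_bot. (exp t * \<omega> t - G t) - (exp s * \<omega> s - G s) = young_integral exp \<omega> s t"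
      using eventually_le_at_bot[of t]
      by eventually_elim (use young_integral_eq[OF young_integral_exp[OF G]] in auto)
  qed
  have OU: "OU t \<omega> = \<omega> t - exp (- t) * (G t - l)" for t
  proof -
    have "Lim at_bot (\<lambda>s. young_integral exp \<omega> s t) = exp t * \<omega> t - (G t - l)"
      using lim by (intro tendsto_Lim) (auto simp: trivial_limit_at_bot_linorder)
    then show ?thesis by (simp add: OU_def right_diff_distrib mult.assoc[symmetric] exp_minus)
  qed
  from G Glim lim OU show ?thesis by blast
qed

text \<open>The integral of \<open>exp (s - t) * \<omega> s\<close> over \<open>s \<le> t\<close>. By the equation that the process solves it is
  also a primitive of the process, and its sublinear growth says that time averages of the process
  tend to zero along every path.\<close>

definition ou_primitive :: "real \<Rightarrow> real" where
  "ou_primitive t = \<omega> t - OU t \<omega>"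

lemma ou_primitive_deriv: "(ou_primitive has_real_derivative OU t \<omega>) (at t)"
proof -
  obtain G l where G: "\<forall>t. (G has_vector_derivative exp t * \<omega> t) (at t)" "(G \<longlongrightarrow> l) at_bot"
    and OU: "\<forall>t. OU t \<omega> = \<omega> t - exp (- t) * (G t - l)" using OU_representation by blast
  note G = G(1)[rule_format] G(2) and OU = OU[rule_format]
  have "ou_primitive = (\<lambda>t. exp (- t) * (G t - l))"
    by (simp add: ou_primitive_def OU fun_eq_iff)
  moreover have "(G has_real_derivative exp t * \<omega> t) (at t)"
    using G by (simp add: has_real_derivative_iff_has_vector_derivative)
  ultimately show ?thesis
    by (auto intro!: derivative_eq_intros simp: OU exp_minus algebra_simps)
qed

lemma ou_primitive_bounded: "sublinearly_bounded ou_primitive"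
  unfolding sublinearly_bounded_def
proof (intro allI impI)
  fix \<epsilon> :: real assume e: "\<epsilon> > 0"
  obtain G l where G: "\<forall>t. (G has_vector_derivative exp t * \<omega> t) (at t)" "(G \<longlongrightarrow> l) at_bot"
    and OU: "\<forall>t. OU t \<omega> = \<omega> t - exp (- t) * (G t - l)" using OU_representation by blast
  note G = G(1)[rule_format] G(2) and OU = OU[rule_format]
  obtain C where C: "C > 0" "\<And>t. \<bar>\<omega> t\<bar> \<le> C + \<epsilon> * \<bar>t\<bar>"
    using sublinearly_boundedE[OF path_bounded e] by auto
  have "\<bar>ou_primitive t\<bar> \<le> (C + \<epsilon>) + \<epsilon> * \<bar>t\<bar>" for t
  proof -
    have "norm (G t - l) \<le> exp t * (C + \<epsilon> + \<epsilon> * \<bar>t\<bar>)"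
    proof (rule Lim_norm_ubound[where net = at_bot])
      show "((\<lambda>s. G t - G s) \<longlongrightarrow> G t - l) at_bot" by (intro tendsto_intros G)
      show "\<forall>\<^sub>F s in at_bot. norm (G t - G s) \<le> exp t * (C + \<epsilon> + \<epsilon> * \<bar>t\<bar>)"
        using eventually_le_at_bot[of t]
        by eventually_elim (use weighted_tail[OF G(1) _ C(1) e C(2)] in auto)
    qed (simp add: trivial_limit_at_bot_linorder)
    then show ?thesis
      by (simp add: ou_primitive_def OU abs_mult exp_minus field_simps)
  qed
  then show "\<exists>C>0. \<forall>t. \<bar>ou_primitive t\<bar> \<le> C + \<epsilon> * \<bar>t\<bar>"
    using C(1) e by (intro exI[of _ "C + \<epsilon>"]) auto
qed

lemma OU_bounded: "sublinearly_bounded (\<lambda>t. OU t \<omega>)"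
  using sublinearly_bounded_diff[OF path_bounded ou_primitive_bounded]
  by (simp add: ou_primitive_def)

lemma continuous_ou_primitive: "continuous_on S ou_primitive"
  using ou_primitive_deriv DERIV_isCont continuous_at_imp_continuous_on by blast

lemma continuous_OU: "continuous_on S (\<lambda>t. OU t \<omega>)"
proof -
  have "(\<lambda>t. OU t \<omega>) = (\<lambda>t. \<omega> t - ou_primitive t)" by (simp add: ou_primitive_def)
  then show ?thesis
    using continuous_on_diff[OF continuous_on_subset[OF cont] continuous_ou_primitive, of S]
    by (simp only: subset_UNIV)
qed

end

text \<open>The difference \<open>d\<close> of both sides solves \<open>d' = - d\<close> and grows sublinearly at minus infinity,
  which forces it to vanish. Comparing the defining Riemann sums is thereby avoided.\<close>

lemma OU_shift:
  assumes "regular_path \<alpha> \<omega>" "regular_path \<alpha> (wiener_shift \<tau> \<omega>)"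
  shows "OU t (wiener_shift \<tau> \<omega>) = OU (t + \<tau>) \<omega>"
proof -
  interpret A: regular_path \<alpha> \<omega> by fact
  interpret B: regular_path \<alpha> "wiener_shift \<tau> \<omega>" by fact
  define d where "d t = OU t (wiener_shift \<tau> \<omega>) - OU (t + \<tau>) \<omega>" for t
  define y where "y t = B.ou_primitive t - A.ou_primitive (t + \<tau>)" for t
  have yd: "y t = - \<omega> \<tau> - d t" for t
    unfolding y_def d_def B.ou_primitive_def A.ou_primitive_def by (simp add: wiener_shift_def)
  have "((\<lambda>t. exp t * (y t + \<omega> \<tau>)) has_real_derivative 0) (at t)" for t
  proof -
    have "((\<lambda>t. A.ou_primitive (t + \<tau>)) has_real_derivative OU (t + \<tau>) \<omega>) (at t)"
      using A.ou_primitive_deriv[of "t + \<tau>"] by (simp add: DERIV_shift)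
    then have "(y has_real_derivative d t) (at t)"
      unfolding y_def d_def by (intro DERIV_diff B.ou_primitive_deriv)
    then have "((\<lambda>t. exp t * (y t + \<omega> \<tau>)) has_real_derivative exp t * (y t + \<omega> \<tau>) + d t * exp t) (at t)"
      by (auto intro!: derivative_eq_intros)
    then show ?thesis by (simp add: yd algebra_simps)
  qed
  note der = this
  have const: "exp t * (y t + \<omega> \<tau>) = exp s * (y s + \<omega> \<tau>)" for s t
    by (rule DERIV_isconst_all[of "\<lambda>t. exp t * (y t + \<omega> \<tau>)", OF allI[OF der]])
  obtain C where C: "C > 0" "\<And>t. \<bar>B.ou_primitive t\<bar> \<le> C + 1 * \<bar>t\<bar>"
    using sublinearly_boundedE[OF B.ou_primitive_bounded, of 1] by auto
  obtain D where D: "D > 0" "\<And>t. \<bar>A.ou_primitive t\<bar> \<le> D + 1 * \<bar>t\<bar>"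
    using sublinearly_boundedE[OF A.ou_primitive_bounded, of 1] by auto
  define E where "E = C + D + \<bar>\<tau>\<bar> + \<bar>\<omega> \<tau>\<bar>"
  have "((\<lambda>s. exp s * (y s + \<omega> \<tau>)) \<longlongrightarrow> 0) at_bot"
  proof (rule Lim_null_comparison)
    show "\<forall>\<^sub>F s in at_bot. norm (exp s * (y s + \<omega> \<tau>)) \<le> exp s * (E - 2 * s)"
      using eventually_le_at_bot[of 0]
    proof eventually_elim
      fix s :: real assume "s \<le> 0"
      have "\<bar>y s + \<omega> \<tau>\<bar> \<le> E - 2 * s"
      proof -
        have "\<bar>s\<bar> = - s" "\<bar>s + \<tau>\<bar> \<le> - s + \<bar>\<tau>\<bar>" using \<open>s \<le> 0\<close> by auto
        moreover have "\<bar>y s + \<omega> \<tau>\<bar> \<le> \<bar>B.ou_primitive s\<bar> + \<bar>A.ou_primitive (s + \<tau>)\<bar> + \<bar>\<omega> \<tau>\<bar>"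
          unfolding y_def by simp
        ultimately show ?thesis using C(2)[of s] D(2)[of "s + \<tau>"] unfolding E_def by simp
      qed
      then show "norm (exp s * (y s + \<omega> \<tau>)) \<le> exp s * (E - 2 * s)" by (simp add: abs_mult)
    qed
    show "((\<lambda>s. exp s * (E - 2 * s)) \<longlongrightarrow> 0) at_bot" by real_asymp
  qed
  moreover have "(\<lambda>s. exp s * (y s + \<omega> \<tau>)) = (\<lambda>s. exp t * (y t + \<omega> \<tau>))" using const by blast
  ultimately have "exp t * (y t + \<omega> \<tau>) = 0"
    using tendsto_const_iff trivial_limit_at_bot_linorder by metis
  then show ?thesis using yd[of t] by (simp add: d_def)
qed

section \<open>Global solutions of ordinary differential equations\<close>

text \<open>The integral of \<open>g\<close> from \<open>0\<close> to \<open>t\<close>, moved to the unit interval: this form needs no case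
  distinction on the sign of \<open>t\<close> and is jointly measurable in \<open>t\<close> and in the parameters of \<open>g\<close>.\<close>

definition scaled_integral :: "(real \<Rightarrow> 'v::euclidean_space) \<Rightarrow> real \<Rightarrow> 'v" where
  "scaled_integral g t = t *\<^sub>R (LINT \<sigma>:{0..1}|lborel. g (\<sigma> * t))"

lemma chain_scale:
  fixes G :: "real \<Rightarrow> 'v::real_normed_vector"
  assumes "\<And>r. (G has_vector_derivative g r) (at r)"
  shows "((\<lambda>\<sigma>. G (\<sigma> * t)) has_vector_derivative t *\<^sub>R g (\<sigma> * t)) (at \<sigma>)"
proof -
  have "((\<lambda>\<sigma>. \<sigma> * t) has_vector_derivative t) (at \<sigma>)"
    by (auto intro!: derivative_eq_intros simp: has_real_derivative_iff_has_vector_derivative[symmetric])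
  from vector_diff_chain_at[OF this assms] show ?thesis by (simp add: o_def)
qed

lemma scaled_integral_eq:
  assumes "continuous_on UNIV g" and G: "\<And>r. (G has_vector_derivative g r) (at r)"
  shows "scaled_integral g t = G t - G 0"
proof -
  have c: "continuous_on {0..1} (\<lambda>\<sigma>. g (\<sigma> * t))"
    by (intro continuous_on_compose2[OF assms(1)] continuous_intros) auto
  have "((\<lambda>\<sigma>. t *\<^sub>R g (\<sigma> * t)) has_integral (G (1 * t) - G (0 * t))) {0..1}"
    by (rule fundamental_theorem_of_calculus)
      (use has_vector_derivative_at_within[OF chain_scale[OF G]] in auto)
  then have "integral {0..1} (\<lambda>\<sigma>. t *\<^sub>R g (\<sigma> * t)) = G t - G 0"
    by (metis integral_unique mult_1 mult_zero_left)
  moreover have "integral {0..1} (\<lambda>\<sigma>. t *\<^sub>R g (\<sigma> * t)) = t *\<^sub>R integral {0..1} (\<lambda>\<sigma>. g (\<sigma> * t))"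
    by (rule integral_cmul)
  moreover have "(LINT \<sigma>:{0..1}|lborel. g (\<sigma> * t)) = integral {0..1} (\<lambda>\<sigma>. g (\<sigma> * t))"
    by (rule set_borel_integral_eq_integral(2)[OF borel_integrable_atLeastAtMost'[OF c]])
  ultimately show ?thesis by (simp add: scaled_integral_def)
qed

lemma scaled_integral_deriv:
  assumes "continuous_on UNIV g"
  shows "(scaled_integral g has_vector_derivative g t) (at t)"
proof -
  obtain G where G: "\<And>r. (G has_vector_derivative g r) (at r)"
    using assms by (rule antiderivative_exists) (rule that)
  have "((\<lambda>r. G r - G 0) has_vector_derivative g t - 0) (at t)"
    by (intro has_vector_derivative_diff G has_vector_derivative_const)
  moreover have "scaled_integral g = (\<lambda>r. G r - G 0)"
    using scaled_integral_eq[OF assms G] by blast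
  ultimately show ?thesis by simp
qed

lemma scaled_integral_diff:
  assumes "continuous_on UNIV g" "continuous_on UNIV h"
  shows "scaled_integral g t - scaled_integral h t = scaled_integral (\<lambda>r. g r - h r) t"
proof -
  obtain G where G: "\<And>r. (G has_vector_derivative g r) (at r)"
    using assms(1) by (rule antiderivative_exists) (rule that)
  obtain Hh where Hh: "\<And>r. (Hh has_vector_derivative h r) (at r)"
    using assms(2) by (rule antiderivative_exists) (rule that)
  have "scaled_integral (\<lambda>r. g r - h r) t = (G t - Hh t) - (G 0 - Hh 0)"
    by (rule scaled_integral_eq) (auto intro!: continuous_intros assms has_vector_derivative_diff G Hh)
  then show ?thesis
    using scaled_integral_eq[OF assms(1) G] scaled_integral_eq[OF assms(2) Hh] by simp
qed

text \<open>A single comparison function \<open>Q\<close> of \<open>\<bar>t\<bar>\<close> serves both time directions.\<close>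

lemma scaled_integral_bound:
  assumes c: "continuous_on UNIV g"
    and bound: "\<And>r. \<bar>r\<bar> \<le> \<bar>t\<bar> \<Longrightarrow> norm (g r) \<le> q \<bar>r\<bar>"
    and Q: "\<And>r. (Q has_real_derivative q r) (at r)"
  shows "norm (scaled_integral g t) \<le> Q \<bar>t\<bar> - Q 0"
proof -
  obtain G where G: "\<And>r. (G has_vector_derivative g r) (at r)"
    using c by (rule antiderivative_exists) (rule that)
  have Q': "(Q has_vector_derivative q r) (at r)" for r
    using Q by (simp add: has_real_derivative_iff_has_vector_derivative)
  have "norm (G (1 * t) - G (0 * t)) \<le> Q (1 * \<bar>t\<bar>) - Q (0 * \<bar>t\<bar>)"
  proof (rule differentiable_bound_general[OF zero_less_one _ _ chain_scale[OF G] chain_scale[OF Q']])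
    show "continuous_on {0..1} (\<lambda>\<sigma>. G (\<sigma> * t))"
      by (rule has_vector_derivative_continuous_on[OF chain_scale[OF G]])
    show "continuous_on {0..1} (\<lambda>\<sigma>. Q (\<sigma> * \<bar>t\<bar>))"
      by (rule has_vector_derivative_continuous_on[OF chain_scale[OF Q']])
    fix \<sigma> :: real assume \<sigma>: "0 < \<sigma>" "\<sigma> < 1"
    have "norm (g (\<sigma> * t)) \<le> q \<bar>\<sigma> * t\<bar>" using \<sigma> by (intro bound) (simp add: abs_mult mult_left_le_one_le)
    then show "norm (t *\<^sub>R g (\<sigma> * t)) \<le> \<bar>t\<bar> *\<^sub>R q (\<sigma> * \<bar>t\<bar>)"
      using \<sigma> by (auto simp: abs_mult intro: mult_left_mono)
  qed
  then show ?thesis using scaled_integral_eq[OF c G, of t] by simp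
qed

primrec picard :: "(real \<Rightarrow> 'v \<Rightarrow> 'v::euclidean_space) \<Rightarrow> 'v \<Rightarrow> nat \<Rightarrow> real \<Rightarrow> 'v" where
  "picard F x 0 = (\<lambda>t. x)"
| "picard F x (Suc n) = (\<lambda>t. x + scaled_integral (\<lambda>r. F r (picard F x n r)) t)"

definition flow :: "(real \<Rightarrow> 'v \<Rightarrow> 'v::euclidean_space) \<Rightarrow> 'v \<Rightarrow> real \<Rightarrow> 'v" where
  "flow F x t = lim (\<lambda>n. picard F x n t)"

lemma norm2_deriv:
  fixes U :: "real \<Rightarrow> 'v::euclidean_space"
  assumes "(U has_vector_derivative U') (at t within S)"
  shows "((\<lambda>t. (norm (U t))\<^sup>2) has_real_derivative 2 * (U t \<bullet> U')) (at t within S)"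
proof -
  have "((\<lambda>t. U t \<bullet> U t) has_derivative (\<lambda>h. U t \<bullet> (h *\<^sub>R U') + (h *\<^sub>R U') \<bullet> U t)) (at t within S)"
    using assms unfolding has_vector_derivative_def by (intro has_derivative_inner)
  then show ?thesis
    by (simp add: has_field_derivative_def power2_norm_eq_inner inner_commute mult_commute_abs algebra_simps)
qed

text \<open>Continuity of the field enters only along continuous curves and is assumed in that form.\<close>

locale linear_growth_ode =
  fixes F :: "real \<Rightarrow> 'v::euclidean_space \<Rightarrow> 'v"
  assumes contF: "\<And>U. continuous_on UNIV U \<Longrightarrow> continuous_on UNIV (\<lambda>t. F t (U t))"
    and lipF: "\<And>T R. \<exists>K>0. \<forall>t u v. \<bar>t\<bar> \<le> T \<and> norm u \<le> R \<and> norm v \<le> R \<longrightarrow>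
      norm (F t u - F t v) \<le> K * norm (u - v)"
    and growthF: "\<And>T. \<exists>A>0. \<forall>t u. \<bar>t\<bar> \<le> T \<longrightarrow> norm (F t u) \<le> A * (1 + norm u)"
begin

definition solution :: "(real \<Rightarrow> 'v) \<Rightarrow> bool" where
  "solution U \<longleftrightarrow> (\<forall>t. (U has_vector_derivative F t (U t)) (at t))"

lemma continuous_picard: "continuous_on UNIV (picard F x n)"
proof (induction n)
  case (Suc n)
  have "continuous_on UNIV (scaled_integral (\<lambda>r. F r (picard F x n r)))"
    by (rule has_vector_derivative_continuous_on[OF scaled_integral_deriv[OF contF[OF Suc]]])
  then show ?case by (auto intro!: continuous_intros)
qed simp

text \<open>The comparison function solves the linear equation with the growth constant \<open>A\<close>. The iterates
  therefore stay in a fixed ball on bounded time intervals, where the field is Lipschitz, and the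
  classical iteration converges globally without truncating the field.\<close>

lemma picard_bound:
  assumes A: "A > 0" "\<And>t u. \<bar>t\<bar> \<le> T \<Longrightarrow> norm (F t u) \<le> A * (1 + norm u)" and "\<bar>t\<bar> \<le> T"
  shows "norm (picard F x n t) \<le> (1 + norm x) * exp (A * \<bar>t\<bar>) - 1"
  using assms(3)
proof (induction n arbitrary: t)
  case 0
  have "(1 + norm x) * 1 \<le> (1 + norm x) * exp (A * \<bar>t\<bar>)" using A by (intro mult_left_mono) auto
  then show ?case by simp
next
  case (Suc n)
  have "norm (scaled_integral (\<lambda>r. F r (picard F x n r)) t)
      \<le> (1 + norm x) * exp (A * \<bar>t\<bar>) - (1 + norm x) * exp (A * 0)"
  proof (rule scaled_integral_bound[where q = "\<lambda>r. A * ((1 + norm x) * exp (A * r))"])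
    fix r assume "\<bar>r\<bar> \<le> \<bar>t\<bar>"
    then have r: "\<bar>r\<bar> \<le> T" using Suc.prems by simp
    have "norm (F r (picard F x n r)) \<le> A * (1 + norm (picard F x n r))" by (rule A(2)[OF r])
    also have "\<dots> \<le> A * ((1 + norm x) * exp (A * \<bar>r\<bar>))"
      using Suc.IH[OF r] A(1) by (intro mult_left_mono) auto
    finally show "norm (F r (picard F x n r)) \<le> A * ((1 + norm x) * exp (A * \<bar>r\<bar>))" .
  qed (auto intro!: contF continuous_picard derivative_eq_intros)
  then show ?case
    using norm_triangle_ineq[of x "scaled_integral (\<lambda>r. F r (picard F x n r)) t"] by simp
qed

lemma picard_step:
  assumes B: "\<And>t n. \<bar>t\<bar> \<le> T \<Longrightarrow> norm (picard F x n t) \<le> B" and "K > 0"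
    and K: "\<And>t u v. \<bar>t\<bar> \<le> T \<Longrightarrow> norm u \<le> B \<Longrightarrow> norm v \<le> B \<Longrightarrow> norm (F t u - F t v) \<le> K * norm (u - v)"
    and "\<bar>t\<bar> \<le> T"
  shows "norm (picard F x (Suc n) t - picard F x n t) \<le> 2 * B * ((K * \<bar>t\<bar>) ^ n / fact n)"
  using assms(4)
proof (induction n arbitrary: t)
  case 0
  then show ?case
    using norm_triangle_ineq4[of "picard F x (Suc 0) t" "picard F x 0 t"] B[of t 0] B[of t "Suc 0"]
    by simp
next
  case (Suc n)
  have "picard F x (Suc (Suc n)) t - picard F x (Suc n) t
      = scaled_integral (\<lambda>r. F r (picard F x (Suc n) r)) t - scaled_integral (\<lambda>r. F r (picard F x n r)) t"
    by simp
  also have "\<dots> = scaled_integral (\<lambda>r. F r (picard F x (Suc n) r) - F r (picard F x n r)) t"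
    by (intro scaled_integral_diff contF continuous_picard)
  also have "norm \<dots> \<le> 2 * B * ((K * \<bar>t\<bar>) ^ Suc n / fact (Suc n)) - 2 * B * ((K * 0) ^ Suc n / fact (Suc n))"
  proof (rule scaled_integral_bound[where q = "\<lambda>r. K * (2 * B * ((K * r) ^ n / fact n))"])
    fix r assume "\<bar>r\<bar> \<le> \<bar>t\<bar>"
    then have r: "\<bar>r\<bar> \<le> T" using Suc.prems by simp
    have "norm (F r (picard F x (Suc n) r) - F r (picard F x n r))
        \<le> K * norm (picard F x (Suc n) r - picard F x n r)"
      by (rule K[OF r B[OF r] B[OF r]])
    also have "\<dots> \<le> K * (2 * B * ((K * \<bar>r\<bar>) ^ n / fact n))"
      using Suc.IH[OF r] \<open>K > 0\<close> by (intro mult_left_mono) auto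
    finally show "norm (F r (picard F x (Suc n) r) - F r (picard F x n r))
        \<le> K * (2 * B * ((K * \<bar>r\<bar>) ^ n / fact n))" .
  next
    fix r :: real
    have "((\<lambda>r. (K * r) ^ Suc n / fact (Suc n)) has_real_derivative
        (1 + real n) * (K * (K * r) ^ n) / fact (Suc n)) (at r)"
      using DERIV_cmult[OF DERIV_ident, of K r UNIV] by (intro DERIV_cdivide DERIV_power_Suc) simp
    also have "(1 + real n) * (K * (K * r) ^ n) / fact (Suc n) = K * ((K * r) ^ n / fact n)"
    proof -
      have "fact (Suc n) = (1 + real n) * fact n" by simp
      then show ?thesis by (simp only: mult_divide_mult_cancel_left_if) simp
    qed
    finally have "((\<lambda>r. 2 * B * ((K * r) ^ Suc n / fact (Suc n))) has_real_derivative
        2 * B * (K * ((K * r) ^ n / fact n))) (at r)"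
      by (rule DERIV_cmult)
    then show "((\<lambda>r. 2 * B * ((K * r) ^ Suc n / fact (Suc n))) has_real_derivative
        K * (2 * B * ((K * r) ^ n / fact n))) (at r)"
      by (simp only: mult_ac)
  qed (intro continuous_on_diff contF continuous_picard)
  finally show ?case by simp
qed

lemma picard_ball:
  obtains B K where "B \<ge> 0" "K > 0" "\<And>n t. \<bar>t\<bar> \<le> T \<Longrightarrow> norm (picard F x n t) \<le> B"
    "\<And>t u v. \<bar>t\<bar> \<le> T \<Longrightarrow> norm u \<le> B \<Longrightarrow> norm v \<le> B \<Longrightarrow> norm (F t u - F t v) \<le> K * norm (u - v)"
proof -
  obtain A where A: "A > 0" "\<And>t u. \<bar>t\<bar> \<le> T \<Longrightarrow> norm (F t u) \<le> A * (1 + norm u)"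
    using growthF[of T] by blast
  define B where "B = (1 + norm x) * exp (A * T)"
  have "B \<ge> 0" by (simp add: B_def)
  have B: "norm (picard F x n t) \<le> B" if "\<bar>t\<bar> \<le> T" for t n
  proof -
    have "(1 + norm x) * exp (A * \<bar>t\<bar>) \<le> B"
      unfolding B_def using A(1) that by (intro mult_left_mono) auto
    then show ?thesis using picard_bound[OF A that, of x n] by simp
  qed
  obtain K where "K > 0"
    "\<And>t u v. \<bar>t\<bar> \<le> T \<Longrightarrow> norm u \<le> B \<Longrightarrow> norm v \<le> B \<Longrightarrow> norm (F t u - F t v) \<le> K * norm (u - v)"
    using lipF[of T B] by blast
  with \<open>B \<ge> 0\<close> B show ?thesis using that by blast
qed

lemma picard_uniform_limit:
  "uniform_limit {-T..T} (picard F x) (flow F x) sequentially"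
proof -
  obtain B K where B0: "B \<ge> 0" and K0: "K > 0"
    and B: "\<And>n t. \<bar>t\<bar> \<le> T \<Longrightarrow> norm (picard F x n t) \<le> B"
    and K: "\<And>t u v. \<bar>t\<bar> \<le> T \<Longrightarrow> norm u \<le> B \<Longrightarrow> norm v \<le> B \<Longrightarrow> norm (F t u - F t v) \<le> K * norm (u - v)"
    by (rule picard_ball[of T x]) (rule that; assumption)
  have "uniform_limit {-T..T} (\<lambda>n t. \<Sum>i<n. picard F x (Suc i) t - picard F x i t)
      (\<lambda>t. \<Sum>i. picard F x (Suc i) t - picard F x i t) sequentially"
  proof (rule Weierstrass_m_test)
    show "summable (\<lambda>n. 2 * B * ((K * T) ^ n / fact n))"
      using summable_exp[of "K * T"] by (intro summable_mult) (simp add: divide_inverse mult.commute)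
    fix n t assume "t \<in> {-T..T}"
    then have t: "\<bar>t\<bar> \<le> T" by auto
    have "norm (picard F x (Suc n) t - picard F x n t) \<le> 2 * B * ((K * \<bar>t\<bar>) ^ n / fact n)"
      by (rule picard_step[OF B K0 K t])
    also have "\<dots> \<le> 2 * B * ((K * T) ^ n / fact n)"
      using t K0 B0 by (intro mult_left_mono divide_right_mono power_mono) auto
    finally show "norm (picard F x (Suc n) t - picard F x n t) \<le> 2 * B * ((K * T) ^ n / fact n)" .
  qed
  then have "uniform_limit {-T..T} (\<lambda>n t. x + (\<Sum>i<n. picard F x (Suc i) t - picard F x i t))
      (\<lambda>t. x + (\<Sum>i. picard F x (Suc i) t - picard F x i t)) sequentially"
    by (intro uniform_limit_intros)
  moreover have "(\<lambda>n t. x + (\<Sum>i<n. picard F x (Suc i) t - picard F x i t)) = picard F x"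
  proof (intro ext)
    fix n t show "x + (\<Sum>i<n. picard F x (Suc i) t - picard F x i t) = picard F x n t"
      using sum_lessThan_telescope[of "\<lambda>i. picard F x i t" n] by simp
  qed
  ultimately have *: "uniform_limit {-T..T} (picard F x)
      (\<lambda>t. x + (\<Sum>i. picard F x (Suc i) t - picard F x i t)) sequentially"
    by (simp only:)
  have "flow F x t = x + (\<Sum>i. picard F x (Suc i) t - picard F x i t)" if "t \<in> {-T..T}" for t
    unfolding flow_def by (rule limI) (rule tendsto_uniform_limitI[OF * that])
  then have "uniform_limit {-T..T} (picard F x) (flow F x) sequentially \<longleftrightarrow>
      uniform_limit {-T..T} (picard F x) (\<lambda>t. x + (\<Sum>i. picard F x (Suc i) t - picard F x i t)) sequentially"
    by (intro uniform_limit_cong' refl)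
  with * show ?thesis by (rule iffD2[rotated])
qed

lemma picard_tendsto: "(\<lambda>n. picard F x n t) \<longlonglongrightarrow> flow F x t"
  using tendsto_uniform_limitI[OF picard_uniform_limit[where T = "\<bar>t\<bar>" and x = x], of t]
  abs_ge_self[of t] abs_ge_minus_self[of t] by (simp add: minus_le_iff)

lemma continuous_flow: "continuous_on UNIV (flow F x)"
proof -
  have "isCont (flow F x) t" for t
  proof -
    have "continuous_on {-(\<bar>t\<bar> + 1)..\<bar>t\<bar> + 1} (flow F x)"
      by (rule uniform_limit_theorem[OF _ picard_uniform_limit])
        (auto intro!: always_eventually continuous_on_subset[OF continuous_picard])
    then show ?thesis by (rule continuous_on_interior) (auto simp: abs_real_def)
  qed
  then show ?thesis by (simp add: continuous_at_imp_continuous_on)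
qed

lemma flow_fixpoint: "flow F x t = x + scaled_integral (\<lambda>r. F r (flow F x r)) t"
proof -
  define T where "T = \<bar>t\<bar>"
  obtain B K where B0: "B \<ge> 0" and K0: "K > 0"
    and B: "\<And>n t. \<bar>t\<bar> \<le> T \<Longrightarrow> norm (picard F x n t) \<le> B"
    and K: "\<And>t u v. \<bar>t\<bar> \<le> T \<Longrightarrow> norm u \<le> B \<Longrightarrow> norm v \<le> B \<Longrightarrow> norm (F t u - F t v) \<le> K * norm (u - v)"
    by (rule picard_ball[of T x]) (rule that; assumption)
  have B': "norm (flow F x t) \<le> B" if "\<bar>t\<bar> \<le> T" for t
    by (rule Lim_norm_ubound[OF _ picard_tendsto]) (use B that in auto)
  let ?y = "x + scaled_integral (\<lambda>r. F r (flow F x r)) t"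
  have "(\<lambda>n. picard F x (Suc n) t) \<longlonglongrightarrow> ?y"
  proof (rule tendstoI)
    fix e :: real assume "e > 0"
    define d where "d = e / (K * T + 1)"
    have KT: "K * T + 1 > 0" using K0 by (simp add: T_def add_nonneg_pos)
    then have "d > 0" using \<open>e > 0\<close> by (simp add: d_def)
    have "\<forall>\<^sub>F n in sequentially. \<forall>r\<in>{-T..T}. dist (picard F x n r) (flow F x r) < d"
      by (rule uniform_limitD[OF picard_uniform_limit \<open>d > 0\<close>])
    then show "\<forall>\<^sub>F n in sequentially. dist (picard F x (Suc n) t) ?y < e"
    proof eventually_elim
      case (elim n)
      have "dist (picard F x (Suc n) t) ?y
          = norm (scaled_integral (\<lambda>r. F r (picard F x n r)) t - scaled_integral (\<lambda>r. F r (flow F x r)) t)"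
        by (simp add: dist_norm)
      also have "\<dots> = norm (scaled_integral (\<lambda>r. F r (picard F x n r) - F r (flow F x r)) t)"
        by (subst scaled_integral_diff) (auto intro: contF continuous_picard continuous_flow)
      also have "\<dots> \<le> (K * d) * \<bar>t\<bar> - (K * d) * 0"
      proof (rule scaled_integral_bound[where q = "\<lambda>_. K * d"])
        fix r assume "\<bar>r\<bar> \<le> \<bar>t\<bar>"
        then have r: "\<bar>r\<bar> \<le> T" by (simp add: T_def)
        have "norm (F r (picard F x n r) - F r (flow F x r)) \<le> K * norm (picard F x n r - flow F x r)"
          by (rule K[OF r B[OF r] B'[OF r]])
        also have "\<dots> \<le> K * d"
          using elim r K0 by (intro mult_left_mono) (auto simp: dist_norm abs_le_iff less_imp_le)
        finally show "norm (F r (picard F x n r) - F r (flow F x r)) \<le> K * d" .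
      qed (auto intro!: continuous_on_diff contF continuous_picard continuous_flow derivative_eq_intros)
      also have "\<dots> < (K * T + 1) * d" using \<open>d > 0\<close> by (simp add: T_def algebra_simps)
      also have "\<dots> = e" using KT by (simp add: d_def)
      finally show ?case .
    qed
  qed
  then show ?thesis using LIMSEQ_Suc[OF picard_tendsto] LIMSEQ_unique by blast
qed

lemma flow_solution: "solution (flow F x)" and flow_0: "flow F x 0 = x"
proof -
  have eq: "flow F x = (\<lambda>t. x + scaled_integral (\<lambda>r. F r (flow F x r)) t)"
    using flow_fixpoint by blast
  have "((\<lambda>t. x + scaled_integral (\<lambda>r. F r (flow F x r)) t) has_vector_derivative 0 + F t (flow F x t)) (at t)" for t
    by (intro has_vector_derivative_add has_vector_derivative_const scaled_integral_deriv contF continuous_flow)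
  then show "solution (flow F x)" unfolding solution_def by (simp flip: eq)
  show "flow F x 0 = x" by (subst flow_fixpoint) (simp add: scaled_integral_def)
qed

text \<open>The squared distance \<open>w\<close> of two solutions satisfies \<open>\<bar>w'\<bar> \<le> 2 * K * w\<close>, so a zero propagates in
  both time directions.\<close>

lemma solution_unique:
  assumes U: "solution U" and V: "solution V" and eq: "U s = V s"
  shows "U t = V t"
proof -
  define T where "T = max \<bar>s\<bar> \<bar>t\<bar>"
  have dU: "\<And>t. (U has_vector_derivative F t (U t)) (at t)" and dV: "\<And>t. (V has_vector_derivative F t (V t)) (at t)"
    using U V by (auto simp: solution_def)
  obtain A where A: "\<And>r. \<bar>r\<bar> \<le> T \<Longrightarrow> norm (U r) \<le> A"
    using continuous_bounded_on_interval[OF has_vector_derivative_continuous_on[OF dU]] by metis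
  obtain B where B: "\<And>r. \<bar>r\<bar> \<le> T \<Longrightarrow> norm (V r) \<le> B"
    using continuous_bounded_on_interval[OF has_vector_derivative_continuous_on[OF dV]] by metis
  obtain K where "K > 0" and K: "\<And>t u v. \<bar>t\<bar> \<le> T \<Longrightarrow> norm u \<le> max A B \<Longrightarrow> norm v \<le> max A B \<Longrightarrow>
      norm (F t u - F t v) \<le> K * norm (u - v)"
    using lipF[of T "max A B"] by blast
  define w where "w r = (norm (U r - V r))\<^sup>2" for r
  define w' where "w' r = 2 * ((U r - V r) \<bullet> (F r (U r) - F r (V r)))" for r
  have w: "(w has_real_derivative w' r) (at r)" for r
    unfolding w_def w'_def by (intro norm2_deriv has_vector_derivative_diff dU dV)
  have w'_le: "\<bar>w' r\<bar> \<le> 2 * K * w r" if "\<bar>r\<bar> \<le> T" for r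
  proof -
    have "\<bar>(U r - V r) \<bullet> (F r (U r) - F r (V r))\<bar> \<le> norm (U r - V r) * norm (F r (U r) - F r (V r))"
      by (rule Cauchy_Schwarz_ineq2)
    also have "\<dots> \<le> norm (U r - V r) * (K * norm (U r - V r))"
      using A[OF that] B[OF that] that by (intro mult_left_mono K) auto
    finally show ?thesis by (simp add: w_def w'_def power2_eq_square abs_mult mult_ac)
  qed
  have dw: "((\<lambda>r. w r * exp (c * r)) has_real_derivative (w' r + c * w r) * exp (c * r)) (at r)" for c r
    by (auto intro!: derivative_eq_intros w simp: algebra_simps)
  have "w s = 0" using eq by (simp add: w_def)
  have "w t = 0"
  proof (cases "s \<le> t")
    case True
    have "w s * exp (- (2 * K) * s) \<ge> w t * exp (- (2 * K) * t)"
    proof (rule DERIV_nonpos_imp_nonincreasing[OF True])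
      fix r assume "s \<le> r" "r \<le> t"
      then have "\<bar>w' r\<bar> \<le> 2 * K * w r" by (intro w'_le) (auto simp: T_def)
      then have "(w' r + - (2 * K) * w r) * exp (- (2 * K) * r) \<le> 0" by (intro mult_nonpos_nonneg) auto
      with dw show "\<exists>y. ((\<lambda>r. w r * exp (- (2 * K) * r)) has_real_derivative y) (at r) \<and> y \<le> 0" by blast
    qed
    then have "w t \<le> 0" using \<open>w s = 0\<close> by (simp add: mult_le_0_iff)
    then show ?thesis by (simp add: w_def)
  next
    case False
    then have "t \<le> s" by simp
    have "w t * exp (2 * K * t) \<le> w s * exp (2 * K * s)"
    proof (rule DERIV_nonneg_imp_nondecreasing[OF \<open>t \<le> s\<close>])
      fix r assume "t \<le> r" "r \<le> s"
      then have "\<bar>w' r\<bar> \<le> 2 * K * w r" by (intro w'_le) (auto simp: T_def)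
      then have "(w' r + 2 * K * w r) * exp (2 * K * r) \<ge> 0" by (intro mult_nonneg_nonneg) auto
      with dw show "\<exists>y. ((\<lambda>r. w r * exp (2 * K * r)) has_real_derivative y) (at r) \<and> 0 \<le> y" by blast
    qed
    then have "w t \<le> 0" using \<open>w s = 0\<close> by (simp add: mult_le_0_iff)
    then show ?thesis by (simp add: w_def)
  qed
  then show ?thesis by (simp add: w_def)
qed

end

section \<open>The random differential equation along one path\<close>

lemma sublinearly_bounded_cmult:
  assumes "sublinearly_bounded x"
  shows "sublinearly_bounded (\<lambda>t. c * x t)"
  unfolding sublinearly_bounded_def
proof (intro allI impI)
  fix \<epsilon> :: real assume "\<epsilon> > 0"
  then have "\<epsilon> / (\<bar>c\<bar> + 1) > 0" by (intro divide_pos_pos) auto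
  then obtain C where C: "C > 0" "\<And>t. \<bar>x t\<bar> \<le> C + \<epsilon> / (\<bar>c\<bar> + 1) * \<bar>t\<bar>"
    using sublinearly_boundedE[OF assms] by metis
  have "\<bar>c * x t\<bar> \<le> (\<bar>c\<bar> + 1) * C + \<epsilon> * \<bar>t\<bar>" for t
  proof -
    have "\<bar>c * x t\<bar> \<le> (\<bar>c\<bar> + 1) * \<bar>x t\<bar>" by (simp add: abs_mult mult_right_mono)
    also have "\<dots> \<le> (\<bar>c\<bar> + 1) * (C + \<epsilon> / (\<bar>c\<bar> + 1) * \<bar>t\<bar>)" by (intro mult_left_mono C) auto
    also have "\<dots> = (\<bar>c\<bar> + 1) * C + \<epsilon> * \<bar>t\<bar>" by (simp add: distrib_left)
    finally show ?thesis .
  qed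
  moreover have "(\<bar>c\<bar> + 1) * C > 0" using C(1) by (intro mult_pos_pos) auto
  ultimately show "\<exists>C>0. \<forall>t. \<bar>c * x t\<bar> \<le> C + \<epsilon> * \<bar>t\<bar>" by blast
qed

locale rde = regular_path \<alpha> \<omega> for \<alpha> \<omega> +
  fixes f :: "'v::euclidean_space \<Rightarrow> 'v" and a :: real and b :: 'v and l m \<mu> :: real
  assumes a: "a \<noteq> 0"
    and f_lip: "\<And>R. \<exists>K>0. \<forall>u v. norm u \<le> R \<and> norm v \<le> R \<longrightarrow> norm (f u - f v) \<le> K * norm (u - v)"
    and f_cont: "continuous_on UNIV f"
    and f_growth: "l > 0" "m > 0" "\<And>x. norm (f x) \<le> l * norm x + m"
    and f_diss: "\<mu> > 0" "\<And>x y. (x - y) \<bullet> (f x - f y) \<le> - \<mu> * (norm (x - y))\<^sup>2"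
begin

abbreviation ou :: "real \<Rightarrow> real" where "ou t \<equiv> OU t \<omega>"

abbreviation field :: "real \<Rightarrow> 'v \<Rightarrow> 'v" where "field \<equiv> rde_field f a b \<omega>"

text \<open>The change of variables between the two equations: if \<open>U\<close> solves the random differential
  equation, then \<open>to_state t (U t)\<close> solves the stochastic one.\<close>

abbreviation to_state :: "real \<Rightarrow> 'v \<Rightarrow> 'v" where
  "to_state t u \<equiv> exp (a * ou t) *\<^sub>R u + (exp (a * ou t) - 1) *\<^sub>R (b /\<^sub>R a)"

lemma field_diff:
  "field t u - field t v =
     exp (- a * ou t) *\<^sub>R (f (to_state t u) - f (to_state t v)) + (a * ou t) *\<^sub>R (u - v)"
  by (simp add: rde_field_def algebra_simps)

lemma to_state_diff: "to_state t u - to_state t v = exp (a * ou t) *\<^sub>R (u - v)"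
  by (simp add: algebra_simps)

lemma exp_ou_bounds:
  assumes "\<bar>a * ou t\<bar> \<le> c"
  shows "exp (a * ou t) \<le> exp c" "exp (- a * ou t) \<le> exp c" "1 \<le> exp c"
    "norm (to_state t u) \<le> exp c * norm u + (exp c + 1) * norm (b /\<^sub>R a)"
proof -
  show e: "exp (a * ou t) \<le> exp c" "exp (- a * ou t) \<le> exp c" "1 \<le> exp c" using assms by auto
  have "\<bar>exp (a * ou t) - 1\<bar> \<le> exp c + 1"
    using e(1) exp_gt_zero[of "a * ou t"] by linarith
  then have "\<bar>exp (a * ou t) - 1\<bar> * norm (b /\<^sub>R a) \<le> (exp c + 1) * norm (b /\<^sub>R a)"
    by (intro mult_right_mono) auto
  moreover have "\<bar>exp (a * ou t)\<bar> * norm u \<le> exp c * norm u" using e(1) by (intro mult_right_mono) auto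
  ultimately show "norm (to_state t u) \<le> exp c * norm u + (exp c + 1) * norm (b /\<^sub>R a)"
    using norm_triangle_ineq[of "exp (a * ou t) *\<^sub>R u" "(exp (a * ou t) - 1) *\<^sub>R (b /\<^sub>R a)"]
    unfolding norm_scaleR[of "exp (a * ou t)"] norm_scaleR[of "exp (a * ou t) - 1"] by linarith
qed

lemma field_lipschitz:
  "\<exists>K>0. \<forall>t u v. \<bar>t\<bar> \<le> T \<and> norm u \<le> R \<and> norm v \<le> R \<longrightarrow>
     norm (field t u - field t v) \<le> K * norm (u - v)"
proof -
  have "continuous_on UNIV (\<lambda>t. a * ou t)" by (intro continuous_intros continuous_OU)
  then obtain c where c: "c > 0" "\<And>t. \<bar>t\<bar> \<le> T \<Longrightarrow> norm (a * ou t) \<le> c"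
    using continuous_bounded_on_interval[of "\<lambda>t. a * ou t" T] by metis
  obtain K where K: "K > 0" "\<And>u v. norm u \<le> exp c * R + (exp c + 1) * norm (b /\<^sub>R a) \<Longrightarrow>
      norm v \<le> exp c * R + (exp c + 1) * norm (b /\<^sub>R a) \<Longrightarrow> norm (f u - f v) \<le> K * norm (u - v)"
    using f_lip by blast
  have "norm (field t u - field t v) \<le> (exp c * K * exp c + c) * norm (u - v)"
    if t: "\<bar>t\<bar> \<le> T" and uv: "norm u \<le> R" "norm v \<le> R" for t u v
  proof -
    have ac: "\<bar>a * ou t\<bar> \<le> c" using c(2)[OF t] by simp
    have st: "norm (to_state t w) \<le> exp c * R + (exp c + 1) * norm (b /\<^sub>R a)" if "norm w \<le> R" for w
    proof -
      have "exp c * norm w \<le> exp c * R" using that by simp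
      then show ?thesis using exp_ou_bounds(4)[OF ac, of w] by linarith
    qed
    have "norm (f (to_state t u) - f (to_state t v)) \<le> K * norm (to_state t u - to_state t v)"
      by (intro K(2) st uv)
    also have "\<dots> = K * (exp (a * ou t) * norm (u - v))" by (simp only: to_state_diff norm_scaleR abs_exp_cancel)
    also have "\<dots> \<le> K * (exp c * norm (u - v))"
      using exp_ou_bounds(1)[OF ac] K(1) by (intro mult_left_mono mult_right_mono) auto
    finally have fd: "norm (f (to_state t u) - f (to_state t v)) \<le> K * (exp c * norm (u - v))" .
    have "norm (field t u - field t v) \<le>
        exp (- a * ou t) * norm (f (to_state t u) - f (to_state t v)) + \<bar>a * ou t\<bar> * norm (u - v)"
      unfolding field_diff by (rule norm_triangle_le) (simp add: abs_mult)
    also have "\<dots> \<le> exp c * (K * (exp c * norm (u - v))) + c * norm (u - v)"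
      using exp_ou_bounds(2)[OF ac] fd ac by (intro add_mono mult_mono) auto
    also have "\<dots> = (exp c * K * exp c + c) * norm (u - v)" by (simp add: algebra_simps)
    finally show ?thesis .
  qed
  moreover have "exp c * K * exp c + c > 0" using c(1) K(1) by (intro add_pos_pos mult_pos_pos) auto
  ultimately show ?thesis by blast
qed

lemma field_zero_bound:
  assumes ac: "\<bar>a * ou t\<bar> \<le> c"
  shows "norm (field t 0) \<le> exp (2 * c) * (2 * l * norm (b /\<^sub>R a) + m + norm (b /\<^sub>R a))"
proof -
  define B where "B = norm (b /\<^sub>R a)"
  have "B \<ge> 0" by (simp add: B_def)
  have e1: "1 \<le> exp c" by (rule exp_ou_bounds(3)[OF ac])
  have ee: "exp (2 * c) = exp c * exp c" by (simp flip: exp_add)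
  have e2: "exp c \<le> exp c * exp c" using e1 by simp
  have "norm (f (to_state t 0)) \<le> l * norm (to_state t 0) + m" by (rule f_growth)
  also have "\<dots> \<le> l * ((exp c + 1) * B) + m"
    using exp_ou_bounds(4)[OF ac, of 0] f_growth(1) by (intro add_right_mono mult_left_mono) (auto simp: B_def)
  also have "\<dots> \<le> l * (2 * exp c * B) + exp c * m"
    using e1 f_growth \<open>B \<ge> 0\<close> by (intro add_mono mult_left_mono mult_right_mono) auto
  finally have f0: "norm (f (to_state t 0)) \<le> exp c * (2 * l * B + m)" by (simp add: algebra_simps)
  have "\<bar>a * ou t\<bar> \<le> exp c" using ac exp_ge_add_one_self[of c] by linarith
  moreover have "norm (ou t *\<^sub>R b) = \<bar>a * ou t\<bar> * B" using a by (simp add: B_def abs_mult field_simps)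
  ultimately have ob: "norm (ou t *\<^sub>R b) \<le> exp c * exp c * B"
    using mult_right_mono[of "\<bar>a * ou t\<bar>" "exp c * exp c" B] e2 \<open>B \<ge> 0\<close> by linarith
  have "norm (field t 0) \<le> exp (- a * ou t) * norm (f (to_state t 0)) + norm (ou t *\<^sub>R b)"
    unfolding rde_field_def by (rule norm_triangle_le) simp
  also have "\<dots> \<le> exp c * (exp c * (2 * l * B + m)) + exp c * exp c * B"
    using exp_ou_bounds(2)[OF ac] f0 ob by (intro add_mono mult_mono) auto
  also have "\<dots> = exp (2 * c) * (2 * l * B + m + B)" unfolding ee by (simp add: algebra_simps)
  finally show ?thesis by (simp add: B_def)
qed

lemma field_linear_growth: "\<exists>A>0. \<forall>t u. \<bar>t\<bar> \<le> T \<longrightarrow> norm (field t u) \<le> A * (1 + norm u)"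
proof -
  have "continuous_on UNIV (\<lambda>t. a * ou t)" by (intro continuous_intros continuous_OU)
  then obtain c where c: "c > 0" "\<And>t. \<bar>t\<bar> \<le> T \<Longrightarrow> norm (a * ou t) \<le> c"
    using continuous_bounded_on_interval[of "\<lambda>t. a * ou t" T] by metis
  define B where "B = norm (b /\<^sub>R a)"
  have "B \<ge> 0" by (simp add: B_def)
  define A where "A = exp c * (l * exp c + l * ((exp c + 1) * B) + m) + c + c * B"
  have "exp c * (l * exp c + l * ((exp c + 1) * B) + m) \<ge> 0" "c * B \<ge> 0"
    using c(1) f_growth \<open>B \<ge> 0\<close> by (auto intro!: add_nonneg_nonneg mult_nonneg_nonneg)
  then have pos: "A > 0" unfolding A_def using c(1) by linarith
  have "norm (field t u) \<le> A * (1 + norm u)" if t: "\<bar>t\<bar> \<le> T" for t u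
  proof -
    have ac: "\<bar>a * ou t\<bar> \<le> c" using c(2)[OF t] by simp
    have "norm (f (to_state t u)) \<le> l * norm (to_state t u) + m" by (rule f_growth)
    also have "\<dots> \<le> l * (exp c * norm u + (exp c + 1) * B) + m"
      using exp_ou_bounds(4)[OF ac, of u] f_growth(1) by (intro add_right_mono mult_left_mono) (auto simp: B_def)
    finally have f1: "norm (f (to_state t u)) \<le> l * (exp c * norm u + (exp c + 1) * B) + m" .
    have "norm (ou t *\<^sub>R (a *\<^sub>R u + b)) = \<bar>a * ou t\<bar> * norm (u + b /\<^sub>R a)"
    proof -
      have "ou t *\<^sub>R (a *\<^sub>R u + b) = (a * ou t) *\<^sub>R (u + b /\<^sub>R a)" using a by (simp add: algebra_simps)
      then show ?thesis by simp
    qed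
    also have "\<dots> \<le> c * (norm u + B)"
      using ac norm_triangle_ineq[of u "b /\<^sub>R a"] by (intro mult_mono) (auto simp: B_def)
    finally have o1: "norm (ou t *\<^sub>R (a *\<^sub>R u + b)) \<le> c * (norm u + B)" .
    have "norm (field t u) \<le> exp (- a * ou t) * norm (f (to_state t u)) + norm (ou t *\<^sub>R (a *\<^sub>R u + b))"
      unfolding rde_field_def by (rule norm_triangle_le) simp
    also have "\<dots> \<le> exp c * (l * (exp c * norm u + (exp c + 1) * B) + m) + c * (norm u + B)"
      using exp_ou_bounds(2)[OF ac] f1 o1 by (intro add_mono mult_mono) auto
    also have "\<dots> = (exp c * (l * ((exp c + 1) * B) + m) + c * B) * 1 + (exp c * l * exp c + c) * norm u"
      by (simp add: algebra_simps)
    also have "\<dots> \<le> A * 1 + A * norm u"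
      using c(1) f_growth \<open>B \<ge> 0\<close> by (intro add_mono mult_right_mono) (auto simp: A_def distrib_left)
    finally show ?thesis by (simp add: distrib_left)
  qed
  with pos show ?thesis by blast
qed

sublocale ode: linear_growth_ode field
proof
  fix U :: "real \<Rightarrow> 'v" assume "continuous_on UNIV U"
  then have "continuous_on UNIV (\<lambda>t. to_state t (U t))" by (intro continuous_intros continuous_OU)
  then have "continuous_on UNIV (\<lambda>t. f (to_state t (U t)))"
    by (rule continuous_on_compose2[OF f_cont]) auto
  then show "continuous_on UNIV (\<lambda>t. field t (U t))"
    unfolding rde_field_def by (intro continuous_intros continuous_OU \<open>continuous_on UNIV U\<close>)
qed (rule field_lipschitz field_linear_growth)+

lemma solution_iff: "rde_solution_on UNIV f a b \<omega> U \<longleftrightarrow> ode.solution U"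
  by (simp add: rde_solution_on_def ode.solution_def)

text \<open>The change of variables is affine in the state, so the noise enters the difference of two
  solutions only through the scalar factor \<open>a * ou t\<close>.\<close>

lemma field_dissipative: "(u - v) \<bullet> (field t u - field t v) \<le> (a * ou t - \<mu>) * (norm (u - v))\<^sup>2"
proof -
  have uv: "u - v = exp (- a * ou t) *\<^sub>R (to_state t u - to_state t v)"
    by (simp only: to_state_diff) (simp flip: exp_add)
  have "(u - v) \<bullet> (f (to_state t u) - f (to_state t v))
      = exp (- a * ou t) * ((to_state t u - to_state t v) \<bullet> (f (to_state t u) - f (to_state t v)))"
    by (subst uv) (rule inner_scaleR_left)
  also have "\<dots> \<le> exp (- a * ou t) * (- \<mu> * (norm (to_state t u - to_state t v))\<^sup>2)"
    by (intro mult_left_mono f_diss) auto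
  also have "\<dots> = - \<mu> * (exp (a * ou t) * (norm (u - v))\<^sup>2)"
    by (simp only: to_state_diff norm_scaleR power_mult_distrib abs_exp_cancel)
      (simp add: power2_eq_square exp_minus field_simps)
  finally have "exp (- a * ou t) * ((u - v) \<bullet> (f (to_state t u) - f (to_state t v)))
      \<le> exp (- a * ou t) * (- \<mu> * (exp (a * ou t) * (norm (u - v))\<^sup>2))"
    by (intro mult_left_mono) auto
  also have "\<dots> = - \<mu> * (norm (u - v))\<^sup>2" by (simp add: exp_minus field_simps)
  finally have "exp (- a * ou t) * ((u - v) \<bullet> (f (to_state t u) - f (to_state t v))) \<le> - \<mu> * (norm (u - v))\<^sup>2" .
  moreover have "(u - v) \<bullet> (field t u - field t v)
      = exp (- a * ou t) * ((u - v) \<bullet> (f (to_state t u) - f (to_state t v))) + a * ou t * (norm (u - v))\<^sup>2"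
    unfolding field_diff power2_norm_eq_inner inner_add_right inner_scaleR_right ..
  ultimately show ?thesis unfolding left_diff_distrib by linarith
qed

text \<open>From time \<open>s\<close> to \<open>t\<close> two solutions contract by the factor \<open>exp (rate s - rate t)\<close>: \<open>a * ou_primitive\<close> is a
  primitive of \<open>a * ou\<close>, and it is negligible against \<open>\<mu> * t\<close>.\<close>

definition rate :: "real \<Rightarrow> real" where
  "rate t = \<mu> * t - a * ou_primitive t"

lemma rate_deriv: "(rate has_real_derivative \<mu> - a * ou t) (at t)"
  unfolding rate_def[abs_def] by (auto intro!: derivative_eq_intros ou_primitive_deriv)

lemma rate_lower:
  assumes "\<epsilon> > 0"
  obtains C where "C > 0" "\<And>t. \<bar>rate t - \<mu> * t\<bar> \<le> C + \<epsilon> * \<bar>t\<bar>"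
proof -
  obtain C where "C > 0" "\<And>t. \<bar>a * ou_primitive t\<bar> \<le> C + \<epsilon> * \<bar>t\<bar>"
    using sublinearly_boundedE[OF sublinearly_bounded_cmult[OF ou_primitive_bounded] assms] by metis
  then show ?thesis using that[of C] by (simp add: rate_def)
qed

lemma contraction:
  assumes U: "rde_solution_on {t0..} f a b \<omega> U" and V: "rde_solution_on {t0..} f a b \<omega> V"
    and "t0 \<le> s" "s \<le> t"
  shows "(norm (U t - V t))\<^sup>2 \<le> (norm (U s - V s))\<^sup>2 * exp (2 * (rate s - rate t))"
proof -
  define w where "w r = (norm (U r - V r))\<^sup>2" for r
  define w' where "w' r = (U r - V r) \<bullet> (field r (U r) - field r (V r))" for r
  have within: "(w has_real_derivative 2 * w' r) (at r within {t0..})"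
    if "t0 \<le> r" for r
    unfolding w_def w'_def using U V that
    by (intro norm2_deriv has_vector_derivative_diff) (auto simp: rde_solution_on_def)
  have "w t * exp (2 * rate t) \<le> w s * exp (2 * rate s)"
  proof (rule DERIV_nonpos_imp_decreasing_open[OF \<open>s \<le> t\<close>])
    fix r assume r: "s < r" "r < t"
    then have "(w has_real_derivative 2 * w' r) (at r within {s<..<t})"
      using \<open>t0 \<le> s\<close> by (intro DERIV_subset[OF within]) auto
    then have dw: "(w has_real_derivative 2 * w' r) (at r)"
      using r at_within_open[of r "{s<..<t}"] by simp
    have "((\<lambda>r. w r * exp (2 * rate r)) has_real_derivative
        2 * w' r * exp (2 * rate r) + exp (2 * rate r) * (2 * (\<mu> - a * ou r)) * w r) (at r)"
      by (intro DERIV_mult dw DERIV_fun_exp DERIV_cmult rate_deriv)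
    moreover have "2 * w' r * exp (2 * rate r) + exp (2 * rate r) * (2 * (\<mu> - a * ou r)) * w r
        = 2 * (w' r - (a * ou r - \<mu>) * w r) * exp (2 * rate r)"
      by (simp add: algebra_simps)
    moreover have "2 * (w' r - (a * ou r - \<mu>) * w r) * exp (2 * rate r) \<le> 0"
      using field_dissipative[of "U r" "V r" r] by (intro mult_nonpos_nonneg[of "2 * (_ - _)"]) (auto simp: w_def w'_def)
    ultimately show "\<exists>y. ((\<lambda>r. w r * exp (2 * rate r)) has_real_derivative y) (at r) \<and> y \<le> 0" by auto
  next
    have "continuous_on {t0..} w"
      using within by (intro DERIV_continuous_on) auto
    moreover have "continuous_on {s..t} rate"
      using rate_deriv DERIV_isCont continuous_at_imp_continuous_on by blast
    ultimately show "continuous_on {s..t} (\<lambda>r. w r * exp (2 * rate r))"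
      using \<open>t0 \<le> s\<close> by (intro continuous_intros) (auto elim: continuous_on_subset)
  qed
  then have "w t \<le> w s * exp (2 * rate s) / exp (2 * rate t)" by (simp add: field_simps)
  also have "\<dots> = w s * exp (2 * (rate s - rate t))" by (simp add: exp_diff right_diff_distrib)
  finally show ?thesis by (simp add: w_def)
qed

lemma contraction_global:
  assumes "ode.solution U" "ode.solution V" "s \<le> t"
  shows "(norm (U t - V t))\<^sup>2 \<le> (norm (U s - V s))\<^sup>2 * exp (2 * (rate s - rate t))"
  using assms by (intro contraction[of s])
    (auto simp: rde_solution_on_def ode.solution_def intro: has_vector_derivative_at_within)

lemma exp_rate_tendsto: "((\<lambda>t. exp (2 * (c - rate t))) \<longlongrightarrow> 0) at_top"
proof -
  obtain C where C: "\<And>t. \<bar>rate t - \<mu> * t\<bar> \<le> C + \<mu> / 2 * \<bar>t\<bar>"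
    using rate_lower[of "\<mu> / 2"] f_diss(1) by auto
  show ?thesis
  proof (rule Lim_null_comparison)
    show "\<forall>\<^sub>F t in at_top. norm (exp (2 * (c - rate t))) \<le> exp (2 * (c + C) - \<mu> * t)"
      using eventually_ge_at_top[of 0]
    proof eventually_elim
      case (elim t)
      then have "2 * (c - rate t) \<le> 2 * (c + C) - \<mu> * t" using C[of t] by (simp add: abs_le_iff)
      then show ?case by simp
    qed
    show "((\<lambda>t. exp (2 * (c + C) - \<mu> * t)) \<longlongrightarrow> 0) at_top" using f_diss(1) by real_asymp
  qed
qed

lemma solutions_merge:
  assumes U: "rde_solution_on {t0..} f a b \<omega> U" and V: "rde_solution_on {t0..} f a b \<omega> V"
  shows "((\<lambda>t. (norm (U t - V t))\<^sup>2) \<longlongrightarrow> 0) at_top"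
proof (rule Lim_null_comparison)
  show "\<forall>\<^sub>F t in at_top. norm ((norm (U t - V t))\<^sup>2) \<le> (norm (U t0 - V t0))\<^sup>2 * exp (2 * (rate t0 - rate t))"
    using eventually_ge_at_top[of t0] by eventually_elim (use contraction[OF U V order_refl] in auto)
  show "((\<lambda>t. (norm (U t0 - V t0))\<^sup>2 * exp (2 * (rate t0 - rate t))) \<longlongrightarrow> 0) at_top"
    by (rule tendsto_mult_right_zero[OF exp_rate_tendsto])
qed

lemma field_zero_growth:
  assumes "\<epsilon> > 0"
  obtains C where "C > 0" "\<And>t. norm (field t 0) \<le> C * exp (\<epsilon> * \<bar>t\<bar>)"
proof -
  have "\<epsilon> / 2 > 0" using assms by simp
  then obtain c where c: "c > 0" "\<And>t. \<bar>a * ou t\<bar> \<le> c + \<epsilon> / 2 * \<bar>t\<bar>"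
    using sublinearly_boundedE[OF sublinearly_bounded_cmult[OF OU_bounded]] by metis
  define D where "D = 2 * l * norm (b /\<^sub>R a) + m + norm (b /\<^sub>R a)"
  have "D > 0" unfolding D_def using f_growth by (intro add_pos_nonneg add_nonneg_pos) auto
  have "norm (field t 0) \<le> (exp (2 * c) * D) * exp (\<epsilon> * \<bar>t\<bar>)" for t
  proof -
    have "norm (field t 0) \<le> exp (2 * (c + \<epsilon> / 2 * \<bar>t\<bar>)) * D"
      unfolding D_def by (rule field_zero_bound[OF c(2)])
    also have "exp (2 * (c + \<epsilon> / 2 * \<bar>t\<bar>)) = exp (2 * c) * exp (\<epsilon> * \<bar>t\<bar>)" by (simp flip: exp_add)
    finally show ?thesis by (simp add: mult_ac)
  qed
  then show ?thesis using that[of "exp (2 * c) * D"] \<open>D > 0\<close> by simp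
qed

text \<open>Dissipativity, applied against the zero state, gives a linear differential inequality for the
  squared norm with forcing \<open>(norm (field t 0))\<^sup>2 / \<mu>\<close>. The bound is independent of the starting
  time \<open>- r\<close> because the primitive \<open>\<Phi>\<close> of the weighted forcing vanishes at minus infinity.\<close>

lemma apriori:
  assumes "\<epsilon> > 0"
  obtains C where "C > 0"
    "\<And>r U t. ode.solution U \<Longrightarrow> U (- r) = 0 \<Longrightarrow> - r \<le> t \<Longrightarrow> (norm (U t))\<^sup>2 \<le> C * exp (\<epsilon> * \<bar>t\<bar>)"
proof -
  \<comment> \<open>The forcing costs \<open>4 \<delta>\<close>, undoing the weight another \<open>2 \<delta>\<close>; \<open>8 \<delta> \<le> \<mu>\<close> keeps \<open>\<mu> - \<eta>\<close> positive.\<close>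
  define \<delta> where "\<delta> = min (\<epsilon> / 6) (\<mu> / 8)"
  have \<delta>: "\<delta> > 0" "6 * \<delta> \<le> \<epsilon>" "8 * \<delta> \<le> \<mu>" using assms f_diss(1) by (auto simp: \<delta>_def min_def)
  obtain G where G: "G > 0" "\<And>t. norm (field t 0) \<le> G * exp (\<delta> * \<bar>t\<bar>)"
    using field_zero_growth[OF \<delta>(1)] by metis
  obtain c where c: "c > 0" "\<And>t. \<bar>a * ou_primitive t\<bar> \<le> c + \<delta> * \<bar>t\<bar>"
    using sublinearly_boundedE[OF sublinearly_bounded_cmult[OF ou_primitive_bounded] \<delta>(1)] by metis
  define \<eta> where "\<eta> = 4 * \<delta>"
  have \<eta>: "\<eta> > 0" "\<mu> - \<eta> \<ge> \<mu> / 2" "\<mu> - \<eta> > 0" using \<delta> f_diss(1) by (auto simp: \<eta>_def)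
  define \<kappa> where "\<kappa> t = \<mu> * t - 2 * (a * ou_primitive t)" for t
  define D where "D = exp (2 * c) * G\<^sup>2 / \<mu>"
  have "D > 0" using G(1) f_diss(1) by (simp add: D_def)
  \<comment> \<open>The two exponentials together dominate \<open>exp (\<mu> * t + \<eta> * \<bar>t\<bar>)\<close> on both half lines.\<close>
  define \<Phi> where "\<Phi> t = D * (exp ((\<mu> + \<eta>) * t) / (\<mu> + \<eta>) + exp ((\<mu> - \<eta>) * t) / (\<mu> - \<eta>))" for t
  have \<Phi>_deriv: "(\<Phi> has_real_derivative D * (exp ((\<mu> + \<eta>) * t) + exp ((\<mu> - \<eta>) * t))) (at t)" for t
  proof -
    have "((\<lambda>t. exp (k * t) / k) has_real_derivative exp (k * t)) (at t)" if "k > 0" for k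
      using that by (auto intro!: derivative_eq_intros)
    then show ?thesis unfolding \<Phi>_def[abs_def] using \<eta> f_diss(1) by (intro DERIV_cmult DERIV_add) auto
  qed
  have \<kappa>_deriv: "(\<kappa> has_real_derivative \<mu> - 2 * (a * ou t)) (at t)" for t
    unfolding \<kappa>_def[abs_def] by (auto intro!: derivative_eq_intros ou_primitive_deriv)
  have forcing: "exp (\<kappa> t) * ((norm (field t 0))\<^sup>2 / \<mu>) \<le> D * (exp ((\<mu> + \<eta>) * t) + exp ((\<mu> - \<eta>) * t))" for t
  proof -
    have "(norm (field t 0))\<^sup>2 \<le> (G * exp (\<delta> * \<bar>t\<bar>))\<^sup>2" by (intro power_mono G) auto
    also have "\<dots> = G\<^sup>2 * exp (2 * \<delta> * \<bar>t\<bar>)"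
      by (simp add: power_mult_distrib exp_double[symmetric] mult_ac)
    finally have g: "(norm (field t 0))\<^sup>2 \<le> G\<^sup>2 * exp (2 * \<delta> * \<bar>t\<bar>)" .
    have "\<kappa> t \<le> \<mu> * t + 2 * c + 2 * \<delta> * \<bar>t\<bar>" using c(2)[of t] by (auto simp: \<kappa>_def abs_le_iff)
    then have "exp (\<kappa> t) * ((norm (field t 0))\<^sup>2 / \<mu>)
        \<le> exp (\<mu> * t + 2 * c + 2 * \<delta> * \<bar>t\<bar>) * (G\<^sup>2 * exp (2 * \<delta> * \<bar>t\<bar>) / \<mu>)"
      using g f_diss(1) by (intro mult_mono divide_right_mono) auto
    also have "\<dots> = D * exp (\<mu> * t + \<eta> * \<bar>t\<bar>)"
      by (simp add: D_def \<eta>_def exp_add[symmetric] mult_ac flip: exp_add)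
    also have "exp (\<mu> * t + \<eta> * \<bar>t\<bar>) \<le> exp ((\<mu> + \<eta>) * t) + exp ((\<mu> - \<eta>) * t)"
      by (cases "t \<ge> 0") (auto simp: algebra_simps)
    finally show ?thesis using \<open>D > 0\<close> by simp
  qed
  define C where "C = D * (4 / \<mu>) * exp (2 * c)"
  have "C > 0" using \<open>D > 0\<close> f_diss(1) by (simp add: C_def)
  moreover have "(norm (U t))\<^sup>2 \<le> C * exp (\<epsilon> * \<bar>t\<bar>)"
    if U: "ode.solution U" and U0: "U (- r) = 0" and "- r \<le> t" for U r t
  proof -
    define w where "w s = (norm (U s))\<^sup>2" for s
    define w' where "w' s = U s \<bullet> field s (U s)" for s
    have dw: "(w has_real_derivative 2 * w' s) (at s)" for s
      unfolding w_def w'_def using U by (intro norm2_deriv) (auto simp: ode.solution_def)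
    have ineq: "2 * w' s \<le> (2 * (a * ou s) - \<mu>) * w s + (norm (field s 0))\<^sup>2 / \<mu>" for s
    proof -
      define n g where "n = norm (U s)" and "g = norm (field s 0)"
      have "w' s = (U s - 0) \<bullet> (field s (U s) - field s 0) + U s \<bullet> field s 0"
        by (simp add: w'_def inner_diff_right)
      also have "\<dots> \<le> (a * ou s - \<mu>) * w s + n * g"
        using field_dissipative[of "U s" 0 s] norm_cauchy_schwarz[of "U s" "field s 0"]
        by (intro add_mono) (auto simp: w_def n_def g_def)
      finally have "2 * w' s \<le> 2 * ((a * ou s - \<mu>) * w s + n * g)"
        by simp
      moreover have "2 * (n * g) \<le> \<mu> * w s + g\<^sup>2 / \<mu>"
      proof -
        have "0 \<le> (\<mu> * n - g)\<^sup>2 / \<mu>" using f_diss(1) by simp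
        also have "\<dots> = \<mu> * n\<^sup>2 - 2 * (n * g) + g\<^sup>2 / \<mu>"
          using f_diss(1) by (simp add: power2_eq_square field_simps)
        finally show ?thesis by (simp add: w_def n_def)
      qed
      ultimately show ?thesis by (simp add: algebra_simps g_def)
    qed
    have "w t * exp (\<kappa> t) - \<Phi> t \<le> w (- r) * exp (\<kappa> (- r)) - \<Phi> (- r)"
    proof (rule DERIV_nonpos_imp_nonincreasing[OF \<open>- r \<le> t\<close>], intro exI conjI)
      fix s
      show "((\<lambda>s. w s * exp (\<kappa> s) - \<Phi> s) has_real_derivative
          2 * w' s * exp (\<kappa> s) + exp (\<kappa> s) * (\<mu> - 2 * (a * ou s)) * w s
            - D * (exp ((\<mu> + \<eta>) * s) + exp ((\<mu> - \<eta>) * s))) (at s)"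
        by (intro DERIV_diff DERIV_mult dw DERIV_fun_exp \<kappa>_deriv \<Phi>_deriv)
      have "2 * w' s * exp (\<kappa> s) + exp (\<kappa> s) * (\<mu> - 2 * (a * ou s)) * w s
          = (2 * w' s - (2 * (a * ou s) - \<mu>) * w s) * exp (\<kappa> s)"
        by (simp add: algebra_simps)
      also have "\<dots> \<le> (norm (field s 0))\<^sup>2 / \<mu> * exp (\<kappa> s)"
        using ineq[of s] by (intro mult_right_mono) auto
      also have "\<dots> \<le> D * (exp ((\<mu> + \<eta>) * s) + exp ((\<mu> - \<eta>) * s))" using forcing[of s] by (simp add: mult_ac)
      finally show "2 * w' s * exp (\<kappa> s) + exp (\<kappa> s) * (\<mu> - 2 * (a * ou s)) * w s
            - D * (exp ((\<mu> + \<eta>) * s) + exp ((\<mu> - \<eta>) * s)) \<le> 0" by simp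
    qed
    moreover have "w (- r) = 0" by (simp add: w_def U0)
    moreover have "\<Phi> (- r) \<ge> 0" using \<open>D > 0\<close> \<eta> f_diss(1) by (simp add: \<Phi>_def)
    ultimately have "w t * exp (\<kappa> t) \<le> \<Phi> t" by simp
    also have "\<Phi> t \<le> D * (exp (\<mu> * t + \<eta> * \<bar>t\<bar>) / (\<mu> / 2) + exp (\<mu> * t + \<eta> * \<bar>t\<bar>) / (\<mu> / 2))"
      unfolding \<Phi>_def
    proof (intro mult_left_mono add_mono frac_le)
      have "\<eta> * t \<le> \<eta> * \<bar>t\<bar>" "\<eta> * (- t) \<le> \<eta> * \<bar>t\<bar>" using \<eta>(1) by (intro mult_left_mono; simp)+
      then show "exp ((\<mu> + \<eta>) * t) \<le> exp (\<mu> * t + \<eta> * \<bar>t\<bar>)" "exp ((\<mu> - \<eta>) * t) \<le> exp (\<mu> * t + \<eta> * \<bar>t\<bar>)"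
        by (auto simp: algebra_simps)
    qed (use \<open>D > 0\<close> \<eta> f_diss(1) in auto)
    also have "\<dots> = D * (4 / \<mu>) * exp (\<mu> * t + \<eta> * \<bar>t\<bar>)" by (simp add: field_simps)
    finally have "w t * exp (\<kappa> t) \<le> D * (4 / \<mu>) * exp (\<mu> * t + \<eta> * \<bar>t\<bar>)" .
    then have "w t \<le> D * (4 / \<mu>) * exp (\<mu> * t + \<eta> * \<bar>t\<bar>) / exp (\<kappa> t)"
      by (simp only: pos_le_divide_eq exp_gt_zero)
    also have "\<dots> = D * (4 / \<mu>) * exp (\<mu> * t + \<eta> * \<bar>t\<bar> - \<kappa> t)" by (simp add: exp_diff)
    also have "\<dots> \<le> D * (4 / \<mu>) * exp (2 * c + \<epsilon> * \<bar>t\<bar>)"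
    proof -
      have "\<mu> * t + \<eta> * \<bar>t\<bar> - \<kappa> t \<le> 2 * c + 6 * \<delta> * \<bar>t\<bar>"
        using c(2)[of t] by (auto simp: \<kappa>_def \<eta>_def abs_le_iff)
      also have "\<dots> \<le> 2 * c + \<epsilon> * \<bar>t\<bar>" using \<delta>(2) by (intro add_left_mono mult_right_mono) auto
      finally show ?thesis using \<open>D > 0\<close> f_diss(1) by (intro mult_left_mono) auto
    qed
    also have "\<dots> = C * exp (\<epsilon> * \<bar>t\<bar>)" by (simp add: C_def exp_add)
    finally show ?thesis by (simp add: w_def)
  qed
  ultimately show ?thesis using that by blast
qed

end

section \<open>The cocycle and its pullback limit\<close>

definition rde_flow ::
    "('v::euclidean_space \<Rightarrow> 'v) \<Rightarrow> real \<Rightarrow> 'v \<Rightarrow> real \<Rightarrow> (real \<Rightarrow> real) \<Rightarrow> 'v \<Rightarrow> 'v" where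
  "rde_flow f a b t \<omega> x = flow (rde_field f a b \<omega>) x t"

definition pullback_point ::
    "('v::euclidean_space \<Rightarrow> 'v) \<Rightarrow> real \<Rightarrow> 'v \<Rightarrow> (real \<Rightarrow> real) \<Rightarrow> 'v" where
  "pullback_point f a b \<omega> = lim (\<lambda>n. rde_flow f a b (real n) (wiener_shift (- real n) \<omega>) 0)"

lemma wiener_shift_add: "wiener_shift s (wiener_shift t \<omega>) = wiener_shift (s + t) \<omega>"
  by (simp add: wiener_shift_def fun_eq_iff ac_simps)

lemma has_vector_derivative_time_shift:
  assumes "(U has_vector_derivative D) (at (t + s))"
  shows "((\<lambda>t. U (t + s)) has_vector_derivative D) (at t)"
proof -
  have "((\<lambda>t. t + s) has_vector_derivative 1) (at t)"
    by (auto intro!: derivative_eq_intros simp: has_real_derivative_iff_has_vector_derivative[symmetric])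
  from vector_diff_chain_at[OF this assms] show ?thesis by (simp add: o_def)
qed

locale rde_family =
  fixes \<alpha> :: real and \<Omega> :: "(real \<Rightarrow> real) set"
    and f :: "'v::euclidean_space \<Rightarrow> 'v" and a :: real and b :: 'v and l m \<mu> :: real
  assumes path: "\<omega> \<in> \<Omega> \<Longrightarrow> rde \<alpha> \<omega> f a l m \<mu>"
    and shift: "\<omega> \<in> \<Omega> \<Longrightarrow> wiener_shift t \<omega> \<in> \<Omega>"
    and zero: "\<omega> \<in> \<Omega> \<Longrightarrow> \<omega> 0 = 0"
begin

abbreviation sol :: "(real \<Rightarrow> real) \<Rightarrow> (real \<Rightarrow> 'v) \<Rightarrow> bool" where
  "sol \<equiv> rde_solution_on UNIV f a b"

abbreviation \<psi> :: "real \<Rightarrow> (real \<Rightarrow> real) \<Rightarrow> 'v \<Rightarrow> 'v" where "\<psi> \<equiv> rde_flow f a b"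

abbreviation p :: "(real \<Rightarrow> real) \<Rightarrow> 'v" where "p \<equiv> pullback_point f a b"

lemma shift_0: "\<omega> \<in> \<Omega> \<Longrightarrow> wiener_shift 0 \<omega> = \<omega>"
  using zero by (simp add: wiener_shift_def fun_eq_iff)

lemma OU_shift_family:
  assumes "\<omega> \<in> \<Omega>" shows "OU t (wiener_shift s \<omega>) = OU (t + s) \<omega>"
  using path[OF assms] path[OF shift[OF assms]] unfolding rde_def by (intro OU_shift) auto

lemma field_shift:
  assumes "\<omega> \<in> \<Omega>" shows "rde_field f a b (wiener_shift s \<omega>) t u = rde_field f a b \<omega> (t + s) u"
  by (simp add: rde_field_def OU_shift_family[OF assms])

lemma sol_shift:
  assumes "\<omega> \<in> \<Omega>" "sol \<omega> U" shows "sol (wiener_shift s \<omega>) (\<lambda>t. U (t + s))"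
  using assms(2) unfolding rde_solution_on_def
  by (auto simp: field_shift[OF assms(1)] intro: has_vector_derivative_time_shift)

lemma sol_flow: "\<omega> \<in> \<Omega> \<Longrightarrow> sol \<omega> (\<lambda>t. \<psi> t \<omega> x)"
  and flow_zero: "\<omega> \<in> \<Omega> \<Longrightarrow> \<psi> 0 \<omega> x = x"
  and sol_unique: "\<omega> \<in> \<Omega> \<Longrightarrow> sol \<omega> U \<Longrightarrow> sol \<omega> V \<Longrightarrow> U s = V s \<Longrightarrow> U t = V t"
proof -
  assume \<omega>: "\<omega> \<in> \<Omega>"
  interpret rde \<alpha> \<omega> f a b l m \<mu> by (rule path[OF \<omega>])
  show "sol \<omega> (\<lambda>t. \<psi> t \<omega> x)" "\<psi> 0 \<omega> x = x"
    unfolding rde_flow_def solution_iff by (rule ode.flow_solution ode.flow_0)+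
  show "U t = V t" if "sol \<omega> U" "sol \<omega> V" "U s = V s"
    using that unfolding solution_iff by (rule ode.solution_unique)
qed

lemma cocycle:
  assumes \<omega>: "\<omega> \<in> \<Omega>"
  shows "\<psi> (t + s) \<omega> x = \<psi> t (wiener_shift s \<omega>) (\<psi> s \<omega> x)"
  by (rule sol_unique[OF shift[OF \<omega>] sol_shift[OF \<omega> sol_flow[OF \<omega>]] sol_flow[OF shift[OF \<omega>]], where s = 0])
    (simp add: flow_zero[OF shift[OF \<omega>]])

lemma flow_eq_sol: "\<omega> \<in> \<Omega> \<Longrightarrow> sol \<omega> U \<Longrightarrow> \<psi> t \<omega> (U 0) = U t"
  by (rule sol_unique[OF _ sol_flow, where s = 0]) (auto simp: flow_zero)

text \<open>This is the solution for \<open>\<omega>\<close> that passes through \<open>x\<close> at time \<open>-r\<close>. Pullback limits let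
  \<open>r\<close> tend to infinity in it.\<close>

lemma sol_pulled:
  assumes \<omega>: "\<omega> \<in> \<Omega>"
  shows "sol \<omega> (\<lambda>t. \<psi> (t + r) (wiener_shift (- r) \<omega>) x)"
  using sol_shift[OF shift[OF \<omega>, of "- r"] sol_flow[OF shift[OF \<omega>, of "- r"], of x], of r]
  by (simp add: wiener_shift_add shift_0[OF \<omega>])

text \<open>Of two solutions started from \<open>0\<close> at different past times, the older one has a subexponential
  size when the younger one starts, by the a priori bound. From then on they contract
  exponentially, and this wins.\<close>

lemma pullback_rate:
  assumes \<omega>: "\<omega> \<in> \<Omega>"
  obtains C where "C > 0"
    "\<And>r. r \<ge> 0 \<Longrightarrow> (norm (\<psi> r (wiener_shift (- r) \<omega>) 0 - p \<omega>))\<^sup>2 \<le> C * exp (- \<mu> * r)"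
proof -
  interpret rde \<alpha> \<omega> f a b l m \<mu> by (rule path[OF \<omega>])
  define V where "V r t = \<psi> (t + r) (wiener_shift (- r) \<omega>) 0" for r t
  have solV: "ode.solution (V r)" for r
    using sol_pulled[OF \<omega>, of r 0] unfolding solution_iff by (simp add: V_def[abs_def])
  have V0: "V r (- r) = 0" for r
    by (simp add: V_def flow_zero[OF shift[OF \<omega>]])
  have \<mu>2: "\<mu> / 2 > 0" "\<mu> / 4 > 0" using f_diss(1) by auto
  obtain A where A: "A > 0" "\<And>r U t. ode.solution U \<Longrightarrow> U (- r) = 0 \<Longrightarrow> - r \<le> t \<Longrightarrow>
      (norm (U t))\<^sup>2 \<le> A * exp (\<mu> / 2 * \<bar>t\<bar>)"
    using apriori[OF \<mu>2(1)] by metis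
  obtain c where c: "\<And>t. \<bar>rate t - \<mu> * t\<bar> \<le> c + \<mu> / 4 * \<bar>t\<bar>"
    using rate_lower[OF \<mu>2(2)] by metis
  define C where "C = A * exp (4 * c)"
  have "C > 0" using A by (simp add: C_def)
  have near: "(norm (V r 0 - V r' 0))\<^sup>2 \<le> C * exp (- \<mu> * r)" if "0 \<le> r" "r \<le> r'" for r r'
  proof -
    have "(norm (V r 0 - V r' 0))\<^sup>2 \<le> (norm (V r (- r) - V r' (- r)))\<^sup>2 * exp (2 * (rate (- r) - rate 0))"
      using that by (intro contraction_global solV) auto
    also have "\<dots> = (norm (V r' (- r)))\<^sup>2 * exp (2 * (rate (- r) - rate 0))" by (simp add: V0)
    also have "\<dots> \<le> (A * exp (\<mu> / 2 * r)) * exp (2 * (- \<mu> * r + \<mu> / 4 * r + 2 * c))"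
    proof (intro mult_mono)
      show "(norm (V r' (- r)))\<^sup>2 \<le> A * exp (\<mu> / 2 * r)"
        using A(2)[OF solV V0, of r' "- r"] that by simp
      have "rate (- r) - rate 0 \<le> - \<mu> * r + \<mu> / 4 * r + 2 * c"
        using c[of "- r"] c[of 0] that by (simp add: abs_le_iff)
      then show "exp (2 * (rate (- r) - rate 0)) \<le> exp (2 * (- \<mu> * r + \<mu> / 4 * r + 2 * c))" by simp
    qed (use A in auto)
    also have "\<dots> = A * exp (\<mu> / 2 * r + 2 * (- \<mu> * r + \<mu> / 4 * r + 2 * c))" by (simp only: exp_add mult.assoc)
    also have "\<mu> / 2 * r + 2 * (- \<mu> * r + \<mu> / 4 * r + 2 * c) = 4 * c + - \<mu> * r" by (simp add: field_simps)
    finally show ?thesis by (simp only: C_def exp_add mult.assoc)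
  qed
  have "convergent (\<lambda>n. V (real n) 0)"
  proof (rule convergent_of_tail_bound)
    show "norm (V (real m) 0 - V (real n) 0) \<le> sqrt (C * exp (- \<mu> * real m))" if "m \<le> n" for m n
      using near[of "real m" "real n"] that by (intro real_le_rsqrt) simp
    have "(\<lambda>n. C * exp (- \<mu> * real n)) \<longlonglongrightarrow> 0" using f_diss(1) by real_asymp
    from tendsto_real_sqrt[OF this] show "(\<lambda>n. sqrt (C * exp (- \<mu> * real n))) \<longlonglongrightarrow> 0" by simp
  qed
  then have "(\<lambda>n. V (real n) 0) \<longlonglongrightarrow> lim (\<lambda>n. V (real n) 0)"
    by (simp add: convergent_LIMSEQ_iff)
  then have lim: "(\<lambda>n. V (real n) 0) \<longlonglongrightarrow> p \<omega>" by (simp add: V_def pullback_point_def)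
  have "(norm (V r 0 - p \<omega>))\<^sup>2 \<le> C * exp (- \<mu> * r)" if "r \<ge> 0" for r
  proof (rule tendsto_upperbound)
    show "(\<lambda>n. (norm (V r 0 - V (real n) 0))\<^sup>2) \<longlonglongrightarrow> (norm (V r 0 - p \<omega>))\<^sup>2"
      by (intro tendsto_intros lim)
    obtain M :: nat where M: "r \<le> M" using real_arch_simple by blast
    show "\<forall>\<^sub>F n in sequentially. (norm (V r 0 - V (real n) 0))\<^sup>2 \<le> C * exp (- \<mu> * r)"
      by (rule eventually_sequentiallyI[of M]) (use near that M in auto)
  qed simp
  then show ?thesis using that[OF \<open>C > 0\<close>] by (simp add: V_def)
qed

lemma pullback_tendsto:
  assumes \<omega>: "\<omega> \<in> \<Omega>"
  shows "((\<lambda>r. \<psi> r (wiener_shift (- r) \<omega>) 0) \<longlongrightarrow> p \<omega>) at_top"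
proof -
  interpret rde \<alpha> \<omega> f a b l m \<mu> by (rule path[OF \<omega>])
  obtain C where C: "\<And>r. r \<ge> 0 \<Longrightarrow> (norm (\<psi> r (wiener_shift (- r) \<omega>) 0 - p \<omega>))\<^sup>2 \<le> C * exp (- \<mu> * r)"
    using pullback_rate[OF \<omega>] by metis
  have "((\<lambda>r. (norm (\<psi> r (wiener_shift (- r) \<omega>) 0 - p \<omega>))\<^sup>2) \<longlongrightarrow> 0) at_top"
  proof (rule Lim_null_comparison)
    show "\<forall>\<^sub>F r in at_top. norm ((norm (\<psi> r (wiener_shift (- r) \<omega>) 0 - p \<omega>))\<^sup>2) \<le> C * exp (- \<mu> * r)"
      using eventually_ge_at_top[of 0] by eventually_elim (use C in auto)
    show "((\<lambda>r. C * exp (- \<mu> * r)) \<longlongrightarrow> 0) at_top" using f_diss(1) by real_asymp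
  qed
  then show ?thesis by (rule LIM_zero_cancel[OF tendsto_zero_of_norm_power2])
qed

lemma forward_contraction:
  assumes \<omega>: "\<omega> \<in> \<Omega>"
  obtains \<rho> where "(\<rho> \<longlongrightarrow> 0) at_top"
    "\<And>t x y. t \<ge> 0 \<Longrightarrow> (norm (\<psi> t \<omega> x - \<psi> t \<omega> y))\<^sup>2 \<le> (norm (x - y))\<^sup>2 * \<rho> t"
proof -
  interpret rde \<alpha> \<omega> f a b l m \<mu> by (rule path[OF \<omega>])
  have "(norm (\<psi> t \<omega> x - \<psi> t \<omega> y))\<^sup>2 \<le> (norm (x - y))\<^sup>2 * exp (2 * (rate 0 - rate t))" if "t \<ge> 0" for t x y
    using contraction_global[of "\<lambda>t. \<psi> t \<omega> x" "\<lambda>t. \<psi> t \<omega> y" 0 t] that sol_flow[OF \<omega>]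
    by (simp add: flow_zero[OF \<omega>] solution_iff)
  then show ?thesis using that[OF exp_rate_tendsto] by blast
qed

text \<open>For \<open>t \<ge> 0\<close> both sides are limits of the same solutions, since the flow is continuous in the
  initial value; negative times follow by the cocycle property.\<close>

lemma pullback_invariant:
  assumes \<omega>: "\<omega> \<in> \<Omega>"
  shows "\<psi> t \<omega> (p \<omega>) = p (wiener_shift t \<omega>)"
proof -
  have pos: "\<psi> t \<omega> (p \<omega>) = p (wiener_shift t \<omega>)" if \<omega>: "\<omega> \<in> \<Omega>" and "t \<ge> 0" for t \<omega>
  proof -
    obtain \<rho> where \<rho>: "\<And>t x y. t \<ge> 0 \<Longrightarrow> (norm (\<psi> t \<omega> x - \<psi> t \<omega> y))\<^sup>2 \<le> (norm (x - y))\<^sup>2 * \<rho> t"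
      using forward_contraction[OF \<omega>] by metis
    let ?V = "\<lambda>r. \<psi> t \<omega> (\<psi> r (wiener_shift (- r) \<omega>) 0)"
    have "((\<lambda>r. (norm (?V r - \<psi> t \<omega> (p \<omega>)))\<^sup>2) \<longlongrightarrow> 0) at_top"
    proof (rule Lim_null_comparison)
      show "\<forall>\<^sub>F r in at_top. norm ((norm (?V r - \<psi> t \<omega> (p \<omega>)))\<^sup>2)
          \<le> (norm (\<psi> r (wiener_shift (- r) \<omega>) 0 - p \<omega>))\<^sup>2 * \<rho> t"
        using \<rho>[OF \<open>t \<ge> 0\<close>] by (intro always_eventually) simp
      have "((\<lambda>r. (norm (\<psi> r (wiener_shift (- r) \<omega>) 0 - p \<omega>))\<^sup>2 * \<rho> t) \<longlongrightarrow> (norm (p \<omega> - p \<omega>))\<^sup>2 * \<rho> t) at_top"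
        by (intro tendsto_intros pullback_tendsto[OF \<omega>])
      then show "((\<lambda>r. (norm (\<psi> r (wiener_shift (- r) \<omega>) 0 - p \<omega>))\<^sup>2 * \<rho> t) \<longlongrightarrow> 0) at_top" by simp
    qed
    then have 1: "(?V \<longlongrightarrow> \<psi> t \<omega> (p \<omega>)) at_top"
      by (rule LIM_zero_cancel[OF tendsto_zero_of_norm_power2])
    have "filterlim (\<lambda>r. t + r) at_top at_top" by real_asymp
    from filterlim_compose[OF pullback_tendsto[OF shift[OF \<omega>, of t]] this]
    have "((\<lambda>r. \<psi> (t + r) (wiener_shift (- (t + r)) (wiener_shift t \<omega>)) 0) \<longlongrightarrow> p (wiener_shift t \<omega>)) at_top" .
    moreover have "\<psi> (t + r) (wiener_shift (- (t + r)) (wiener_shift t \<omega>)) 0 = ?V r" for r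
      using cocycle[OF shift[OF \<omega>], of t r "- r" 0] by (simp add: wiener_shift_add shift_0[OF \<omega>])
    ultimately have "(?V \<longlongrightarrow> p (wiener_shift t \<omega>)) at_top" by simp
    with 1 show ?thesis by (rule tendsto_unique[OF trivial_limit_at_top_linorder])
  qed
  show ?thesis
  proof (cases "t \<ge> 0")
    case False
    have "p \<omega> = \<psi> (- t) (wiener_shift t \<omega>) (p (wiener_shift t \<omega>))"
      using pos[OF shift[OF \<omega>], of "- t" t] False by (simp add: wiener_shift_add shift_0[OF \<omega>])
    then have "\<psi> t \<omega> (p \<omega>) = \<psi> t \<omega> (\<psi> (- t) (wiener_shift t \<omega>) (p (wiener_shift t \<omega>)))" by simp
    also have "\<dots> = \<psi> (t + - t) (wiener_shift t \<omega>) (p (wiener_shift t \<omega>))"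
      by (subst cocycle[OF shift[OF \<omega>]]) (simp add: wiener_shift_add shift_0[OF \<omega>])
    also have "\<dots> = p (wiener_shift t \<omega>)" by (simp add: flow_zero[OF shift[OF \<omega>]])
    finally show ?thesis .
  qed (use pos \<omega> in auto)
qed

lemma pullback_growth:
  assumes \<omega>: "\<omega> \<in> \<Omega>" and "\<epsilon> > 0"
  obtains C where "C > 0" "\<And>t. (norm (p (wiener_shift t \<omega>)))\<^sup>2 \<le> C * exp (\<epsilon> * \<bar>t\<bar>)"
proof -
  interpret rde \<alpha> \<omega> f a b l m \<mu> by (rule path[OF \<omega>])
  obtain A where A: "A > 0" "\<And>r U t. ode.solution U \<Longrightarrow> U (- r) = 0 \<Longrightarrow> - r \<le> t \<Longrightarrow>
      (norm (U t))\<^sup>2 \<le> A * exp (\<epsilon> * \<bar>t\<bar>)"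
    using apriori[OF \<open>\<epsilon> > 0\<close>] by metis
  have "(norm (p (wiener_shift t \<omega>)))\<^sup>2 \<le> A * exp (\<epsilon> * \<bar>t\<bar>)" for t
  proof (rule tendsto_upperbound[where F = at_top])
    have "filterlim (\<lambda>r. t + r) at_top at_top" by real_asymp
    from filterlim_compose[OF pullback_tendsto[OF shift[OF \<omega>, of t]] this]
    have "((\<lambda>r. \<psi> (t + r) (wiener_shift (- r) \<omega>) 0) \<longlongrightarrow> p (wiener_shift t \<omega>)) at_top"
      by (simp add: wiener_shift_add)
    then show "((\<lambda>r. (norm (\<psi> (t + r) (wiener_shift (- r) \<omega>) 0))\<^sup>2) \<longlongrightarrow> (norm (p (wiener_shift t \<omega>)))\<^sup>2) at_top"
      by (intro tendsto_intros)
    show "\<forall>\<^sub>F r in at_top. (norm (\<psi> (t + r) (wiener_shift (- r) \<omega>) 0))\<^sup>2 \<le> A * exp (\<epsilon> * \<bar>t\<bar>)"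
      using eventually_ge_at_top[of "- t"]
    proof eventually_elim
      case (elim r)
      then show ?case
        using A(2)[of "\<lambda>t. \<psi> (t + r) (wiener_shift (- r) \<omega>) 0" r t] sol_pulled[OF \<omega>, of r 0]
        by (simp add: solution_iff flow_zero[OF shift[OF \<omega>]])
    qed
  qed simp
  then show ?thesis using that[OF A(1)] by blast
qed

text \<open>By invariance, \<open>p \<omega>\<close> is the value at time \<open>0\<close> of the solution that starts from
  \<open>p (wiener_shift (- t) \<omega>)\<close> at time \<open>- t\<close>, so contraction applies.\<close>

lemma pullback_attracts:
  assumes \<omega>: "\<omega> \<in> \<Omega>"
  obtains C where "C > 0" "\<And>t x. t \<ge> 0 \<Longrightarrow> (norm (\<psi> t (wiener_shift (- t) \<omega>) x - p \<omega>))\<^sup>2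
      \<le> C * exp (- \<mu> * t) * (norm (x - p (wiener_shift (- t) \<omega>)))\<^sup>2"
proof -
  interpret rde \<alpha> \<omega> f a b l m \<mu> by (rule path[OF \<omega>])
  have "\<mu> / 2 > 0" using f_diss(1) by simp
  then obtain c where c: "\<And>t. \<bar>rate t - \<mu> * t\<bar> \<le> c + \<mu> / 2 * \<bar>t\<bar>"
    using rate_lower by metis
  have "(norm (\<psi> t (wiener_shift (- t) \<omega>) x - p \<omega>))\<^sup>2
      \<le> exp (4 * c) * exp (- \<mu> * t) * (norm (x - p (wiener_shift (- t) \<omega>)))\<^sup>2" if "t \<ge> 0" for t x
  proof -
    have "(norm (\<psi> (0 + t) (wiener_shift (- t) \<omega>) x - \<psi> 0 \<omega> (p \<omega>)))\<^sup>2 \<le>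
        (norm (\<psi> (- t + t) (wiener_shift (- t) \<omega>) x - \<psi> (- t) \<omega> (p \<omega>)))\<^sup>2 * exp (2 * (rate (- t) - rate 0))"
      by (rule contraction_global)
        (use sol_pulled[OF \<omega>] sol_flow[OF \<omega>] that in \<open>auto simp: solution_iff\<close>)
    also have "\<dots> = (norm (x - p (wiener_shift (- t) \<omega>)))\<^sup>2 * exp (2 * (rate (- t) - rate 0))"
      by (simp add: flow_zero[OF shift[OF \<omega>]] pullback_invariant[OF \<omega>])
    also have "\<dots> \<le> (norm (x - p (wiener_shift (- t) \<omega>)))\<^sup>2 * exp (4 * c + - \<mu> * t)"
      using c[of "- t"] c[of 0] that by (intro mult_left_mono) (auto simp: abs_le_iff)
    finally show ?thesis by (simp only: flow_zero[OF \<omega>] exp_add mult_ac add_0)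
  qed
  then show ?thesis using that[of "exp (4 * c)"] by simp
qed

end

section \<open>Equivalence of the two equations\<close>

lemma sum_pairs:
  fixes g :: "nat \<Rightarrow> 'v::comm_monoid_add"
  shows "(\<Sum>j<2 * n. g j) = (\<Sum>i<n. g (2 * i) + g (2 * i + 1))"
  by (induction n) (auto simp: add_ac)

text \<open>Halving the intervals of a dyadic partition changes the Riemann sum by \<open>2 ^ k\<close> products of
  increments of \<open>x\<close> and \<open>y\<close>, and \<open>2 * \<alpha> > 1\<close> makes these changes summable over \<open>k\<close>. The integral
  is assumed to exist, so no other partitions have to be compared.\<close>

lemma young_loeve:
  fixes y :: "real \<Rightarrow> 'v::real_normed_vector"
  assumes J: "has_young_integral y x s t J" and "s \<le> t" and "\<alpha> > 1/2" and KL: "K \<ge> 0" "L \<ge> 0"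
    and x: "\<And>u v. s \<le> u \<Longrightarrow> u \<le> v \<Longrightarrow> v \<le> t \<Longrightarrow> \<bar>x v - x u\<bar> \<le> K * (v - u) powr \<alpha>"
    and y: "\<And>u v. s \<le> u \<Longrightarrow> u \<le> v \<Longrightarrow> v \<le> t \<Longrightarrow> norm (y v - y u) \<le> L * (v - u) powr \<alpha>"
  shows "norm (J - (x t - x s) *\<^sub>R y s) \<le> K * L / (1 - 2 powr (1 - 2 * \<alpha>)) * (t - s) powr (2 * \<alpha>)"
proof -
  define q where "q = 2 powr (1 - 2 * \<alpha>)"
  have q: "0 < q" "q < 1" using \<open>\<alpha> > 1/2\<close> by (auto simp: q_def powr_less_one)
  define S where "S k = uniform_sum y x s t (2 ^ k)" for k
  define B where "B = K * L * (t - s) powr (2 * \<alpha>)"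
  have "B \<ge> 0" using KL by (simp add: B_def)
  have step: "norm (S (Suc k) - S k) \<le> B * q ^ k" for k
  proof -
    define h where "h = (t - s) / 2 ^ Suc k"
    define pt where "pt j = s + real j * h" for j
    have "h \<ge> 0" using \<open>s \<le> t\<close> by (simp add: h_def)
    have dh: "(t - s) / 2 ^ k = 2 * h" by (simp add: h_def field_simps)
    have ts: "t = s + real (2 ^ Suc k) * h" by (simp add: h_def)
    have Sk: "S k = (\<Sum>i<2 ^ k. (x (pt (2 * i + 2)) - x (pt (2 * i))) *\<^sub>R y (pt (2 * i)))"
      unfolding S_def uniform_sum_def of_nat_power of_nat_numeral dh by (simp add: pt_def algebra_simps)
    have "S (Suc k) = (\<Sum>j<2 * 2 ^ k. (x (pt (j + 1)) - x (pt j)) *\<^sub>R y (pt j))"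
      unfolding S_def uniform_sum_def of_nat_power of_nat_numeral h_def[symmetric] by (simp add: pt_def)
    also have "\<dots> = (\<Sum>i<2 ^ k. (x (pt (2 * i + 1)) - x (pt (2 * i))) *\<^sub>R y (pt (2 * i))
        + (x (pt (2 * i + 2)) - x (pt (2 * i + 1))) *\<^sub>R y (pt (2 * i + 1)))"
      by (subst sum_pairs) simp
    finally have "S (Suc k) - S k
        = (\<Sum>i<2 ^ k. (x (pt (2 * i + 2)) - x (pt (2 * i + 1))) *\<^sub>R (y (pt (2 * i + 1)) - y (pt (2 * i))))"
      unfolding Sk by (simp add: sum_subtractf[symmetric] algebra_simps)
    also have "norm \<dots> \<le> (\<Sum>i<(2::nat) ^ k. (K * h powr \<alpha>) * (L * h powr \<alpha>))"
    proof (rule sum_norm_le)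
      fix i :: nat assume "i \<in> {..<2 ^ k}"
      then have "2 * i + 2 \<le> 2 ^ Suc k" by simp
      then have "real (2 * i + 2) \<le> real (2 ^ Suc k)" by (rule of_nat_mono)
      then have "real (2 * i + 2) * h \<le> real (2 ^ Suc k) * h" using \<open>h \<ge> 0\<close> by (rule mult_right_mono)
      then have le: "pt (2 * i + 2) \<le> t" unfolding pt_def ts by simp
      have d: "pt (2 * i + 2) = pt (2 * i + 1) + h" "pt (2 * i + 1) = pt (2 * i) + h" "s \<le> pt (2 * i)"
        using \<open>h \<ge> 0\<close> by (auto simp: pt_def algebra_simps)
      have "\<bar>x (pt (2 * i + 2)) - x (pt (2 * i + 1))\<bar> \<le> K * h powr \<alpha>"
        using x[of "pt (2 * i + 1)" "pt (2 * i + 2)"] d le \<open>h \<ge> 0\<close> by simp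
      moreover have "norm (y (pt (2 * i + 1)) - y (pt (2 * i))) \<le> L * h powr \<alpha>"
        using y[of "pt (2 * i)" "pt (2 * i + 1)"] d le \<open>h \<ge> 0\<close> by simp
      ultimately show "norm ((x (pt (2 * i + 2)) - x (pt (2 * i + 1))) *\<^sub>R (y (pt (2 * i + 1)) - y (pt (2 * i))))
          \<le> (K * h powr \<alpha>) * (L * h powr \<alpha>)"
        using KL by (simp only: norm_scaleR) (intro mult_mono, auto)
    qed
    also have "\<dots> = K * L * (2 ^ k * h powr (2 * \<alpha>))"
      using powr_add[of h \<alpha> \<alpha>] by (simp add: mult_ac)
    also have "2 ^ k * h powr (2 * \<alpha>) = (t - s) powr (2 * \<alpha>) * (2 powr real k / (2 powr real (Suc k)) powr (2 * \<alpha>))"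
    proof -
      have "(2::real) ^ Suc k = 2 powr real (Suc k)" "(2::real) ^ k = 2 powr real k"
        by (rule powr_realpow[symmetric]; simp)+
      then show ?thesis unfolding h_def using \<open>s \<le> t\<close> by (simp only:) (subst powr_divide; simp)
    qed
    also have "2 powr real k / (2 powr real (Suc k)) powr (2 * \<alpha>) = 2 powr (real k * (1 - 2 * \<alpha>) - 2 * \<alpha>)"
      by (simp add: powr_powr powr_diff[symmetric] algebra_simps)
    also have "\<dots> \<le> 2 powr (real k * (1 - 2 * \<alpha>))" using \<open>\<alpha> > 1/2\<close> by simp
    also have "\<dots> = q ^ k" using q(1) by (simp add: q_def powr_powr powr_realpow[symmetric] mult.commute)
    finally show ?thesis using KL by (simp add: B_def mult_left_mono mult.assoc)
  qed
  have tot: "norm (S n - S 0) \<le> B / (1 - q)" for n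
  proof -
    have "S n - S 0 = (\<Sum>k<n. S (Suc k) - S k)" by (simp add: sum_lessThan_telescope)
    also have "norm \<dots> \<le> (\<Sum>k<n. B * q ^ k)" by (intro sum_norm_le step)
    also have "\<dots> = B * (\<Sum>k<n. q ^ k)" by (simp add: sum_distrib_left)
    also have "(\<Sum>k<n. q ^ k) \<le> 1 / (1 - q)"
      using q sum_le_suminf[OF summable_geometric, of q "{..<n}"] by (simp add: suminf_geometric)
    finally show ?thesis using \<open>B \<ge> 0\<close> by (simp add: mult_left_mono)
  qed
  have "filterlim (\<lambda>k::nat. 2 ^ k :: nat) at_top at_top"
    by (rule filterlim_at_top_mono[OF filterlim_ident]) (auto intro: less_imp_le)
  from filterlim_compose[OF uniform_sum_tendsto[OF J \<open>s \<le> t\<close>] this]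
  have "S \<longlonglongrightarrow> J" by (simp add: S_def[abs_def])
  then have "norm (J - S 0) \<le> B / (1 - q)"
    by (intro Lim_norm_ubound[OF _ tendsto_diff[OF _ tendsto_const]]) (use tot in auto)
  moreover have "S 0 = (x t - x s) *\<^sub>R y s" by (simp add: S_def uniform_sum_def)
  ultimately show ?thesis by (simp add: B_def q_def)
qed

text \<open>Remainders of order larger than one are invisible to derivatives; this turns an expansion
  along the rough path into a differential equation.\<close>

lemma zero_derivative_of_superlinear:
  fixes D :: "real \<Rightarrow> 'v::real_normed_vector"
  assumes "\<gamma> > 1"
    and D: "\<And>R. \<exists>C. \<forall>s t. - R \<le> s \<and> s \<le> t \<and> t \<le> R \<longrightarrow> norm (D t - D s) \<le> C * (t - s) powr \<gamma>"
  shows "(D has_vector_derivative 0) (at t)"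
proof -
  obtain C where C: "\<And>u v. - (\<bar>t\<bar> + 1) \<le> u \<Longrightarrow> u \<le> v \<Longrightarrow> v \<le> \<bar>t\<bar> + 1 \<Longrightarrow> norm (D v - D u) \<le> C * (v - u) powr \<gamma>"
    using D[of "\<bar>t\<bar> + 1"] by blast
  have sym: "norm (D y - D t) \<le> C * \<bar>y - t\<bar> powr \<gamma>" if "\<bar>y - t\<bar> < 1" for y
  proof (cases "t \<le> y")
    case True
    then show ?thesis using C[of t y] that by auto
  next
    case False
    then show ?thesis using C[of y t] that by (auto simp: norm_minus_commute)
  qed
  have "((\<lambda>y. (1 / norm (y - t)) *\<^sub>R (D y - (D t + (y - t) *\<^sub>R 0))) \<longlongrightarrow> 0) (at t)"
  proof (rule Lim_null_comparison)
    have "\<forall>\<^sub>F y in at t. dist y t < 1 \<and> y \<noteq> t"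
      by (auto simp: eventually_at intro: exI[of _ 1])
    then show "\<forall>\<^sub>F y in at t. norm ((1 / norm (y - t)) *\<^sub>R (D y - (D t + (y - t) *\<^sub>R 0))) \<le> C * \<bar>y - t\<bar> powr (\<gamma> - 1)"
    proof eventually_elim
      case (elim y)
      then have pos: "\<bar>y - t\<bar> > 0" by simp
      have "norm (D y - D t) \<le> C * \<bar>y - t\<bar> powr \<gamma>" using elim by (intro sym) (simp add: dist_real_def)
      also have "\<bar>y - t\<bar> powr \<gamma> = \<bar>y - t\<bar> * \<bar>y - t\<bar> powr (\<gamma> - 1)"
        using pos powr_mult_base[of "\<bar>y - t\<bar>" "\<gamma> - 1"] by simp
      finally have "norm (D y - D t) / \<bar>y - t\<bar> \<le> C * \<bar>y - t\<bar> powr (\<gamma> - 1)"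
        using pos by (simp add: pos_divide_le_eq mult_ac)
      then show ?case by simp
    qed
    have "((\<lambda>y. \<bar>y - t\<bar>) \<longlongrightarrow> \<bar>t - t\<bar>) (at t)" by (intro tendsto_intros)
    then have "((\<lambda>y. \<bar>y - t\<bar> powr (\<gamma> - 1)) \<longlongrightarrow> 0) (at t)"
      using \<open>\<gamma> > 1\<close> by (intro tendsto_zero_powrI[where b = "\<gamma> - 1"]) auto
    then show "((\<lambda>y. C * \<bar>y - t\<bar> powr (\<gamma> - 1)) \<longlongrightarrow> 0) (at t)" by (rule tendsto_mult_right_zero)
  qed
  then show ?thesis
    unfolding has_vector_derivative_def has_derivative_within by (auto intro: bounded_linear_zero)
qed

lemma exp_lipschitz:
  fixes x y :: real
  assumes "\<bar>x\<bar> \<le> c" "\<bar>y\<bar> \<le> c"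
  shows "\<bar>exp y - exp x\<bar> \<le> exp c * \<bar>y - x\<bar>"
proof -
  have "norm (exp y - exp x) \<le> exp c * norm (y - x)"
    by (rule field_differentiable_bound[where S = "{-c..c}" and f' = exp])
      (use assms in \<open>auto intro: derivative_eq_intros DERIV_subset\<close>)
  then show ?thesis by simp
qed

lemma exp_second_order:
  fixes x y :: real
  assumes "\<bar>x\<bar> \<le> c" "\<bar>y\<bar> \<le> c"
  shows "\<bar>exp y - exp x - exp x * (y - x)\<bar> \<le> exp c * (y - x)\<^sup>2"
proof -
  define g where "g r = exp r - exp x * r" for r
  have "norm (g y - g x) \<le> (exp c * \<bar>y - x\<bar>) * norm (y - x)"
  proof (rule field_differentiable_bound[where S = "closed_segment x y" and f' = "\<lambda>r. exp r - exp x"])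
    fix r assume r: "r \<in> closed_segment x y"
    show "(g has_field_derivative exp r - exp x) (at r within closed_segment x y)"
      unfolding g_def[abs_def] by (auto intro!: derivative_eq_intros)
    have "\<bar>r\<bar> \<le> c" "\<bar>r - x\<bar> \<le> \<bar>y - x\<bar>"
      using r assms by (auto simp: closed_segment_eq_real_ivl split: if_splits)
    then have "\<bar>exp r - exp x\<bar> \<le> exp c * \<bar>r - x\<bar>" using exp_lipschitz assms by blast
    also have "\<dots> \<le> exp c * \<bar>y - x\<bar>" using \<open>\<bar>r - x\<bar> \<le> \<bar>y - x\<bar>\<close> by simp
    finally show "norm (exp r - exp x) \<le> exp c * \<bar>y - x\<bar>" by simp
  qed auto
  also have "g y - g x = exp y - exp x - exp x * (y - x)" by (simp add: g_def algebra_simps)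
  also have "exp c * \<bar>y - x\<bar> * norm (y - x) = exp c * (y - x)\<^sup>2" by (simp add: power2_eq_square)
  finally show ?thesis by simp
qed

lemma powr_interpolate:
  fixes h :: real
  assumes "0 < \<alpha>" "\<alpha> < 1" "0 \<le> h" "h \<le> D"
  shows "h \<le> (1 + D) * h powr \<alpha>" "h powr \<alpha> * h \<le> (1 + D) * h powr (2 * \<alpha>)"
proof -
  show *: "h \<le> (1 + D) * h powr \<alpha>"
  proof (cases "h = 0")
    case False
    then have "h > 0" using assms by simp
    have "h = h powr (1 - \<alpha>) * h powr \<alpha>" using \<open>h > 0\<close> by (simp add: powr_add[symmetric])
    also have "\<dots> \<le> (1 + D) * h powr \<alpha>"
    proof (rule mult_right_mono)
      have "h powr (1 - \<alpha>) \<le> (1 + D) powr (1 - \<alpha>)" using assms by (intro powr_mono2) auto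
      also have "\<dots> \<le> (1 + D) powr 1" using assms by (intro powr_mono) auto
      finally show "h powr (1 - \<alpha>) \<le> 1 + D" using assms by simp
    qed simp
    finally show ?thesis .
  qed simp
  have "h powr \<alpha> * h \<le> h powr \<alpha> * ((1 + D) * h powr \<alpha>)" using * by (intro mult_left_mono) auto
  also have "\<dots> = (1 + D) * h powr (2 * \<alpha>)" using powr_add[of h \<alpha> \<alpha>] by (simp add: mult_ac)
  finally show "h powr \<alpha> * h \<le> (1 + D) * h powr (2 * \<alpha>)" .
qed

lemma locally_holder_continuous:
  fixes X :: "real \<Rightarrow> 'v::real_normed_vector"
  assumes "locally_holder \<alpha> X" "\<alpha> > 0"
  shows "continuous_on UNIV X"
proof -
  have "isCont X t" for t
  proof -
    obtain K where K: "\<And>u v. u \<in> {-(\<bar>t\<bar> + 1)..\<bar>t\<bar> + 1} \<Longrightarrow> v \<in> {-(\<bar>t\<bar> + 1)..\<bar>t\<bar> + 1} \<Longrightarrow>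
        norm (X u - X v) \<le> K * \<bar>u - v\<bar> powr \<alpha>"
      using assms(1) unfolding locally_holder_def by blast
    have "((\<lambda>y. X y - X t) \<longlongrightarrow> 0) (at t)"
    proof (rule Lim_null_comparison)
      have "\<forall>\<^sub>F y in at t. dist y t < 1" by (auto simp: eventually_at intro: exI[of _ 1])
      then show "\<forall>\<^sub>F y in at t. norm (X y - X t) \<le> K * \<bar>y - t\<bar> powr \<alpha>"
        by eventually_elim (rule K; auto simp: dist_real_def)
      have "((\<lambda>y. \<bar>y - t\<bar>) \<longlongrightarrow> \<bar>t - t\<bar>) (at t)" by (intro tendsto_intros)
      then have "((\<lambda>y. \<bar>y - t\<bar> powr \<alpha>) \<longlongrightarrow> 0) (at t)"
        using assms(2) by (intro tendsto_zero_powrI[where b = \<alpha>]) auto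
      then show "((\<lambda>y. K * \<bar>y - t\<bar> powr \<alpha>) \<longlongrightarrow> 0) (at t)" by (rule tendsto_mult_right_zero)
    qed
    then show ?thesis by (simp add: isCont_def LIM_zero_iff)
  qed
  then show ?thesis by (simp add: continuous_at_imp_continuous_on)
qed

context rde
begin

abbreviation c\<^sub>0 :: 'v where "c\<^sub>0 \<equiv> b /\<^sub>R a"

lemma to_state_center: "to_state t u + c\<^sub>0 = exp (a * ou t) *\<^sub>R (u + c\<^sub>0)"
  by (simp add: algebra_simps)

lemma field_center:
  "field t u = exp (- a * ou t) *\<^sub>R f (to_state t u) + (a * ou t) *\<^sub>R (u + c\<^sub>0)"
proof -
  have "ou t *\<^sub>R (a *\<^sub>R u + b) = (a * ou t) *\<^sub>R (u + c\<^sub>0)" using a by (simp add: algebra_simps)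
  then show ?thesis by (simp add: rde_field_def)
qed

lemma path_decomp: "a * \<omega> t = a * ou t + a * ou_primitive t"
  by (simp add: ou_primitive_def algebra_simps)

text \<open>Multiplication by the inverse exponential of the driving path removes the stochastic integral
  (the Doss--Sussmann transformation). Both equations are compared with the result.\<close>

definition reduced_solution :: "(real \<Rightarrow> 'v) \<Rightarrow> bool" where
  "reduced_solution X \<longleftrightarrow> (\<forall>t. ((\<lambda>t. exp (- (a * \<omega> t)) *\<^sub>R (X t + c\<^sub>0))
      has_vector_derivative exp (- (a * \<omega> t)) *\<^sub>R f (X t)) (at t))"

text \<open>The reduced variable \<open>Z\<close> and \<open>U + c\<^sub>0\<close> differ by the exponential of \<open>a * ou_primitive\<close>, a
  differentiable factor whose logarithmic derivative is the term \<open>a * ou\<close> of the field.\<close>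

lemma rde_iff_reduced:
  "rde_solution_on UNIV f a b \<omega> U \<longleftrightarrow> reduced_solution (\<lambda>t. to_state t (U t))"
proof -
  define Z where "Z t = exp (- (a * \<omega> t)) *\<^sub>R (to_state t (U t) + c\<^sub>0)" for t
  have Z: "Z t = exp (- (a * ou_primitive t)) *\<^sub>R (U t + c\<^sub>0)" for t
    unfolding Z_def to_state_center path_decomp by (simp flip: exp_add)
  have U: "U t = exp (a * ou_primitive t) *\<^sub>R Z t - c\<^sub>0" for t
    unfolding Z by (simp flip: exp_add)
  have e: "exp (- (a * \<omega> t)) = exp (- (a * ou_primitive t)) * exp (- a * ou t)" for t
    unfolding path_decomp by (simp flip: exp_add)
  show ?thesis
  proof
    assume "rde_solution_on UNIV f a b \<omega> U"
    then have dU: "(U has_vector_derivative field t (U t)) (at t)" for t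
      by (simp add: rde_solution_on_def)
    have "(Z has_vector_derivative exp (- (a * \<omega> t)) *\<^sub>R f (to_state t (U t))) (at t)" for t
    proof -
      have "((\<lambda>t. exp (- (a * ou_primitive t))) has_real_derivative
          exp (- (a * ou_primitive t)) * - (a * ou t)) (at t)"
        by (intro DERIV_fun_exp DERIV_minus DERIV_cmult ou_primitive_deriv)
      moreover have "((\<lambda>t. U t + c\<^sub>0) has_vector_derivative field t (U t) + 0) (at t)"
        by (intro has_vector_derivative_add dU has_vector_derivative_const)
      ultimately have "((\<lambda>t. exp (- (a * ou_primitive t)) *\<^sub>R (U t + c\<^sub>0)) has_vector_derivative
          exp (- (a * ou_primitive t)) *\<^sub>R (field t (U t) + 0)
          + (exp (- (a * ou_primitive t)) * - (a * ou t)) *\<^sub>R (U t + c\<^sub>0)) (at t)"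
        by (rule has_vector_derivative_scaleR)
      moreover have "exp (- (a * ou_primitive t)) *\<^sub>R (field t (U t) + 0)
          + (exp (- (a * ou_primitive t)) * - (a * ou t)) *\<^sub>R (U t + c\<^sub>0)
          = exp (- (a * \<omega> t)) *\<^sub>R f (to_state t (U t))"
        unfolding field_center e by (simp add: scaleR_add_right)
      ultimately show ?thesis by (simp only: Z[abs_def])
    qed
    then show "reduced_solution (\<lambda>t. to_state t (U t))"
      unfolding reduced_solution_def Z_def[abs_def] by blast
  next
    assume "reduced_solution (\<lambda>t. to_state t (U t))"
    then have dZ: "(Z has_vector_derivative exp (- (a * \<omega> t)) *\<^sub>R f (to_state t (U t))) (at t)" for t
      unfolding reduced_solution_def Z_def[abs_def] by blast
    have "(U has_vector_derivative field t (U t)) (at t)" for t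
    proof -
      have "((\<lambda>t. exp (a * ou_primitive t)) has_real_derivative
          exp (a * ou_primitive t) * (a * ou t)) (at t)"
        by (intro DERIV_fun_exp DERIV_cmult ou_primitive_deriv)
      from has_vector_derivative_diff[OF has_vector_derivative_scaleR[OF this dZ] has_vector_derivative_const[of c\<^sub>0]]
      have "((\<lambda>t. exp (a * ou_primitive t) *\<^sub>R Z t - c\<^sub>0) has_vector_derivative
          exp (a * ou_primitive t) *\<^sub>R exp (- (a * \<omega> t)) *\<^sub>R f (to_state t (U t))
          + (exp (a * ou_primitive t) * (a * ou t)) *\<^sub>R Z t - 0) (at t)" .
      moreover have "exp (a * ou_primitive t) *\<^sub>R exp (- (a * \<omega> t)) *\<^sub>R f (to_state t (U t))
          = exp (- a * ou t) *\<^sub>R f (to_state t (U t))"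
        unfolding e by (simp flip: exp_add)
      moreover have "(exp (a * ou_primitive t) * (a * ou t)) *\<^sub>R Z t = (a * ou t) *\<^sub>R (U t + c\<^sub>0)"
        unfolding U by simp
      moreover have "(\<lambda>t. exp (a * ou_primitive t) *\<^sub>R Z t - c\<^sub>0) = U" using U by auto
      ultimately show ?thesis by (simp only: field_center diff_zero)
    qed
    then show "rde_solution_on UNIV f a b \<omega> U" by (simp add: rde_solution_on_def)
  qed
qed

lemma path_bounds:
  assumes "R \<ge> 0"
  obtains w K where "w > 0" "K > 0" "\<And>t. \<bar>t\<bar> \<le> R \<Longrightarrow> \<bar>a * \<omega> t\<bar> \<le> w"
    "\<And>u v. - R \<le> u \<Longrightarrow> u \<le> v \<Longrightarrow> v \<le> R \<Longrightarrow> \<bar>\<omega> v - \<omega> u\<bar> \<le> K * (v - u) powr \<alpha>"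
    "\<And>u v. - R \<le> u \<Longrightarrow> u \<le> v \<Longrightarrow> v \<le> R \<Longrightarrow> \<bar>a * \<omega> v - a * \<omega> u\<bar> \<le> \<bar>a\<bar> * K * (v - u) powr \<alpha>"
proof -
  have "continuous_on UNIV (\<lambda>t. a * \<omega> t)" by (intro continuous_intros cont)
  then obtain w where w: "w > 0" "\<And>t. \<bar>t\<bar> \<le> R \<Longrightarrow> norm (a * \<omega> t) \<le> w"
    using continuous_bounded_on_interval[of "\<lambda>t. a * \<omega> t" R] by metis
  obtain K where K: "K > 0" "\<And>s t. \<bar>s\<bar> \<le> R \<Longrightarrow> \<bar>t\<bar> \<le> R \<Longrightarrow> \<bar>\<omega> s - \<omega> t\<bar> \<le> K * \<bar>s - t\<bar> powr \<alpha>"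
    using holderE by metis
  have K': "\<bar>\<omega> v - \<omega> u\<bar> \<le> K * (v - u) powr \<alpha>" if "- R \<le> u" "u \<le> v" "v \<le> R" for u v
    using K(2)[of v u] that by (simp add: abs_le_iff)
  have "\<bar>a * \<omega> v - a * \<omega> u\<bar> \<le> \<bar>a\<bar> * K * (v - u) powr \<alpha>" if "- R \<le> u" "u \<le> v" "v \<le> R" for u v
  proof -
    have "\<bar>a * \<omega> v - a * \<omega> u\<bar> = \<bar>a\<bar> * \<bar>\<omega> v - \<omega> u\<bar>" by (simp add: abs_mult flip: right_diff_distrib)
    also have "\<dots> \<le> \<bar>a\<bar> * (K * (v - u) powr \<alpha>)" by (intro mult_left_mono K' that) auto
    finally show ?thesis by simp
  qed
  then show ?thesis using that[OF w(1) K(1)] w(2) K' by simp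
qed

lemma noise_increment: "(\<omega> v - \<omega> u) *\<^sub>R (a *\<^sub>R x + b) = (a * \<omega> v - a * \<omega> u) *\<^sub>R (x + c\<^sub>0)"
proof -
  have "a *\<^sub>R x + b = a *\<^sub>R (x + c\<^sub>0)" using a by (simp add: scaleR_add_right)
  moreover have "(\<omega> v - \<omega> u) * a = a * \<omega> v - a * \<omega> u" by (simp add: algebra_simps)
  ultimately show ?thesis by (simp only: scaleR_scaleR)
qed

text \<open>Freezing the exponential of the path at the right end point turns the increment of \<open>X - \<Phi>\<close>
  into the increment of a differentiable function, of order \<open>1 + \<alpha>\<close>, and a second order Taylor
  remainder of the exponential, of order \<open>2 * \<alpha>\<close>.\<close>

lemma reduced_expansion:
  assumes red: "reduced_solution X" and Phi: "\<And>t. (\<Phi> has_vector_derivative f (X t)) (at t)"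
    and X: "continuous_on UNIV X" and "R \<ge> 0"
  shows "\<exists>C. \<forall>u v. - R \<le> u \<and> u \<le> v \<and> v \<le> R \<longrightarrow>
      norm ((X v - \<Phi> v) - (X u - \<Phi> u) - (\<omega> v - \<omega> u) *\<^sub>R (a *\<^sub>R X u + b)) \<le> C * (v - u) powr (2 * \<alpha>)"
    and "\<exists>C. \<forall>u v. - R \<le> u \<and> u \<le> v \<and> v \<le> R \<longrightarrow> norm (X v - X u) \<le> C * (v - u) powr \<alpha>"
proof -
  obtain w K where w: "w > 0" "K > 0" "\<And>t. \<bar>t\<bar> \<le> R \<Longrightarrow> \<bar>a * \<omega> t\<bar> \<le> w"
    and K: "\<And>u v. - R \<le> u \<Longrightarrow> u \<le> v \<Longrightarrow> v \<le> R \<Longrightarrow> \<bar>a * \<omega> v - a * \<omega> u\<bar> \<le> \<bar>a\<bar> * K * (v - u) powr \<alpha>"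
    by (rule path_bounds[OF \<open>R \<ge> 0\<close>]) (rule that; assumption)
  define q where "q t = a * \<omega> t" for t
  define L where "L = \<bar>a\<bar> * K"
  have "L \<ge> 0" using w by (simp add: L_def)
  have q: "\<bar>q t\<bar> \<le> w" if "\<bar>t\<bar> \<le> R" for t using w(3)[OF that] by (simp add: q_def)
  have dq: "\<bar>q v - q u\<bar> \<le> L * (v - u) powr \<alpha>" if "- R \<le> u" "u \<le> v" "v \<le> R" for u v
    using K[OF that] by (simp add: q_def L_def)
  define E where "E = exp w"
  have E: "E > 0" by (simp add: E_def)
  have eq: "exp (q t) \<le> E" "exp (- q t) \<le> E" if "\<bar>t\<bar> \<le> R" for t
    using q[OF that] by (auto simp: E_def)
  define Z where "Z t = exp (- q t) *\<^sub>R (X t + c\<^sub>0)" for t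
  have dZ: "(Z has_vector_derivative exp (- q t) *\<^sub>R f (X t)) (at t)" for t
    using red unfolding reduced_solution_def Z_def[abs_def] q_def by blast
  have XZ: "X t = exp (q t) *\<^sub>R Z t - c\<^sub>0" for t by (simp add: Z_def flip: exp_add)
  obtain Zb where Zb: "Zb > 0" "\<And>t. \<bar>t\<bar> \<le> R \<Longrightarrow> norm (Z t) \<le> Zb"
    using continuous_bounded_on_interval[OF has_vector_derivative_continuous_on[OF dZ], of R] by metis
  have "continuous_on UNIV (\<lambda>t. f (X t))" by (rule continuous_on_compose2[OF f_cont X]) auto
  then obtain G where G: "G > 0" "\<And>t. \<bar>t\<bar> \<le> R \<Longrightarrow> norm (f (X t)) \<le> G"
    using continuous_bounded_on_interval[of "\<lambda>t. f (X t)" R] by metis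
  have main: "norm ((X v - \<Phi> v) - (X u - \<Phi> u) - (\<omega> v - \<omega> u) *\<^sub>R (a *\<^sub>R X u + b))
      \<le> (E * L * E * G * (1 + 2 * R) + E * L\<^sup>2 * Zb) * (v - u) powr (2 * \<alpha>)"
    and hold: "norm (X v - X u) \<le> (E * (E * G) * (1 + 2 * R) + E * L * Zb) * (v - u) powr \<alpha>"
    if uv: "- R \<le> u" "u \<le> v" "v \<le> R" for u v
  proof -
    have au: "\<bar>u\<bar> \<le> R" "\<bar>v\<bar> \<le> R" using uv by auto
    define h where "h = v - u"
    have h: "0 \<le> h" "h \<le> 2 * R" using uv by (auto simp: h_def)
    have interp: "h \<le> (1 + 2 * R) * h powr \<alpha>" "h powr \<alpha> * h \<le> (1 + 2 * R) * h powr (2 * \<alpha>)"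
      using powr_interpolate[of \<alpha> h "2 * R"] alpha h by auto
    have sq: "(h powr \<alpha>)\<^sup>2 = h powr (2 * \<alpha>)" using powr_add[of h \<alpha> \<alpha>] by (simp add: power2_eq_square)
    define Hf where "Hf r = exp (q v) *\<^sub>R Z r - \<Phi> r" for r
    have "norm (Hf v - Hf u) \<le> (E * (L * h powr \<alpha>) * (E * G)) * (v - u)"
    proof (rule norm_increment_le[where g = "\<lambda>r. exp (q v) *\<^sub>R exp (- q r) *\<^sub>R f (X r) - f (X r)"])
      show "(Hf has_vector_derivative exp (q v) *\<^sub>R exp (- q r) *\<^sub>R f (X r) - f (X r)) (at r)" for r
        unfolding Hf_def[abs_def]
        by (intro has_vector_derivative_diff Phi bounded_linear.has_vector_derivative[OF bounded_linear_scaleR_right] dZ)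
      fix r assume r: "u < r" "r < v"
      then have ar: "\<bar>r\<bar> \<le> R" using uv by auto
      have "exp (q v) *\<^sub>R exp (- q r) *\<^sub>R f (X r) - f (X r) = (exp (q v) - exp (q r)) *\<^sub>R exp (- q r) *\<^sub>R f (X r)"
      proof -
        have "(exp (q v) - exp (q r)) * exp (- q r) = exp (q v) * exp (- q r) - 1"
          by (simp add: left_diff_distrib flip: exp_add)
        then show ?thesis by (simp only: scaleR_scaleR scaleR_diff_left scaleR_one)
      qed
      also have "norm \<dots> = \<bar>exp (q v) - exp (q r)\<bar> * (exp (- q r) * norm (f (X r)))" by (simp add: abs_mult)
      also have "\<dots> \<le> (E * (L * h powr \<alpha>)) * (E * G)"
      proof (intro mult_mono)
        have "\<bar>exp (q v) - exp (q r)\<bar> \<le> E * \<bar>q v - q r\<bar>"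
          unfolding E_def by (intro exp_lipschitz q ar au)
        also have "\<bar>q v - q r\<bar> \<le> L * (v - r) powr \<alpha>" using uv r by (intro dq) auto
        also have "(v - r) powr \<alpha> \<le> h powr \<alpha>" unfolding h_def using r alpha by (intro powr_mono2) auto
        finally show "\<bar>exp (q v) - exp (q r)\<bar> \<le> E * (L * h powr \<alpha>)" using E \<open>L \<ge> 0\<close> by (simp add: mult_left_mono)
      qed (use eq[OF ar] G(1) G(2)[OF ar] E \<open>L \<ge> 0\<close> in auto)
      finally show "norm (exp (q v) *\<^sub>R exp (- q r) *\<^sub>R f (X r) - f (X r)) \<le> E * (L * h powr \<alpha>) * (E * G)" .
    qed fact
    also have "\<dots> = (E * L * E * G) * (h powr \<alpha> * h)" by (simp add: h_def mult_ac)
    also have "\<dots> \<le> (E * L * E * G) * ((1 + 2 * R) * h powr (2 * \<alpha>))"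
      using E \<open>L \<ge> 0\<close> G by (intro mult_left_mono interp) auto
    finally have H: "norm (Hf v - Hf u) \<le> (E * L * E * G) * ((1 + 2 * R) * h powr (2 * \<alpha>))" .
    have dq2: "(q v - q u)\<^sup>2 \<le> L\<^sup>2 * h powr (2 * \<alpha>)"
    proof -
      have "\<bar>q v - q u\<bar>\<^sup>2 \<le> (L * h powr \<alpha>)\<^sup>2" using dq[OF uv] by (intro power_mono) (auto simp: h_def)
      then show ?thesis by (simp add: power_mult_distrib sq)
    qed
    have "\<bar>exp (q v) - exp (q u) - exp (q u) * (q v - q u)\<bar> \<le> E * (q v - q u)\<^sup>2"
      unfolding E_def by (intro exp_second_order q au)
    also have "\<dots> \<le> E * (L\<^sup>2 * h powr (2 * \<alpha>))" using dq2 E by (intro mult_left_mono) auto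
    finally have second: "norm ((exp (q v) - exp (q u) - exp (q u) * (q v - q u)) *\<^sub>R Z u)
        \<le> (E * (L\<^sup>2 * h powr (2 * \<alpha>))) * Zb"
      unfolding norm_scaleR using Zb(2)[OF au(1)] E by (intro mult_mono) auto
    have "(X v - \<Phi> v) - (X u - \<Phi> u) - (\<omega> v - \<omega> u) *\<^sub>R (a *\<^sub>R X u + b)
        = (Hf v - Hf u) + (exp (q v) - exp (q u) - exp (q u) * (q v - q u)) *\<^sub>R Z u"
      unfolding noise_increment q_def[symmetric] Hf_def XZ by (simp add: algebra_simps)
    then have "norm ((X v - \<Phi> v) - (X u - \<Phi> u) - (\<omega> v - \<omega> u) *\<^sub>R (a *\<^sub>R X u + b))
        \<le> (E * L * E * G) * ((1 + 2 * R) * h powr (2 * \<alpha>)) + (E * (L\<^sup>2 * h powr (2 * \<alpha>))) * Zb"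
      using norm_triangle_mono[OF H second] by simp
    also have "\<dots> = (E * L * E * G * (1 + 2 * R) + E * L\<^sup>2 * Zb) * h powr (2 * \<alpha>)" by (simp add: algebra_simps)
    finally show "norm ((X v - \<Phi> v) - (X u - \<Phi> u) - (\<omega> v - \<omega> u) *\<^sub>R (a *\<^sub>R X u + b))
        \<le> (E * L * E * G * (1 + 2 * R) + E * L\<^sup>2 * Zb) * (v - u) powr (2 * \<alpha>)" by (simp add: h_def)
    have "norm (Z v - Z u) \<le> (E * G) * (v - u)"
    proof (rule norm_increment_le[OF uv(2) dZ])
      fix r assume r: "u < r" "r < v"
      then have ar: "\<bar>r\<bar> \<le> R" using uv by auto
      show "norm (exp (- q r) *\<^sub>R f (X r)) \<le> E * G"
        using eq[OF ar] G(2)[OF ar] E by (auto intro!: mult_mono)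
    qed
    also have "\<dots> \<le> (E * G) * ((1 + 2 * R) * h powr \<alpha>)"
      unfolding h_def[symmetric] using E G by (intro mult_left_mono interp) auto
    finally have z: "norm (exp (q v) *\<^sub>R (Z v - Z u)) \<le> E * ((E * G) * ((1 + 2 * R) * h powr \<alpha>))"
      unfolding norm_scaleR using eq[OF au(2)] E by (intro mult_mono) auto
    have "\<bar>exp (q v) - exp (q u)\<bar> \<le> E * \<bar>q v - q u\<bar>"
      unfolding E_def by (intro exp_lipschitz q au)
    also have "\<dots> \<le> E * (L * h powr \<alpha>)" unfolding h_def using E dq[OF uv] by (intro mult_left_mono) auto
    finally have y: "norm ((exp (q v) - exp (q u)) *\<^sub>R Z u) \<le> E * (L * h powr \<alpha>) * Zb"
      unfolding norm_scaleR using Zb(2)[OF au(1)] E \<open>L \<ge> 0\<close> by (intro mult_mono) auto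
    have "X v - X u = exp (q v) *\<^sub>R (Z v - Z u) + (exp (q v) - exp (q u)) *\<^sub>R Z u"
      unfolding XZ by (simp add: algebra_simps)
    then have "norm (X v - X u) \<le> E * ((E * G) * ((1 + 2 * R) * h powr \<alpha>)) + E * (L * h powr \<alpha>) * Zb"
      using norm_triangle_mono[OF z y] by simp
    also have "\<dots> = (E * (E * G) * (1 + 2 * R) + E * L * Zb) * h powr \<alpha>" by (simp add: algebra_simps)
    finally show "norm (X v - X u) \<le> (E * (E * G) * (1 + 2 * R) + E * L * Zb) * (v - u) powr \<alpha>"
      by (simp add: h_def)
  qed
  show "\<exists>C. \<forall>u v. - R \<le> u \<and> u \<le> v \<and> v \<le> R \<longrightarrow>
      norm ((X v - \<Phi> v) - (X u - \<Phi> u) - (\<omega> v - \<omega> u) *\<^sub>R (a *\<^sub>R X u + b)) \<le> C * (v - u) powr (2 * \<alpha>)"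
    using main by blast
  show "\<exists>C. \<forall>u v. - R \<le> u \<and> u \<le> v \<and> v \<le> R \<longrightarrow> norm (X v - X u) \<le> C * (v - u) powr \<alpha>"
    using hold by blast
qed

lemma reduced_imp_sde:
  assumes red: "reduced_solution X"
  shows "sde_solution \<alpha> f a b \<omega> X"
proof -
  define Z where "Z t = exp (- (a * \<omega> t)) *\<^sub>R (X t + c\<^sub>0)" for t
  have dZ: "(Z has_vector_derivative exp (- (a * \<omega> t)) *\<^sub>R f (X t)) (at t)" for t
    using red unfolding reduced_solution_def Z_def[abs_def] by blast
  have "X = (\<lambda>t. exp (a * \<omega> t) *\<^sub>R Z t - c\<^sub>0)" by (simp add: Z_def fun_eq_iff flip: exp_add)
  moreover have "continuous_on UNIV (\<lambda>t. exp (a * \<omega> t) *\<^sub>R Z t - c\<^sub>0)"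
    by (intro continuous_intros cont has_vector_derivative_continuous_on[OF dZ])
  ultimately have X: "continuous_on UNIV X" by simp
  have fX: "continuous_on UNIV (\<lambda>t. f (X t))" by (rule continuous_on_compose2[OF f_cont X]) auto
  then obtain \<Phi> where \<Phi>: "\<And>t. (\<Phi> has_vector_derivative f (X t)) (at t)"
    by (rule antiderivative_exists) (rule that)
  show ?thesis
    unfolding sde_solution_def
  proof (intro conjI allI impI)
    show "locally_holder \<alpha> X"
      unfolding locally_holder_def
    proof
      fix R
      show "\<exists>K. \<forall>s\<in>{- R..R}. \<forall>t\<in>{- R..R}. norm (X s - X t) \<le> K * \<bar>s - t\<bar> powr \<alpha>"
      proof (cases "R \<ge> 0")
        case True
        obtain C where C: "\<forall>u v. - R \<le> u \<and> u \<le> v \<and> v \<le> R \<longrightarrow> norm (X v - X u) \<le> C * (v - u) powr \<alpha>"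
          using reduced_expansion(2)[OF red \<Phi> X True] by blast
        have "norm (X s - X t) \<le> C * \<bar>s - t\<bar> powr \<alpha>" if "s \<in> {- R..R}" "t \<in> {- R..R}" for s t
        proof (cases "t \<le> s")
          case True
          then show ?thesis using C that by auto
        next
          case False
          then have "\<bar>s - t\<bar> = t - s" by simp
          then show ?thesis using C[rule_format, of s t] that False by (simp add: norm_minus_commute)
        qed
        then show ?thesis by blast
      qed auto
    qed
    fix s t :: real assume "s \<le> t"
    define R where "R = max \<bar>s\<bar> \<bar>t\<bar>"
    have "R \<ge> 0" by (simp add: R_def)
    obtain C where C: "\<And>u v. - R \<le> u \<Longrightarrow> u \<le> v \<Longrightarrow> v \<le> R \<Longrightarrow>
        norm ((X v - \<Phi> v) - (X u - \<Phi> u) - (\<omega> v - \<omega> u) *\<^sub>R (a *\<^sub>R X u + b)) \<le> C * (v - u) powr (2 * \<alpha>)"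
      using reduced_expansion(1)[OF red \<Phi> X \<open>R \<ge> 0\<close>] by blast
    have "has_young_integral (\<lambda>r. a *\<^sub>R X r + b) \<omega> s t ((X t - \<Phi> t) - (X s - \<Phi> s))"
    proof (rule has_young_integralI[where \<Gamma> = "\<lambda>r. X r - \<Phi> r" and \<gamma> = "2 * \<alpha>" and C = C])
      fix u v assume "s \<le> u" "u \<le> v" "v \<le> t"
      then show "norm (X v - \<Phi> v - (X u - \<Phi> u) - (\<omega> v - \<omega> u) *\<^sub>R (a *\<^sub>R X u + b)) \<le> C * (v - u) powr (2 * \<alpha>)"
        by (intro C) (auto simp: R_def)
    qed (use alpha in auto)
    moreover have "((\<lambda>r. f (X r)) has_integral (\<Phi> t - \<Phi> s)) {s..t}"
      by (rule fundamental_theorem_of_calculus[OF \<open>s \<le> t\<close> has_vector_derivative_at_within[OF \<Phi>]])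
    moreover have "X t = X s + (\<Phi> t - \<Phi> s) + ((X t - \<Phi> t) - (X s - \<Phi> s))" by simp
    ultimately show "\<exists>I J. ((\<lambda>r. f (X r)) has_integral I) {s..t} \<and>
        has_young_integral (\<lambda>r. a *\<^sub>R X r + b) \<omega> s t J \<and> X t = X s + I + J" by blast
  qed
qed

text \<open>The increments of the reduced variable \<open>Z\<close> and of the primitive \<open>\<Psi>\<close> of its expected derivative
  agree up to order \<open>2 * \<alpha>\<close>. The four errors come from freezing the exponential at the left end
  point (\<open>T1\<close>), from replacing \<open>W u\<close> by \<open>W v\<close> in the noise term (\<open>T2\<close>), from the Young--Loeve bound
  (\<open>T3\<close>) and from the Taylor remainder of the exponential (\<open>T4\<close>).\<close>

lemma sde_imp_reduced:
  assumes sde: "sde_solution \<alpha> f a b \<omega> X"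
  shows "reduced_solution X"
proof -
  have hX: "locally_holder \<alpha> X" using sde by (simp add: sde_solution_def)
  have X: "continuous_on UNIV X" using locally_holder_continuous[OF hX] alpha by simp
  have fX: "continuous_on UNIV (\<lambda>t. f (X t))" by (rule continuous_on_compose2[OF f_cont X]) auto
  then obtain \<Phi> where \<Phi>: "\<And>t. (\<Phi> has_vector_derivative f (X t)) (at t)"
    by (rule antiderivative_exists) (rule that)
  define q where "q t = a * \<omega> t" for t
  have "continuous_on UNIV (\<lambda>t. exp (- q t) *\<^sub>R f (X t))"
    unfolding q_def by (intro continuous_intros cont fX)
  then obtain \<Psi> where \<Psi>: "\<And>t. (\<Psi> has_vector_derivative exp (- q t) *\<^sub>R f (X t)) (at t)"
    by (rule antiderivative_exists) (rule that)
  define W where "W t = X t + c\<^sub>0" for t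
  define Z where "Z t = exp (- q t) *\<^sub>R W t" for t
  have "((\<lambda>t. Z t - \<Psi> t) has_vector_derivative 0) (at t)" for t
  proof (rule zero_derivative_of_superlinear[where \<gamma> = "2 * \<alpha>"])
    fix R
    show "\<exists>C. \<forall>s t. - R \<le> s \<and> s \<le> t \<and> t \<le> R \<longrightarrow>
        norm ((Z t - \<Psi> t) - (Z s - \<Psi> s)) \<le> C * (t - s) powr (2 * \<alpha>)"
    proof (cases "R \<ge> 0")
      case R: True
      obtain w K where w: "w > 0" "K > 0" "\<And>t. \<bar>t\<bar> \<le> R \<Longrightarrow> \<bar>a * \<omega> t\<bar> \<le> w"
        and K: "\<And>u v. - R \<le> u \<Longrightarrow> u \<le> v \<Longrightarrow> v \<le> R \<Longrightarrow> \<bar>\<omega> v - \<omega> u\<bar> \<le> K * (v - u) powr \<alpha>"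
          "\<And>u v. - R \<le> u \<Longrightarrow> u \<le> v \<Longrightarrow> v \<le> R \<Longrightarrow> \<bar>a * \<omega> v - a * \<omega> u\<bar> \<le> \<bar>a\<bar> * K * (v - u) powr \<alpha>"
        by (rule path_bounds[OF R]) (rule that; assumption)
      define L where "L = \<bar>a\<bar> * K"
      have "L \<ge> 0" using w by (simp add: L_def)
      have q: "\<bar>q t\<bar> \<le> w" if "\<bar>t\<bar> \<le> R" for t using w(3)[OF that] by (simp add: q_def)
      have dq: "\<bar>q v - q u\<bar> \<le> L * (v - u) powr \<alpha>" if "- R \<le> u" "u \<le> v" "v \<le> R" for u v
        using K(2)[OF that] by (simp add: q_def L_def)
      define E where "E = exp w"
      have E: "E > 0" by (simp add: E_def)
      have eq: "exp (- q t) \<le> E" if "\<bar>t\<bar> \<le> R" for t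
        using q[OF that] by (auto simp: E_def)
      obtain G where G: "G > 0" "\<And>t. \<bar>t\<bar> \<le> R \<Longrightarrow> norm (f (X t)) \<le> G"
        using continuous_bounded_on_interval[OF fX, of R] by metis
      have "continuous_on UNIV W" unfolding W_def[abs_def] by (intro continuous_intros X)
      then obtain Wb where Wb: "Wb > 0" "\<And>t. \<bar>t\<bar> \<le> R \<Longrightarrow> norm (W t) \<le> Wb"
        using continuous_bounded_on_interval[of W R] by metis
      obtain KX' where KX': "\<forall>s\<in>{-R..R}. \<forall>t\<in>{-R..R}. norm (X s - X t) \<le> KX' * \<bar>s - t\<bar> powr \<alpha>"
        using hX unfolding locally_holder_def by blast
      define KX where "KX = \<bar>KX'\<bar>"
      have KX: "norm (X v - X u) \<le> KX * (v - u) powr \<alpha>" if "- R \<le> u" "u \<le> v" "v \<le> R" for u v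
      proof -
        have "norm (X v - X u) \<le> KX' * \<bar>v - u\<bar> powr \<alpha>"
          using that by (intro KX'[rule_format]) auto
        also have "\<dots> \<le> KX * \<bar>v - u\<bar> powr \<alpha>" unfolding KX_def by (intro mult_right_mono) auto
        finally show ?thesis using that by simp
      qed
      have "KX \<ge> 0" by (simp add: KX_def)
      define Cy where "Cy = K * (\<bar>a\<bar> * KX) / (1 - 2 powr (1 - 2 * \<alpha>))"
      define C where "C = E * L * G * (1 + 2 * R) + E * L * KX + E * Cy + E * L\<^sup>2 * Wb"
      have "norm ((Z v - \<Psi> v) - (Z u - \<Psi> u)) \<le> C * (v - u) powr (2 * \<alpha>)"
        if uv: "- R \<le> u" "u \<le> v" "v \<le> R" for u v
      proof -
        have au: "\<bar>u\<bar> \<le> R" "\<bar>v\<bar> \<le> R" using uv by auto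
        define h where "h = v - u"
        have h: "0 \<le> h" "h \<le> 2 * R" using uv by (auto simp: h_def)
        have interp: "h powr \<alpha> * h \<le> (1 + 2 * R) * h powr (2 * \<alpha>)"
          using powr_interpolate[of \<alpha> h "2 * R"] alpha h by auto
        have sq: "h powr \<alpha> * h powr \<alpha> = h powr (2 * \<alpha>)" using powr_add[of h \<alpha> \<alpha>] by simp
        obtain I J where I: "((\<lambda>r. f (X r)) has_integral I) {u..v}"
          and J: "has_young_integral (\<lambda>r. a *\<^sub>R X r + b) \<omega> u v J" and XIJ: "X v = X u + I + J"
          using sde uv(2) unfolding sde_solution_def by blast
        have "((\<lambda>r. f (X r)) has_integral (\<Phi> v - \<Phi> u)) {u..v}"
          by (rule fundamental_theorem_of_calculus[OF uv(2) has_vector_derivative_at_within[OF \<Phi>]])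
        with I have I: "I = \<Phi> v - \<Phi> u" by (rule has_integral_unique)
        have "norm (J - (\<omega> v - \<omega> u) *\<^sub>R (a *\<^sub>R X u + b)) \<le> Cy * h powr (2 * \<alpha>)"
          unfolding Cy_def h_def
        proof (rule young_loeve[OF J uv(2)])
          fix r s assume rs: "u \<le> r" "r \<le> s" "s \<le> v"
          show "\<bar>\<omega> s - \<omega> r\<bar> \<le> K * (s - r) powr \<alpha>" using rs uv by (intro K) auto
          have "norm ((a *\<^sub>R X s + b) - (a *\<^sub>R X r + b)) = \<bar>a\<bar> * norm (X s - X r)"
            by (simp flip: scaleR_diff_right)
          also have "\<dots> \<le> \<bar>a\<bar> * (KX * (s - r) powr \<alpha>)" using rs uv by (intro mult_left_mono KX) auto
          finally show "norm ((a *\<^sub>R X s + b) - (a *\<^sub>R X r + b)) \<le> \<bar>a\<bar> * KX * (s - r) powr \<alpha>" by simp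
        qed (use alpha w \<open>KX \<ge> 0\<close> in auto)
        moreover define \<rho> where "\<rho> = J - (\<omega> v - \<omega> u) *\<^sub>R (a *\<^sub>R X u + b)"
        ultimately have \<rho>: "norm \<rho> \<le> Cy * h powr (2 * \<alpha>)" by simp
        have J: "J = (q v - q u) *\<^sub>R W u + \<rho>"
          by (simp add: \<rho>_def noise_increment q_def W_def)
        have WW: "W v = W u + (\<Phi> v - \<Phi> u) + (q v - q u) *\<^sub>R W u + \<rho>"
          by (simp add: W_def[of v] XIJ I J) (simp add: W_def)
        define Hf where "Hf r = exp (- q u) *\<^sub>R \<Phi> r - \<Psi> r" for r
        have "norm (Hf v - Hf u) \<le> (E * (L * h powr \<alpha>) * G) * (v - u)"
        proof (rule norm_increment_le[where g = "\<lambda>r. exp (- q u) *\<^sub>R f (X r) - exp (- q r) *\<^sub>R f (X r)"])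
          show "(Hf has_vector_derivative exp (- q u) *\<^sub>R f (X r) - exp (- q r) *\<^sub>R f (X r)) (at r)" for r
            unfolding Hf_def[abs_def]
            by (intro has_vector_derivative_diff \<Psi> bounded_linear.has_vector_derivative[OF bounded_linear_scaleR_right] \<Phi>)
          fix r assume r: "u < r" "r < v"
          then have ar: "\<bar>r\<bar> \<le> R" using uv by auto
          have "norm (exp (- q u) *\<^sub>R f (X r) - exp (- q r) *\<^sub>R f (X r)) = \<bar>exp (- q u) - exp (- q r)\<bar> * norm (f (X r))"
            by (simp flip: scaleR_diff_left)
          also have "\<dots> \<le> (E * (L * h powr \<alpha>)) * G"
          proof (intro mult_mono)
            have "\<bar>exp (- q u) - exp (- q r)\<bar> \<le> E * \<bar>- q u - - q r\<bar>"
              unfolding E_def by (intro exp_lipschitz) (use q[OF ar] q[OF au(1)] in auto)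
            also have "\<bar>- q u - - q r\<bar> \<le> L * (r - u) powr \<alpha>" using dq[of u r] uv r by simp
            also have "(r - u) powr \<alpha> \<le> h powr \<alpha>" unfolding h_def using r alpha by (intro powr_mono2) auto
            finally show "\<bar>exp (- q u) - exp (- q r)\<bar> \<le> E * (L * h powr \<alpha>)" using E \<open>L \<ge> 0\<close> by (simp add: mult_left_mono)
          qed (use G(1) G(2)[OF ar] E \<open>L \<ge> 0\<close> in auto)
          finally show "norm (exp (- q u) *\<^sub>R f (X r) - exp (- q r) *\<^sub>R f (X r)) \<le> E * (L * h powr \<alpha>) * G" .
        qed fact
        also have "\<dots> = (E * L * G) * (h powr \<alpha> * h)" by (simp add: h_def mult_ac)
        also have "\<dots> \<le> (E * L * G) * ((1 + 2 * R) * h powr (2 * \<alpha>))"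
          using E \<open>L \<ge> 0\<close> G by (intro mult_left_mono interp) auto
        finally have T1: "norm (Hf v - Hf u) \<le> (E * L * G) * ((1 + 2 * R) * h powr (2 * \<alpha>))" .
        have "norm ((exp (- q u) * (q v - q u)) *\<^sub>R (W v - W u)) = exp (- q u) * \<bar>q v - q u\<bar> * norm (X v - X u)"
          by (simp add: abs_mult W_def)
        also have "\<dots> \<le> E * (L * h powr \<alpha>) * (KX * h powr \<alpha>)"
          using eq[OF au(1)] dq[OF uv] KX[OF uv] E \<open>L \<ge> 0\<close> by (intro mult_mono) (auto simp: h_def)
        also have "\<dots> = E * L * KX * h powr (2 * \<alpha>)" unfolding sq[symmetric] by (simp add: mult_ac)
        finally have T2: "norm ((exp (- q u) * (q v - q u)) *\<^sub>R (W v - W u)) \<le> E * L * KX * h powr (2 * \<alpha>)" .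
        have T3: "norm (exp (- q u) *\<^sub>R \<rho>) \<le> E * (Cy * h powr (2 * \<alpha>))"
          unfolding norm_scaleR using eq[OF au(1)] \<rho> E by (intro mult_mono) auto
        have "\<bar>exp (- q v) - exp (- q u) - exp (- q u) * (- q v - - q u)\<bar> \<le> E * (- q v - - q u)\<^sup>2"
          unfolding E_def by (intro exp_second_order) (use q[OF au(1)] q[OF au(2)] in auto)
        also have "(- q v - - q u)\<^sup>2 = \<bar>q v - q u\<bar>\<^sup>2" by (simp add: power2_eq_square algebra_simps)
        also have "\<bar>q v - q u\<bar>\<^sup>2 \<le> (L * h powr \<alpha>)\<^sup>2" using dq[OF uv] by (intro power_mono) (auto simp: h_def)
        also have "\<dots> = L\<^sup>2 * h powr (2 * \<alpha>)" unfolding sq[symmetric] by (simp add: power2_eq_square mult_ac)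
        finally have "\<bar>exp (- q v) - exp (- q u) - exp (- q u) * (- q v - - q u)\<bar> \<le> E * (L\<^sup>2 * h powr (2 * \<alpha>))"
          using E by (simp add: mult_left_mono)
        then have T4: "norm ((exp (- q v) - exp (- q u) - exp (- q u) * (- q v - - q u)) *\<^sub>R W v)
            \<le> E * (L\<^sup>2 * h powr (2 * \<alpha>)) * Wb"
          unfolding norm_scaleR using Wb(2)[OF au(2)] E by (intro mult_mono) auto
        have "exp (- q u) *\<^sub>R W v = exp (- q u) *\<^sub>R (W u + (\<Phi> v - \<Phi> u) + (q v - q u) *\<^sub>R W u + \<rho>)"
          by (simp add: WW)
        then have "(Z v - \<Psi> v) - (Z u - \<Psi> u) = (Hf v - Hf u) + (- ((exp (- q u) * (q v - q u)) *\<^sub>R (W v - W u)))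
            + exp (- q u) *\<^sub>R \<rho> + (exp (- q v) - exp (- q u) - exp (- q u) * (- q v - - q u)) *\<^sub>R W v"
          unfolding Z_def Hf_def by (simp add: algebra_simps)
        then have "norm ((Z v - \<Psi> v) - (Z u - \<Psi> u)) \<le>
            (E * L * G) * ((1 + 2 * R) * h powr (2 * \<alpha>)) + E * L * KX * h powr (2 * \<alpha>)
            + E * (Cy * h powr (2 * \<alpha>)) + E * (L\<^sup>2 * h powr (2 * \<alpha>)) * Wb"
          using norm_triangle_mono[OF norm_triangle_mono[OF norm_triangle_mono[OF T1 T2[folded norm_minus_cancel[of "_ *\<^sub>R (W v - W u)"]]] T3] T4]
          by (simp only:)
        also have "\<dots> = C * h powr (2 * \<alpha>)" by (simp add: C_def algebra_simps)
        finally show ?thesis by (simp add: h_def)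
      qed
      then show ?thesis by blast
    qed auto
  qed (use alpha in auto)
  from has_vector_derivative_add[OF this \<Psi>]
  have "(Z has_vector_derivative exp (- q t) *\<^sub>R f (X t)) (at t)" for t by simp
  then show ?thesis unfolding reduced_solution_def Z_def[abs_def] W_def q_def by blast
qed

lemma sde_iff_rde:
  "sde_solution \<alpha> f a b \<omega> (\<lambda>t. to_state t (U t)) \<longleftrightarrow> rde_solution_on UNIV f a b \<omega> U"
  using sde_imp_reduced reduced_imp_sde rde_iff_reduced by blast

end

section \<open>The Borel sets of path space are generated by evaluations\<close>

definition path_cylinders :: "(real \<Rightarrow> real) set set" where
  "path_cylinders = {{\<omega> \<in> C0. \<omega> t \<in> A} | t A. A \<in> sets borel}"

lemma path_cylinders_Pow: "path_cylinders \<subseteq> Pow C0"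
  by (auto simp: path_cylinders_def)

text \<open>A closed condition on a nondegenerate interval can be tested at rational times, so boxes are
  measurable with respect to the evaluations. They take the place of the open subbasic sets, for
  which this is less direct.\<close>

definition box :: "real \<times> real \<times> real \<times> real \<Rightarrow> (real \<Rightarrow> real) set" where
  "box = (\<lambda>(q1, q2, r1, r2). {\<eta> \<in> C0. \<forall>s\<in>{q1..q2}. \<eta> s \<in> {r1..r2}})"

definition boxes :: "(real \<times> real \<times> real \<times> real) set" where
  "boxes = {(q1, q2, r1, r2). q1 \<in> \<rat> \<and> q2 \<in> \<rat> \<and> r1 \<in> \<rat> \<and> r2 \<in> \<rat> \<and> q1 < q2}"

lemma countable_boxes: "countable boxes"
proof (rule countable_subset)
  show "boxes \<subseteq> \<rat> \<times> \<rat> \<times> \<rat> \<times> \<rat>" by (auto simp: boxes_def)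
  show "countable ((\<rat> :: real set) \<times> (\<rat> :: real set) \<times> (\<rat> :: real set) \<times> (\<rat> :: real set))"
    by (intro countable_SIGMA countable_rat)
qed

lemma box_by_rationals:
  assumes "q1 < q2" "continuous_on UNIV \<eta>" "\<And>x. x \<in> {q1..q2} \<inter> \<rat> \<Longrightarrow> \<eta> x \<in> {r1..r2::real}"
    and s: "s \<in> {q1..q2::real}"
  shows "\<eta> s \<in> {r1..r2}"
proof (rule ccontr)
  assume "\<eta> s \<notin> {r1..r2}"
  moreover have "open (- {r1..r2})" by (rule open_Compl) (rule closed_atLeastAtMost)
  ultimately obtain \<epsilon> where \<epsilon>: "\<epsilon> > 0" "\<And>z. dist z (\<eta> s) < \<epsilon> \<Longrightarrow> z \<notin> {r1..r2}"
    by (metis ComplD ComplI open_dist)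
  have "isCont \<eta> s" using assms(2) by (simp add: continuous_on_eq_continuous_at)
  then obtain \<delta> where \<delta>: "\<delta> > 0" "\<And>x. dist x s < \<delta> \<Longrightarrow> dist (\<eta> x) (\<eta> s) < \<epsilon>"
    using \<epsilon>(1) unfolding continuous_at_eps_delta by blast
  have "max q1 (s - \<delta>) < min q2 (s + \<delta>)" using assms(1) s \<delta>(1) by auto
  then obtain x where x: "x \<in> \<rat>" "max q1 (s - \<delta>) < x" "x < min q2 (s + \<delta>)"
    using Rats_dense_in_real by blast
  then have "\<eta> x \<in> {r1..r2}" by (intro assms(3)) auto
  moreover have "dist x s < \<delta>" using x by (auto simp: dist_real_def)
  ultimately show False using \<delta>(2) \<epsilon>(2) by blast
qed

lemma box_measurable:
  assumes "c \<in> boxes" shows "box c \<in> sigma_sets C0 path_cylinders"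
proof -
  obtain q1 q2 r1 r2 where c: "c = (q1, q2, r1, r2)" by (cases c)
  have "q1 < q2" using assms by (simp add: c boxes_def)
  have eq: "box c = (\<Inter>x\<in>{q1..q2} \<inter> \<rat>. {\<eta> \<in> C0. \<eta> x \<in> {r1..r2}})"
  proof -
    obtain x0 where "x0 \<in> {q1..q2} \<inter> \<rat>" using Rats_dense_in_real[OF \<open>q1 < q2\<close>] by fastforce
    show ?thesis
    proof (intro equalityI subsetI)
      fix \<eta> assume \<eta>: "\<eta> \<in> (\<Inter>x\<in>{q1..q2} \<inter> \<rat>. {\<eta> \<in> C0. \<eta> x \<in> {r1..r2}})"
      then have "\<eta> \<in> C0" using \<open>x0 \<in> {q1..q2} \<inter> \<rat>\<close> by blast
      moreover have "\<eta> s \<in> {r1..r2}" if "s \<in> {q1..q2}" for s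
        by (rule box_by_rationals[OF \<open>q1 < q2\<close> _ _ that]) (use \<eta> \<open>\<eta> \<in> C0\<close> in \<open>auto simp: C0_def\<close>)
      ultimately show "\<eta> \<in> box c" by (simp add: box_def c)
    qed (simp add: box_def c)
  qed
  obtain x0 where "x0 \<in> {q1..q2} \<inter> \<rat>" using Rats_dense_in_real[OF \<open>q1 < q2\<close>] by fastforce
  interpret sigma_algebra C0 "sigma_sets C0 path_cylinders"
    by (rule sigma_algebra_sigma_sets[OF path_cylinders_Pow])
  show ?thesis
    unfolding eq
  proof (rule countable_INT')
    show "countable ({q1..q2} \<inter> \<rat>)" by (intro countable_Int2 countable_rat)
    show "{q1..q2} \<inter> \<rat> \<noteq> {}" using \<open>x0 \<in> {q1..q2} \<inter> \<rat>\<close> by blast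
    have "{\<eta> \<in> C0. \<eta> x \<in> {r1..r2}} \<in> path_cylinders" for x
      unfolding path_cylinders_def
      by (rule CollectI, rule exI[of _ x], rule exI[of _ "{r1..r2}"]) simp
    then show "(\<lambda>x. {\<eta> \<in> C0. \<eta> x \<in> {r1..r2}}) ` ({q1..q2} \<inter> \<rat>) \<subseteq> sigma_sets C0 path_cylinders"
      by auto
  qed
qed

definition box_cover :: "(real \<Rightarrow> real) set \<Rightarrow> (real \<Rightarrow> real) \<Rightarrow> bool" where
  "box_cover W \<omega> \<longleftrightarrow>
     (\<exists>F. finite F \<and> F \<subseteq> boxes \<and> (\<forall>c\<in>F. \<omega> \<in> box c) \<and> C0 \<inter> (\<Inter>c\<in>F. box c) \<subseteq> W)"

lemma box_cover_mono: "box_cover V \<omega> \<Longrightarrow> V \<subseteq> W \<Longrightarrow> box_cover W \<omega>"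
  unfolding box_cover_def by (meson subset_trans)

lemma box_cover_Int:
  assumes "box_cover V \<omega>" "box_cover W \<omega>"
  shows "box_cover (V \<inter> W) \<omega>"
proof -
  obtain F where F: "finite F" "F \<subseteq> boxes" "\<forall>c\<in>F. \<omega> \<in> box c" "C0 \<inter> (\<Inter>c\<in>F. box c) \<subseteq> V"
    using assms(1) unfolding box_cover_def by (elim exE conjE)
  obtain G where G: "finite G" "G \<subseteq> boxes" "\<forall>c\<in>G. \<omega> \<in> box c" "C0 \<inter> (\<Inter>c\<in>G. box c) \<subseteq> W"
    using assms(2) unfolding box_cover_def by (elim exE conjE)
  show ?thesis
    unfolding box_cover_def
  proof (intro exI[of _ "F \<union> G"] conjI)
    have "C0 \<inter> (\<Inter>c\<in>F \<union> G. box c) \<subseteq> C0 \<inter> (\<Inter>c\<in>F. box c)"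
      "C0 \<inter> (\<Inter>c\<in>F \<union> G. box c) \<subseteq> C0 \<inter> (\<Inter>c\<in>G. box c)" by auto
    then show "C0 \<inter> (\<Inter>c\<in>F \<union> G. box c) \<subseteq> V \<inter> W"
      using F(4) G(4) by (intro Int_greatest) (rule order_trans; assumption)+
  qed (use F G in auto)
qed

lemma subbasic_covered_by_boxes:
  assumes K: "compact K" and V: "open V" and \<omega>: "\<omega> \<in> C0" "\<omega> ` K \<subseteq> V"
  shows "box_cover {\<eta> \<in> C0. \<eta> ` K \<subseteq> V} \<omega>"
proof -
  define Q where "Q = {c \<in> boxes. case c of (q1, q2, r1, r2) \<Rightarrow> {r1..r2} \<subseteq> V \<and> \<omega> \<in> box c}"
  have "\<exists>c\<in>Q. s \<in> {fst c<..<fst (snd c)}" if "s \<in> K" for s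
  proof -
    have "\<omega> s \<in> V" using that \<omega> by blast
    then obtain \<epsilon> where \<epsilon>: "\<epsilon> > 0" "\<And>z. dist z (\<omega> s) < \<epsilon> \<Longrightarrow> z \<in> V"
      using V by (metis open_dist)
    obtain r1 r2 where r: "r1 \<in> \<rat>" "\<omega> s - \<epsilon> < r1" "r1 < \<omega> s" "r2 \<in> \<rat>" "\<omega> s < r2" "r2 < \<omega> s + \<epsilon>"
      using Rats_dense_in_real[of "\<omega> s - \<epsilon>" "\<omega> s"] Rats_dense_in_real[of "\<omega> s" "\<omega> s + \<epsilon>"] \<epsilon>(1) by auto
    have "isCont \<omega> s" using \<omega>(1) by (simp add: C0_def continuous_on_eq_continuous_at)
    moreover have "min (\<omega> s - r1) (r2 - \<omega> s) > 0" using r by simp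
    ultimately obtain \<delta> where \<delta>: "\<delta> > 0" "\<And>x. dist x s < \<delta> \<Longrightarrow> dist (\<omega> x) (\<omega> s) < min (\<omega> s - r1) (r2 - \<omega> s)"
      unfolding continuous_at_eps_delta by blast
    obtain q1 q2 where q: "q1 \<in> \<rat>" "s - \<delta> < q1" "q1 < s" "q2 \<in> \<rat>" "s < q2" "q2 < s + \<delta>"
      using Rats_dense_in_real[of "s - \<delta>" s] Rats_dense_in_real[of s "s + \<delta>"] \<delta>(1) by auto
    have "\<omega> x \<in> {r1..r2}" if "x \<in> {q1..q2}" for x
      using \<delta>(2)[of x] that q by (auto simp: dist_real_def abs_le_iff abs_less_iff)
    moreover have "{r1..r2} \<subseteq> V"
    proof
      fix z assume "z \<in> {r1..r2}"
      then show "z \<in> V" using r by (intro \<epsilon>(2)) (auto simp: dist_real_def)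
    qed
    ultimately have "(q1, q2, r1, r2) \<in> Q" using q r \<omega> by (auto simp: Q_def boxes_def box_def)
    then show ?thesis using q by (intro bexI[of _ "(q1, q2, r1, r2)"]) auto
  qed
  then have "K \<subseteq> (\<Union>c\<in>Q. {fst c<..<fst (snd c)})" by blast
  then obtain F where F: "F \<subseteq> Q" "finite F" "K \<subseteq> (\<Union>c\<in>F. {fst c<..<fst (snd c)})"
    using compactE_image[OF K, of Q "\<lambda>c. {fst c<..<fst (snd c)}"] by auto
  have "\<eta> s \<in> V" if \<eta>: "\<eta> \<in> C0" "\<forall>c\<in>F. \<eta> \<in> box c" and "s \<in> K" for \<eta> s
  proof -
    obtain c where c: "c \<in> F" "s \<in> {fst c<..<fst (snd c)}" using F(3) \<open>s \<in> K\<close> by blast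
    obtain q1 q2 r1 r2 where ceq: "c = (q1, q2, r1, r2)" by (cases c)
    have "{r1..r2} \<subseteq> V" using c(1) F(1) by (auto simp: ceq Q_def)
    moreover have "\<eta> s \<in> {r1..r2}" using \<eta>(2) c by (force simp: ceq box_def)
    ultimately show ?thesis by blast
  qed
  then have "C0 \<inter> (\<Inter>c\<in>F. box c) \<subseteq> {\<eta> \<in> C0. \<eta> ` K \<subseteq> V}" by blast
  moreover have "F \<subseteq> boxes" "\<forall>c\<in>F. \<omega> \<in> box c" using F(1) by (auto simp: Q_def)
  ultimately show ?thesis using F(2) unfolding box_cover_def by blast
qed

lemma openin_covered_by_boxes:
  assumes "openin compact_open_C0 W"
  shows "W \<subseteq> C0 \<and> (\<forall>\<omega>\<in>W. box_cover W \<omega>)"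
proof -
  have "generate_topology_on {{\<omega> \<in> C0. \<omega> ` K \<subseteq> V} |K V. compact K \<and> open V} W"
    using assms unfolding compact_open_C0_def openin_topology_generated_by_iff .
  then show ?thesis
  proof induction
    case (Int A B)
    then show ?case using box_cover_Int by blast
  next
    case (UN K)
    show ?case
    proof (intro conjI ballI)
      show "\<Union>K \<subseteq> C0" using UN by blast
      fix \<omega> assume "\<omega> \<in> \<Union>K"
      then obtain k where k: "k \<in> K" "\<omega> \<in> k" by blast
      then have "box_cover k \<omega>" using UN.IH by blast
      then show "box_cover (\<Union>K) \<omega>" by (rule box_cover_mono) (use k(1) in blast)
    qed
  next
    case (Basis W)
    then obtain K V where W: "W = {\<omega> \<in> C0. \<omega> ` K \<subseteq> V}" and KV: "compact K" "open V" by blast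
    show ?case
      unfolding W using subbasic_covered_by_boxes[OF KV] by simp
  qed simp
qed

text \<open>An open set is a union of finite intersections of boxes, of which there are only countably
  many.\<close>

lemma openin_measurable:
  assumes "openin compact_open_C0 W"
  shows "W \<in> sigma_sets C0 path_cylinders"
proof -
  interpret sigma_algebra C0 "sigma_sets C0 path_cylinders"
    by (rule sigma_algebra_sigma_sets[OF path_cylinders_Pow])
  define \<F> where "\<F> = {F. finite F \<and> F \<subseteq> boxes \<and> C0 \<inter> (\<Inter>c\<in>F. box c) \<subseteq> W}"
  have "W = (\<Union>F\<in>\<F>. C0 \<inter> (\<Inter>c\<in>F. box c))"
  proof (intro equalityI subsetI)
    fix \<omega> assume "\<omega> \<in> W"
    then have "\<omega> \<in> C0" "box_cover W \<omega>" using openin_covered_by_boxes[OF assms] by auto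
    then obtain F where "F \<in> \<F>" "\<forall>c\<in>F. \<omega> \<in> box c" unfolding box_cover_def \<F>_def by auto
    then show "\<omega> \<in> (\<Union>F\<in>\<F>. C0 \<inter> (\<Inter>c\<in>F. box c))" using \<open>\<omega> \<in> C0\<close> by auto
  qed (auto simp: \<F>_def)
  also have "\<dots> \<in> sigma_sets C0 path_cylinders"
  proof (rule countable_UN')
    show "countable \<F>"
      by (rule countable_subset[OF _ countable_Collect_finite_subset[OF countable_boxes]]) (auto simp: \<F>_def)
    have "C0 \<inter> (\<Inter>c\<in>F. box c) \<in> sigma_sets C0 path_cylinders" if "finite F" "F \<subseteq> boxes" for F
      using that
    proof (induction F)
      case (insert c F)
      then have "box c \<inter> (C0 \<inter> (\<Inter>c\<in>F. box c)) \<in> sigma_sets C0 path_cylinders"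
        by (intro Int[OF box_measurable]) auto
      moreover have "box c \<inter> (C0 \<inter> (\<Inter>c\<in>F. box c)) = C0 \<inter> (\<Inter>c\<in>insert c F. box c)" by auto
      ultimately show ?case by simp
    qed simp
    then show "(\<lambda>F. C0 \<inter> (\<Inter>c\<in>F. box c)) ` \<F> \<subseteq> sigma_sets C0 path_cylinders"
      by (auto simp: \<F>_def)
  qed
  finally show ?thesis .
qed

lemma openin_subset_C0: "{W. openin compact_open_C0 W} \<subseteq> Pow C0"
proof
  fix W assume "W \<in> {W. openin compact_open_C0 W}"
  then have "openin compact_open_C0 W" by (rule CollectD)
  from openin_covered_by_boxes[OF this] have "W \<subseteq> C0" by (rule conjunct1)
  then show "W \<in> Pow C0" by (rule PowI)
qed

lemma space_borel_C0: "space borel_C0 = C0"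
  unfolding borel_C0_def using openin_subset_C0 by (rule space_measure_of)

lemma evaluation_measurable: "(\<lambda>\<omega>. \<omega> t) \<in> borel_measurable borel_C0"
proof (rule borel_measurableI)
  fix S :: "real set" assume "open S"
  have "openin compact_open_C0 {\<omega> \<in> C0. \<omega> ` {t} \<subseteq> S}"
    unfolding compact_open_C0_def openin_topology_generated_by_iff
    using \<open>open S\<close>
    by (intro generate_topology_on.Basis CollectI) (rule exI[of _ "{t}"], rule exI[of _ S], simp)
  then have "{\<omega> \<in> C0. \<omega> ` {t} \<subseteq> S} \<in> sets borel_C0"
    unfolding borel_C0_def using openin_subset_C0 by simp
  moreover have "(\<lambda>\<omega>. \<omega> t) -` S \<inter> space borel_C0 = {\<omega> \<in> C0. \<omega> ` {t} \<subseteq> S}"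
    by (auto simp: space_borel_C0)
  ultimately show "(\<lambda>\<omega>. \<omega> t) -` S \<inter> space borel_C0 \<in> sets borel_C0" by simp
qed

lemma sets_borel_C0: "sets borel_C0 = sigma_sets C0 path_cylinders"
proof
  have "sets borel_C0 = sigma_sets C0 {W. openin compact_open_C0 W}"
    unfolding borel_C0_def using openin_subset_C0 by simp
  also have "\<dots> \<subseteq> sigma_sets C0 path_cylinders"
    by (rule sigma_sets_mono) (auto intro: openin_measurable)
  finally show "sets borel_C0 \<subseteq> sigma_sets C0 path_cylinders" .
  have "path_cylinders \<subseteq> sets borel_C0"
  proof
    fix B assume "B \<in> path_cylinders"
    then obtain t A where B: "B = {\<omega> \<in> C0. \<omega> t \<in> A}" "A \<in> sets borel" by (auto simp: path_cylinders_def)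
    have "B = (\<lambda>\<omega>. \<omega> t) -` A \<inter> space borel_C0" by (auto simp: B space_borel_C0)
    then show "B \<in> sets borel_C0" using measurable_sets[OF evaluation_measurable B(2)] by simp
  qed
  then show "sigma_sets C0 path_cylinders \<subseteq> sets borel_C0"
    using sets.sigma_sets_subset[of path_cylinders borel_C0] by (simp add: space_borel_C0)
qed

lemma wiener_shift_C0: "\<omega> \<in> C0 \<Longrightarrow> wiener_shift \<tau> \<omega> \<in> C0"
proof -
  assume "\<omega> \<in> C0"
  then have "continuous_on UNIV \<omega>" by (simp add: C0_def)
  then have "continuous_on UNIV (\<lambda>s. \<omega> (s + \<tau>))"
    by (rule continuous_on_compose2[where f = "\<lambda>s. s + \<tau>"]) (auto intro: continuous_intros)
  then have "continuous_on UNIV (\<lambda>s. \<omega> (s + \<tau>) - \<omega> \<tau>)"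
    by (rule continuous_on_diff) (rule continuous_on_const)
  then show ?thesis by (simp add: C0_def wiener_shift_def)
qed

lemma wiener_shift_measurable: "wiener_shift \<tau> \<in> measurable borel_C0 borel_C0"
proof (rule measurable_sigma_sets[OF sets_borel_C0 path_cylinders_Pow])
  show "wiener_shift \<tau> \<in> space borel_C0 \<rightarrow> C0" by (auto simp: space_borel_C0 wiener_shift_C0)
  fix B assume "B \<in> path_cylinders"
  then obtain t A where B: "B = {\<omega> \<in> C0. \<omega> t \<in> A}" "A \<in> sets borel" by (auto simp: path_cylinders_def)
  have "(\<lambda>\<omega>. \<omega> (t + \<tau>) - \<omega> \<tau>) \<in> borel_measurable borel_C0"
    by (intro borel_measurable_diff evaluation_measurable)
  from measurable_sets[OF this B(2)]
  have "(\<lambda>\<omega>. \<omega> (t + \<tau>) - \<omega> \<tau>) -` A \<inter> space borel_C0 \<in> sets borel_C0" .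
  moreover have "wiener_shift \<tau> -` B \<inter> space borel_C0 = (\<lambda>\<omega>. \<omega> (t + \<tau>) - \<omega> \<tau>) -` A \<inter> space borel_C0"
  proof -
    have "wiener_shift \<tau> \<omega> \<in> B \<longleftrightarrow> \<omega> (t + \<tau>) - \<omega> \<tau> \<in> A" if "\<omega> \<in> C0" for \<omega>
      using wiener_shift_C0[OF that, of \<tau>] unfolding B by (simp add: wiener_shift_def)
    then show ?thesis unfolding space_borel_C0 by blast
  qed
  ultimately show "wiener_shift \<tau> -` B \<inter> space borel_C0 \<in> sets borel_C0" by simp
qed


section \<open>Linear functionals determine the law\<close>

text \<open>Normalised by its mass, \<open>w\<close> is the density of a probability measure, and the assumption fixes
  the characteristic function of \<open>X\<close> under it; the phase \<open>\<sigma>\<close> provides the imaginary part.\<close>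

lemma weighted_levy:
  fixes P Q :: "'a measure" and w X :: "'a \<Rightarrow> real"
  assumes P: "prob_space P" and Q: "prob_space Q" and sets: "sets P = sets Q"
    and w[measurable]: "w \<in> borel_measurable P" and X[measurable]: "X \<in> borel_measurable P"
    and wb: "\<And>\<omega>. 0 \<le> w \<omega>" "\<And>\<omega>. w \<omega> \<le> 2"
    and eq: "\<And>u \<sigma>. (\<integral>\<omega>. w \<omega> * cos (u * X \<omega> + \<sigma>) \<partial>P) = (\<integral>\<omega>. w \<omega> * cos (u * X \<omega> + \<sigma>) \<partial>Q)"
    and A: "A \<in> sets borel"
  shows "(\<integral>\<omega>. w \<omega> * indicator A (X \<omega>) \<partial>P) = (\<integral>\<omega>. w \<omega> * indicator A (X \<omega>) \<partial>Q)"
proof -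
  note [measurable_cong] = sets
  define c where "c = (\<integral>\<omega>. w \<omega> \<partial>P)"
  have cQ: "c = (\<integral>\<omega>. w \<omega> \<partial>Q)" using eq[of 0 0] by (simp add: c_def)
  have int: "integrable R (\<lambda>\<omega>. w \<omega> * g \<omega>)"
    if "prob_space R" "sets R = sets P" "g \<in> borel_measurable P" "\<And>\<omega>. \<bar>g \<omega>\<bar> \<le> 1" for R and g :: "'a \<Rightarrow> real"
  proof -
    interpret R: prob_space R by fact
    have "w \<in> borel_measurable R" "g \<in> borel_measurable R"
      using w that measurable_cong_sets[OF that(2) refl, of borel] by auto
    moreover have "\<bar>w \<omega> * g \<omega>\<bar> \<le> 2 * 1" for \<omega>
      unfolding abs_mult using wb[of \<omega>] that(4)[of \<omega>] by (intro mult_mono) auto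
    ultimately show ?thesis
      by (intro R.integrable_const_bound[where B = 2]) auto
  qed
  have wint: "integrable P w" "integrable Q w"
    using int[OF P refl, of "\<lambda>_. 1"] int[OF Q sets[symmetric], of "\<lambda>_. 1"] by auto
  show ?thesis
  proof (cases "c = 0")
    case True
    have "(\<integral>\<omega>. w \<omega> * indicator A (X \<omega>) \<partial>R) = 0"
      if "prob_space R" "sets R = sets P" "(\<integral>\<omega>. w \<omega> \<partial>R) = 0" "integrable R w" for R
    proof (rule antisym)
      have im: "(\<lambda>\<omega>. indicator A (X \<omega>) :: real) \<in> borel_measurable P"
        by (rule measurable_compose[OF X borel_measurable_indicator[OF A]])
      have "(\<integral>\<omega>. w \<omega> * indicator A (X \<omega>) \<partial>R) \<le> (\<integral>\<omega>. w \<omega> \<partial>R)"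
      proof (rule integral_mono[OF int[OF that(1,2) im] that(4)])
        show "\<bar>indicator A (X \<omega>) :: real\<bar> \<le> 1" for \<omega> by (simp add: indicator_def)
        show "w \<omega> * indicator A (X \<omega>) \<le> w \<omega>" for \<omega> using wb(1)[of \<omega>] by (simp add: indicator_def)
      qed
      then show "(\<integral>\<omega>. w \<omega> * indicator A (X \<omega>) \<partial>R) \<le> 0" using that by simp
      show "0 \<le> (\<integral>\<omega>. w \<omega> * indicator A (X \<omega>) \<partial>R)" by (intro integral_nonneg_AE) (auto simp: wb)
    qed
    from this[OF P refl] this[OF Q sets[symmetric]] show ?thesis using True cQ c_def wint by simp
  next
    case False
    moreover have "c \<ge> 0" unfolding c_def by (intro integral_nonneg_AE) (auto simp: wb)
    ultimately have "c > 0" by simp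
    define D where "D R = density R (\<lambda>\<omega>. ennreal (w \<omega> / c))" for R
    have D: "prob_space (D R)" "real_distribution (distr (D R) borel X)"
      "\<And>u. char (distr (D R) borel X) u =
        Complex ((\<integral>\<omega>. w \<omega> * cos (u * X \<omega> + 0) \<partial>R) / c) ((\<integral>\<omega>. w \<omega> * cos (u * X \<omega> + - (pi / 2)) \<partial>R) / c)"
      "measure (distr (D R) borel X) A = (\<integral>\<omega>. w \<omega> * indicator A (X \<omega>) \<partial>R) / c"
      if R: "prob_space R" "sets R = sets P" "(\<integral>\<omega>. w \<omega> \<partial>R) = c" "integrable R w" for R
    proof -
      interpret R: prob_space R by fact
      note [measurable_cong] = R(2)
      show pD: "prob_space (D R)"
      proof
        have "emeasure (D R) (space (D R)) = (\<integral>\<^sup>+\<omega>. ennreal (w \<omega> / c) \<partial>R)"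
          unfolding D_def by (subst emeasure_density) (auto intro!: nn_integral_cong)
        also have "\<dots> = ennreal (\<integral>\<omega>. w \<omega> / c \<partial>R)"
          using R \<open>c > 0\<close> wb by (intro nn_integral_eq_integral) auto
        finally show "emeasure (D R) (space (D R)) = 1" using R \<open>c > 0\<close> by simp
      qed
      interpret D: prob_space "D R" by (rule pD)
      have XD[measurable]: "X \<in> borel_measurable (D R)" by (simp add: D_def)
      show "real_distribution (distr (D R) borel X)" by (rule D.real_distribution_distr[OF XD])
      have dens: "integral\<^sup>L (D R) g = (\<integral>\<omega>. w \<omega> * g \<omega> \<partial>R) / c"
        if [measurable]: "g \<in> borel_measurable P" for g :: "'a \<Rightarrow> real"
        unfolding D_def using \<open>c > 0\<close> wb by (subst integral_density) auto
      show "measure (distr (D R) borel X) A = (\<integral>\<omega>. w \<omega> * indicator A (X \<omega>) \<partial>R) / c"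
      proof -
        have "measure (distr (D R) borel X) A = (\<integral>x. indicator A x \<partial>distr (D R) borel X)"
          using A by simp
        also have "\<dots> = (\<integral>\<omega>. indicator A (X \<omega>) \<partial>D R)"
          using A by (subst integral_distr) auto
        also have "\<dots> = (\<integral>\<omega>. w \<omega> * indicator A (X \<omega>) \<partial>R) / c"
          by (rule dens[OF measurable_compose[OF X borel_measurable_indicator[OF A]]])
        finally show ?thesis .
      qed
      fix u
      have "char (distr (D R) borel X) u = (\<integral>\<omega>. iexp (u * X \<omega>) \<partial>D R)"
        unfolding char_def by (subst integral_distr) auto
      moreover have i: "integrable (D R) (\<lambda>\<omega>. iexp (u * X \<omega>))"
        by (intro D.integrable_const_bound[where B = 1]) auto
      have "Re (\<integral>\<omega>. iexp (u * X \<omega>) \<partial>D R) = (\<integral>\<omega>. cos (u * X \<omega>) \<partial>D R)"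
        by (subst integral_Re[OF i, symmetric]) (simp add: Re_exp)
      moreover have "Im (\<integral>\<omega>. iexp (u * X \<omega>) \<partial>D R) = (\<integral>\<omega>. sin (u * X \<omega>) \<partial>D R)"
        by (subst integral_Im[OF i, symmetric]) (simp add: Im_exp)
      moreover have "sin (u * X \<omega>) = cos (u * X \<omega> + - (pi / 2))" for \<omega> by (simp add: cos_diff)
      ultimately show "char (distr (D R) borel X) u =
          Complex ((\<integral>\<omega>. w \<omega> * cos (u * X \<omega> + 0) \<partial>R) / c) ((\<integral>\<omega>. w \<omega> * cos (u * X \<omega> + - (pi / 2)) \<partial>R) / c)"
        by (simp add: complex_eq_iff dens)
    qed
    note DP = D[OF P refl c_def[symmetric] wint(1)] and DQ = D[OF Q sets[symmetric] cQ[symmetric] wint(2)]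
    have "distr (D P) borel X = distr (D Q) borel X"
      by (rule Levy_uniqueness[OF DP(2) DQ(2)]) (intro ext, simp only: DP(3) DQ(3) eq)
    then have "(\<integral>\<omega>. w \<omega> * indicator A (X \<omega>) \<partial>P) / c = (\<integral>\<omega>. w \<omega> * indicator A (X \<omega>) \<partial>Q) / c"
      by (simp only: DP(4)[symmetric] DQ(4)[symmetric])
    then show ?thesis using \<open>c > 0\<close> by simp
  qed
qed


text \<open>The Cramer--Wold device, by induction on the number of conditions: the product \<open>g S\<close> of the
  indicators treated so far becomes the weight for the next one. A weight must be nonnegative, so
  \<open>1 + cos\<close> replaces \<open>cos\<close>, and the constant part is subtracted at the end. The product formula for
  cosines leads back to cosines of functionals in \<open>V\<close>.\<close>

lemma cramer_wold:
  fixes P Q :: "'a measure" and V :: "('a \<Rightarrow> real) set"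
  assumes P: "prob_space P" and Q: "prob_space Q" and sets: "sets P = sets Q"
    and meas: "\<And>X. X \<in> V \<Longrightarrow> X \<in> borel_measurable P"
    and lin: "\<And>X Y u. X \<in> V \<Longrightarrow> Y \<in> V \<Longrightarrow> (\<lambda>\<omega>. u * X \<omega> + Y \<omega>) \<in> V" and zero: "(\<lambda>_. 0) \<in> V"
    and law: "\<And>X. X \<in> V \<Longrightarrow> distr P borel X = distr Q borel X"
    and T: "finite T" "\<And>t. t \<in> T \<Longrightarrow> X t \<in> V" "\<And>t. t \<in> T \<Longrightarrow> A t \<in> sets borel"
  shows "measure P {\<omega> \<in> space P. \<forall>t\<in>T. X t \<omega> \<in> A t} = measure Q {\<omega> \<in> space Q. \<forall>t\<in>T. X t \<omega> \<in> A t}"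
proof -
  interpret P: prob_space P by fact
  interpret Q: prob_space Q by fact
  have QP: "g \<in> borel_measurable Q" if "g \<in> borel_measurable P" for g :: "'a \<Rightarrow> real"
    using that measurable_cong_sets[OF sets refl, of borel] by auto
  define g where "g S \<omega> = (\<Prod>t\<in>S. indicator (A t) (X t \<omega>) :: real)" for S \<omega>
  have g01: "0 \<le> g S \<omega>" "g S \<omega> \<le> 1" for S \<omega>
    unfolding g_def by (auto intro!: prod_nonneg prod_le_1)
  have gm: "g S \<in> borel_measurable P" if "S \<subseteq> T" for S
    unfolding g_def[abs_def]
  proof (rule borel_measurable_prod)
    fix t assume "t \<in> S"
    then have "t \<in> T" using that by blast
    then show "(\<lambda>\<omega>. indicator (A t) (X t \<omega>) :: real) \<in> borel_measurable P"
      using measurable_compose[OF meas[OF T(2)] borel_measurable_indicator[OF T(3)]] by blast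
  qed
  have int: "integrable P h" "integrable Q h" if "h \<in> borel_measurable P" "\<And>\<omega>. \<bar>h \<omega>\<bar> \<le> 2" for h :: "'a \<Rightarrow> real"
    using that QP[OF that(1)] by (auto intro!: P.integrable_const_bound[where B = 2] Q.integrable_const_bound[where B = 2])
  have cosm: "(\<lambda>\<omega>. cos (Y \<omega> + \<tau>)) \<in> borel_measurable P" if "Y \<in> V" for Y \<tau>
    using meas[OF that] by measurable
  have "(\<integral>\<omega>. g S \<omega> * cos (Y \<omega> + \<tau>) \<partial>P) = (\<integral>\<omega>. g S \<omega> * cos (Y \<omega> + \<tau>) \<partial>Q)"
    if "S \<subseteq> T" "Y \<in> V" for S Y \<tau>
    using finite_subset[OF that(1) T(1)] that
  proof (induction S arbitrary: Y \<tau>)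
    case empty
    have "(\<integral>\<omega>. cos (Y \<omega> + \<tau>) \<partial>P) = (\<integral>x. cos (x + \<tau>) \<partial>distr P borel Y)"
      using meas[OF empty(2)] by (subst integral_distr) auto
    also have "\<dots> = (\<integral>\<omega>. cos (Y \<omega> + \<tau>) \<partial>Q)"
      unfolding law[OF empty(2)] using QP[OF meas[OF empty(2)]] by (subst integral_distr) auto
    finally show ?case by (simp add: g_def)
  next
    case (insert t0 S)
    have S: "S \<subseteq> T" and t0: "X t0 \<in> V" "A t0 \<in> sets borel" using insert.prems T by auto
    note IH = insert.IH[OF S]
    have lin': "(\<lambda>\<omega>. u * X t0 \<omega> + Y \<omega>) \<in> V" for u using lin[OF t0(1) insert.prems(2)] .
    have linX: "(\<lambda>\<omega>. u * X t0 \<omega>) \<in> V" for u using lin[OF t0(1) zero] by simp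
    have gcos: "\<bar>g S \<omega> * c\<bar> \<le> 2" if "\<bar>c\<bar> \<le> 1" for \<omega> c
    proof -
      have "\<bar>g S \<omega> * c\<bar> \<le> 1 * 1" unfolding abs_mult using g01[of S \<omega>] that by (intro mult_mono) auto
      then show ?thesis by simp
    qed
    have base: "(\<integral>\<omega>. g S \<omega> * indicator (A t0) (X t0 \<omega>) \<partial>P) = (\<integral>\<omega>. g S \<omega> * indicator (A t0) (X t0 \<omega>) \<partial>Q)"
    proof (rule weighted_levy[OF P Q sets gm[OF S] meas[OF t0(1)] g01(1) _ _ t0(2)])
      show "g S \<omega> \<le> 2" for \<omega> using g01(2)[of S \<omega>] by simp
      show "(\<integral>\<omega>. g S \<omega> * cos (u * X t0 \<omega> + \<sigma>) \<partial>P) = (\<integral>\<omega>. g S \<omega> * cos (u * X t0 \<omega> + \<sigma>) \<partial>Q)" for u \<sigma>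
        by (rule IH[OF linX])
    qed
    have tilted: "(\<integral>\<omega>. (g S \<omega> * (1 + cos (Y \<omega> + \<tau>))) * indicator (A t0) (X t0 \<omega>) \<partial>P)
        = (\<integral>\<omega>. (g S \<omega> * (1 + cos (Y \<omega> + \<tau>))) * indicator (A t0) (X t0 \<omega>) \<partial>Q)"
    proof (rule weighted_levy[OF P Q sets _ meas[OF t0(1)] _ _ _ t0(2)])
      show "(\<lambda>\<omega>. g S \<omega> * (1 + cos (Y \<omega> + \<tau>))) \<in> borel_measurable P"
        using gm[OF S] cosm[OF insert.prems(2), of \<tau>] by (intro borel_measurable_times borel_measurable_add) auto
      show "0 \<le> g S \<omega> * (1 + cos (Y \<omega> + \<tau>))" for \<omega>
        using g01[of S \<omega>] cos_ge_minus_one[of "Y \<omega> + \<tau>"] by (intro mult_nonneg_nonneg) linarith+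
      show "g S \<omega> * (1 + cos (Y \<omega> + \<tau>)) \<le> 2" for \<omega>
      proof -
        have "g S \<omega> * (1 + cos (Y \<omega> + \<tau>)) \<le> 1 * 2"
          using g01[of S \<omega>] cos_le_one[of "Y \<omega> + \<tau>"] cos_ge_minus_one[of "Y \<omega> + \<tau>"]
          by (intro mult_mono) linarith+
        then show ?thesis by simp
      qed
      fix u \<sigma>
      define h where "h = (\<lambda>\<omega>. g S \<omega> * cos (u * X t0 \<omega> + \<sigma>))"
      define h1 where "h1 = (\<lambda>\<omega>. g S \<omega> * cos ((u * X t0 \<omega> + Y \<omega>) + (\<tau> + \<sigma>)))"
      define h2 where "h2 = (\<lambda>\<omega>. g S \<omega> * cos (((- u) * X t0 \<omega> + Y \<omega>) + (\<tau> - \<sigma>)))"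
      have split: "g S \<omega> * (1 + cos (Y \<omega> + \<tau>)) * cos (u * X t0 \<omega> + \<sigma>) = h \<omega> + (h1 \<omega> / 2 + h2 \<omega> / 2)" for \<omega>
      proof -
        have "cos (Y \<omega> + \<tau>) * cos (u * X t0 \<omega> + \<sigma>) =
            (cos ((Y \<omega> + \<tau>) - (u * X t0 \<omega> + \<sigma>)) + cos ((Y \<omega> + \<tau>) + (u * X t0 \<omega> + \<sigma>))) / 2"
          by (rule cos_times_cos)
        also have "(Y \<omega> + \<tau>) - (u * X t0 \<omega> + \<sigma>) = ((- u) * X t0 \<omega> + Y \<omega>) + (\<tau> - \<sigma>)" by simp
        also have "(Y \<omega> + \<tau>) + (u * X t0 \<omega> + \<sigma>) = (u * X t0 \<omega> + Y \<omega>) + (\<tau> + \<sigma>)" by simp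
        finally have c: "cos (Y \<omega> + \<tau>) * cos (u * X t0 \<omega> + \<sigma>) =
            (cos (((- u) * X t0 \<omega> + Y \<omega>) + (\<tau> - \<sigma>)) + cos ((u * X t0 \<omega> + Y \<omega>) + (\<tau> + \<sigma>))) / 2" .
        have "g S \<omega> * (1 + cos (Y \<omega> + \<tau>)) * cos (u * X t0 \<omega> + \<sigma>)
            = g S \<omega> * cos (u * X t0 \<omega> + \<sigma>) + g S \<omega> * (cos (Y \<omega> + \<tau>) * cos (u * X t0 \<omega> + \<sigma>))"
          by (simp only: distrib_left distrib_right mult.assoc mult_1_right mult_1_left)
        then show ?thesis unfolding c h_def h1_def h2_def by (simp only: distrib_left add_divide_distrib times_divide_eq_right add.commute)
      qed
      have m: "h \<in> borel_measurable P" "h1 \<in> borel_measurable P" "h2 \<in> borel_measurable P"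
        unfolding h_def h1_def h2_def
        by (rule borel_measurable_times[OF gm[OF S] cosm[OF linX]] borel_measurable_times[OF gm[OF S] cosm[OF lin']])+
      have b: "\<bar>h \<omega>\<bar> \<le> 2" "\<bar>h1 \<omega>\<bar> \<le> 2" "\<bar>h2 \<omega>\<bar> \<le> 2" for \<omega>
        unfolding h_def h1_def h2_def by (auto intro!: gcos simp: abs_cos_le_one)
      have "integral\<^sup>L P h = integral\<^sup>L Q h" "integral\<^sup>L P h1 = integral\<^sup>L Q h1" "integral\<^sup>L P h2 = integral\<^sup>L Q h2"
        unfolding h_def h1_def h2_def by (rule IH[OF linX] IH[OF lin'])+
      then show "(\<integral>\<omega>. g S \<omega> * (1 + cos (Y \<omega> + \<tau>)) * cos (u * X t0 \<omega> + \<sigma>) \<partial>P)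
          = (\<integral>\<omega>. g S \<omega> * (1 + cos (Y \<omega> + \<tau>)) * cos (u * X t0 \<omega> + \<sigma>) \<partial>Q)"
        unfolding split using int[OF m(1) b(1)] int[OF m(2) b(2)] int[OF m(3) b(3)] by simp
    qed
    define k0 where "k0 = (\<lambda>\<omega>. g S \<omega> * indicator (A t0) (X t0 \<omega>))"
    define k1 where "k1 = (\<lambda>\<omega>. (g S \<omega> * (1 + cos (Y \<omega> + \<tau>))) * indicator (A t0) (X t0 \<omega>))"
    have im: "(\<lambda>\<omega>. indicator (A t0) (X t0 \<omega>) :: real) \<in> borel_measurable P"
      by (rule measurable_compose[OF meas[OF t0(1)] borel_measurable_indicator[OF t0(2)]])
    have km: "k0 \<in> borel_measurable P" "k1 \<in> borel_measurable P"
      unfolding k0_def k1_def using gm[OF S] cosm[OF insert.prems(2), of \<tau>] im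
      by (intro borel_measurable_times borel_measurable_add; auto)+
    have kb: "\<bar>k0 \<omega>\<bar> \<le> 2" "\<bar>k1 \<omega>\<bar> \<le> 2" for \<omega>
    proof -
      show "\<bar>k0 \<omega>\<bar> \<le> 2" unfolding k0_def by (rule gcos) (simp add: indicator_def)
      have "\<bar>g S \<omega> * (1 + cos (Y \<omega> + \<tau>))\<bar> \<le> 1 * 2"
        unfolding abs_mult using g01[of S \<omega>] cos_le_one[of "Y \<omega> + \<tau>"] cos_ge_minus_one[of "Y \<omega> + \<tau>"]
        by (intro mult_mono) linarith+
      then show "\<bar>k1 \<omega>\<bar> \<le> 2" unfolding k1_def by (simp add: indicator_def)
    qed
    have "g (insert t0 S) \<omega> * cos (Y \<omega> + \<tau>) = k1 \<omega> - k0 \<omega>" for \<omega>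
      using insert.hyps by (simp add: g_def k0_def k1_def algebra_simps)
    moreover have "integral\<^sup>L P k0 = integral\<^sup>L Q k0" "integral\<^sup>L P k1 = integral\<^sup>L Q k1"
      using base tilted by (simp_all only: k0_def k1_def)
    ultimately show ?case using int[OF km(1) kb(1)] int[OF km(2) kb(2)] by simp
  qed
  from this[OF order_refl zero, of 0] have eq: "(\<integral>\<omega>. g T \<omega> \<partial>P) = (\<integral>\<omega>. g T \<omega> \<partial>Q)" by simp
  have gi: "g T \<omega> = indicator {\<omega>. \<forall>t\<in>T. X t \<omega> \<in> A t} \<omega>" for \<omega>
  proof (cases "\<forall>t\<in>T. X t \<omega> \<in> A t")
    case False
    then obtain t where "t \<in> T" "X t \<omega> \<notin> A t" by blast
    then have "g T \<omega> = 0" unfolding g_def using T(1) by (intro prod_zero bexI[of _ t]) auto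
    then show ?thesis using False by simp
  qed (simp add: g_def)
  have meas_eq: "measure R {\<omega> \<in> space R. \<forall>t\<in>T. X t \<omega> \<in> A t} = (\<integral>\<omega>. g T \<omega> \<partial>R)" for R
  proof -
    have "(\<integral>\<omega>. g T \<omega> \<partial>R) = (\<integral>\<omega>. indicator {\<omega>. \<forall>t\<in>T. X t \<omega> \<in> A t} \<omega> \<partial>R)" by (simp only: gi)
    also have "\<dots> = measure R ({\<omega>. \<forall>t\<in>T. X t \<omega> \<in> A t} \<inter> space R)" by simp
    finally show ?thesis by (simp add: Int_def conj_commute)
  qed
  show ?thesis unfolding meas_eq by (rule eq)
qed


section \<open>Fractional Brownian motion has stationary increments\<close>

lemma gaussian_law_integrable:
  assumes "gaussian_law \<mu>"
  shows "integrable \<mu> (\<lambda>x. x)" "integrable \<mu> (\<lambda>x. x\<^sup>2)"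
proof -
  consider m where "\<mu> = return borel m"
    | m \<sigma> where "\<sigma> > 0" "\<mu> = density lborel (\<lambda>x. ennreal (normal_density m \<sigma> x))"
    using assms unfolding gaussian_law_def by blast
  then have "integrable \<mu> (\<lambda>x. x) \<and> integrable \<mu> (\<lambda>x. x\<^sup>2)"
  proof cases
    case (1 m)
    interpret prob_space \<mu> unfolding 1 by (rule prob_space_return) simp
    have "integrable \<mu> (\<lambda>x. x)"
    proof (rule integrable_const_bound[where B = "\<bar>m\<bar>"])
      show "AE x in \<mu>. norm x \<le> \<bar>m\<bar>" unfolding 1 by (subst AE_return) auto
    qed (simp add: 1)
    moreover have "integrable \<mu> (\<lambda>x. x\<^sup>2)"
    proof (rule integrable_const_bound[where B = "m\<^sup>2"])
      show "AE x in \<mu>. norm (x\<^sup>2) \<le> m\<^sup>2" unfolding 1 by (subst AE_return) auto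
    qed (simp add: 1)
    ultimately show ?thesis by blast
  next
    case (2 m \<sigma>)
    let ?n = "normal_density m \<sigma>"
    have "integrable lborel (\<lambda>x. ?n x * (x - m)^2 + (2 * m) * (?n x * x) - m\<^sup>2 * ?n x)"
      using 2(1) integrable_normal_moment[OF 2(1), of m 2] integrable_normal_moment_nz_1[OF 2(1), of m]
      by (intro Bochner_Integration.integrable_diff Bochner_Integration.integrable_add integrable_mult_right) auto
    also have "(\<lambda>x. ?n x * (x - m)^2 + (2 * m) * (?n x * x) - m\<^sup>2 * ?n x) = (\<lambda>x. ?n x * x\<^sup>2)"
      by (simp add: fun_eq_iff power2_eq_square algebra_simps)
    finally have "integrable \<mu> (\<lambda>x. x\<^sup>2)"
      unfolding 2(2) by (subst integrable_density) (auto simp: normal_density_nonneg)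
    moreover have "integrable \<mu> (\<lambda>x. x)"
      unfolding 2(2) using integrable_normal_moment_nz_1[OF 2(1), of m]
      by (subst integrable_density) (auto simp: normal_density_nonneg)
    ultimately show ?thesis by blast
  qed
  then show "integrable \<mu> (\<lambda>x. x)" "integrable \<mu> (\<lambda>x. x\<^sup>2)" by blast+
qed

lemma centered_gaussian_cases:
  assumes "gaussian_law \<mu>" "(\<integral>x. x \<partial>\<mu>) = 0"
  shows "(\<mu> = return borel 0 \<and> (\<integral>x. x\<^sup>2 \<partial>\<mu>) = 0) \<or>
    (\<exists>\<sigma>>0. \<mu> = density lborel (\<lambda>x. ennreal (normal_density 0 \<sigma> x)) \<and> (\<integral>x. x\<^sup>2 \<partial>\<mu>) = \<sigma>\<^sup>2)"
proof -
  consider m where "\<mu> = return borel m"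
    | m \<sigma> where "\<sigma> > 0" "\<mu> = density lborel (\<lambda>x. ennreal (normal_density m \<sigma> x))"
    using assms unfolding gaussian_law_def by blast
  then show ?thesis
  proof cases
    case (1 m)
    then have "m = 0" using assms(2) by (simp add: integral_return)
    then show ?thesis using 1 by (simp add: integral_return)
  next
    case (2 m \<sigma>)
    have "(\<integral>x. x \<partial>\<mu>) = (\<integral>x. normal_density m \<sigma> x * x \<partial>lborel)"
      unfolding 2(2) by (subst integral_density) (auto simp: normal_density_nonneg)
    also have "\<dots> = m" by (rule integral_normal_moment_nz_1[OF 2(1)])
    finally have m: "m = 0" using assms(2) by simp
    have "(\<integral>x. x\<^sup>2 \<partial>\<mu>) = (\<integral>x. normal_density 0 \<sigma> x * x\<^sup>2 \<partial>lborel)"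
      unfolding 2(2) m by (subst integral_density) (auto simp: normal_density_nonneg)
    also have "\<dots> = \<sigma>\<^sup>2"
      using integral_normal_moment_even[OF 2(1), of 0 1] by simp
    finally show ?thesis using 2 m by blast
  qed
qed

lemma centered_gaussian_unique:
  assumes "gaussian_law \<mu>" "gaussian_law \<nu>" "(\<integral>x. x \<partial>\<mu>) = 0" "(\<integral>x. x \<partial>\<nu>) = 0"
    and "(\<integral>x. x\<^sup>2 \<partial>\<mu>) = (\<integral>x. x\<^sup>2 \<partial>\<nu>)"
  shows "\<mu> = \<nu>"
  using centered_gaussian_cases[OF assms(1,3)] centered_gaussian_cases[OF assms(2,4)] assms(5)
  by (auto simp: power2_eq_iff)

definition path_functionals :: "((real \<Rightarrow> real) \<Rightarrow> real) set" where
  "path_functionals = {(\<lambda>\<omega>. \<Sum>t\<in>T. c t * \<omega> t) | T c. finite T}"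

lemma path_functionalsI: "finite T \<Longrightarrow> (\<lambda>\<omega>. \<Sum>t\<in>T. c t * \<omega> t) \<in> path_functionals"
  by (auto simp: path_functionals_def)

lemma path_functionals_lin:
  assumes "X \<in> path_functionals" "Y \<in> path_functionals"
  shows "(\<lambda>\<omega>. u * X \<omega> + Y \<omega>) \<in> path_functionals"
proof -
  obtain S c where X: "finite S" "X = (\<lambda>\<omega>. \<Sum>t\<in>S. c t * \<omega> t)" using assms(1) by (auto simp: path_functionals_def)
  obtain T d where Y: "finite T" "Y = (\<lambda>\<omega>. \<Sum>t\<in>T. d t * \<omega> t)" using assms(2) by (auto simp: path_functionals_def)
  define e where "e t = u * (if t \<in> S then c t else 0) + (if t \<in> T then d t else 0)" for t
  have "u * X \<omega> + Y \<omega> = (\<Sum>t\<in>S \<union> T. e t * \<omega> t)" for \<omega>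
  proof -
    have "X \<omega> = (\<Sum>t\<in>S \<union> T. (if t \<in> S then c t else 0) * \<omega> t)"
      unfolding X using X(1) Y(1) by (intro sum.mono_neutral_cong_left) auto
    moreover have "Y \<omega> = (\<Sum>t\<in>S \<union> T. (if t \<in> T then d t else 0) * \<omega> t)"
      unfolding Y using X(1) Y(1) by (intro sum.mono_neutral_cong_left) auto
    ultimately show ?thesis by (simp add: e_def sum_distrib_left distrib_right mult.assoc flip: sum.distrib)
  qed
  then have "(\<lambda>\<omega>. u * X \<omega> + Y \<omega>) = (\<lambda>\<omega>. \<Sum>t\<in>S \<union> T. e t * \<omega> t)" by blast
  then show ?thesis using path_functionalsI[of "S \<union> T" e] X(1) Y(1) by simp
qed

lemma path_functionals_zero: "(\<lambda>_. 0) \<in> path_functionals"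
  using path_functionalsI[of "{}"] by simp

lemma path_functionals_evaluation: "(\<lambda>\<omega>. \<omega> t) \<in> path_functionals"
  using path_functionalsI[of "{t}" "\<lambda>_. 1"] by simp

lemma path_functionals_shift:
  assumes "X \<in> path_functionals" shows "(\<lambda>\<omega>. X (wiener_shift \<tau> \<omega>)) \<in> path_functionals"
proof -
  have "(\<lambda>\<omega>. \<Sum>t\<in>T. c t * wiener_shift \<tau> \<omega> t) \<in> path_functionals" if "finite T" for T and c :: "real \<Rightarrow> real"
    using that
  proof induction
    case (insert t T)
    have "(\<lambda>\<omega>. (- 1) * \<omega> \<tau> + \<omega> (t + \<tau>)) \<in> path_functionals"
      by (intro path_functionals_lin path_functionals_evaluation)
    then have "(\<lambda>\<omega>. wiener_shift \<tau> \<omega> t) \<in> path_functionals" by (simp add: wiener_shift_def)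
    from path_functionals_lin[OF this insert.IH, of "c t"] show ?case using insert.hyps by simp
  qed (simp add: path_functionals_zero)
  then show ?thesis using assms unfolding path_functionals_def by blast
qed

text \<open>A linear functional of the shifted path is a linear functional of the path with the same
  variance, by stationarity of the increment covariance, hence with the same Gaussian law.\<close>

lemma fbm_stationary_increments:
  assumes fbm: "fbm_law H P"
  shows "distr P borel_C0 (wiener_shift \<tau>) = P"
proof -
  have P: "prob_space P" and space: "space P = C0" and sets: "sets P = sets borel_C0"
    and gauss: "\<And>X. X \<in> path_functionals \<Longrightarrow> gaussian_law (distr P borel X)"
    and mean: "\<And>t. (\<integral>\<omega>. \<omega> t \<partial>P) = 0"
    and cov: "\<And>s t. (\<integral>\<omega>. \<omega> s * \<omega> t \<partial>P) = (\<bar>t\<bar> powr (2 * H) + \<bar>s\<bar> powr (2 * H) - \<bar>t - s\<bar> powr (2 * H)) / 2"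
    using fbm unfolding fbm_law_def path_functionals_def by auto
  interpret P: prob_space P by (rule P)
  have shiftm: "wiener_shift \<tau> \<in> measurable P borel_C0"
    using wiener_shift_measurable[of \<tau>] by (simp add: measurable_cong_sets[OF sets refl])
  have evm: "(\<lambda>\<omega>. \<omega> t) \<in> borel_measurable P" for t
    using evaluation_measurable[of t] by (simp add: measurable_cong_sets[OF sets refl])
  have Xm: "X \<in> borel_measurable P" if "X \<in> path_functionals" for X
    using that unfolding path_functionals_def by (auto intro!: borel_measurable_sum borel_measurable_times evm)
  have int: "integrable P X" "integrable P (\<lambda>\<omega>. (X \<omega>)\<^sup>2)" if "X \<in> path_functionals" for X
    using gaussian_law_integrable[OF gauss[OF that]] Xm[OF that] by (simp_all add: integrable_distr_eq)
  have int2: "integrable P (\<lambda>\<omega>. X \<omega> * Y \<omega>)" if X: "X \<in> path_functionals" and Y: "Y \<in> path_functionals" for X Y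
  proof (rule Bochner_Integration.integrable_bound)
    show "integrable P (\<lambda>\<omega>. (X \<omega>)\<^sup>2 + (Y \<omega>)\<^sup>2)" by (intro Bochner_Integration.integrable_add int X Y)
    have "\<bar>x * y\<bar> \<le> x\<^sup>2 + y\<^sup>2" for x y :: real
    proof -
      have "2 * (\<bar>x\<bar> * \<bar>y\<bar>) \<le> x\<^sup>2 + y\<^sup>2" using sum_squares_bound[of "\<bar>x\<bar>" "\<bar>y\<bar>"] by simp
      moreover have "0 \<le> \<bar>x\<bar> * \<bar>y\<bar>" by simp
      ultimately show ?thesis unfolding abs_mult by linarith
    qed
    then show "AE \<omega> in P. norm (X \<omega> * Y \<omega>) \<le> norm ((X \<omega>)\<^sup>2 + (Y \<omega>)\<^sup>2)" by simp
  qed (use Xm[OF X] Xm[OF Y] in simp)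
  define R where "R s t = (\<bar>t\<bar> powr (2 * H) + \<bar>s\<bar> powr (2 * H) - \<bar>t - s\<bar> powr (2 * H)) / 2" for s t
  have ev: "(\<lambda>\<omega>. \<omega> t) \<in> path_functionals" "(\<lambda>\<omega>. wiener_shift \<tau> \<omega> t) \<in> path_functionals" for t
    using path_functionals_evaluation path_functionals_shift[OF path_functionals_evaluation] by auto
  have second: "(\<integral>\<omega>. (\<Sum>t\<in>T. c t * Y t \<omega>)\<^sup>2 \<partial>P) = (\<Sum>s\<in>T. \<Sum>t\<in>T. c s * c t * R s t)"
    if Y: "\<And>t. Y t \<in> path_functionals" and Rst: "\<And>s t. (\<integral>\<omega>. Y s \<omega> * Y t \<omega> \<partial>P) = R s t"
    for T c and Y :: "real \<Rightarrow> (real \<Rightarrow> real) \<Rightarrow> real"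
  proof -
    have "(\<Sum>t\<in>T. c t * Y t \<omega>)\<^sup>2 = (\<Sum>s\<in>T. \<Sum>t\<in>T. c s * c t * (Y s \<omega> * Y t \<omega>))" for \<omega>
      unfolding power2_eq_square sum_product by (intro sum.cong refl) (simp add: mult_ac)
    then have "(\<integral>\<omega>. (\<Sum>t\<in>T. c t * Y t \<omega>)\<^sup>2 \<partial>P) = (\<integral>\<omega>. (\<Sum>s\<in>T. \<Sum>t\<in>T. c s * c t * (Y s \<omega> * Y t \<omega>)) \<partial>P)"
      by simp
    also have "\<dots> = (\<Sum>s\<in>T. \<Sum>t\<in>T. \<integral>\<omega>. c s * c t * (Y s \<omega> * Y t \<omega>) \<partial>P)"
      by (subst Bochner_Integration.integral_sum | intro Bochner_Integration.integrable_sum integrable_mult_right int2 Y sum.cong refl)+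
    also have "\<dots> = (\<Sum>s\<in>T. \<Sum>t\<in>T. c s * c t * R s t)"
      by (intro sum.cong refl) (simp add: Rst)
    finally show ?thesis .
  qed
  have Rshift: "(\<integral>\<omega>. wiener_shift \<tau> \<omega> s * wiener_shift \<tau> \<omega> t \<partial>P) = R s t" for s t
  proof -
    have "(\<integral>\<omega>. wiener_shift \<tau> \<omega> s * wiener_shift \<tau> \<omega> t \<partial>P) =
        (\<integral>\<omega>. \<omega> (s + \<tau>) * \<omega> (t + \<tau>) - \<omega> (s + \<tau>) * \<omega> \<tau> - (\<omega> \<tau> * \<omega> (t + \<tau>) - \<omega> \<tau> * \<omega> \<tau>) \<partial>P)"
      by (intro Bochner_Integration.integral_cong refl) (simp add: wiener_shift_def algebra_simps)
    also have "\<dots> = R (s + \<tau>) (t + \<tau>) - R (s + \<tau>) \<tau> - (R \<tau> (t + \<tau>) - R \<tau> \<tau>)"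
      using int2[OF ev(1) ev(1)] by (simp add: cov R_def)
    also have "\<dots> = R s t" by (simp add: R_def field_simps)
    finally show ?thesis .
  qed
  have meanX: "(\<integral>\<omega>. X \<omega> \<partial>P) = 0" if "X \<in> path_functionals" for X
  proof -
    obtain T c where X: "finite T" "X = (\<lambda>\<omega>. \<Sum>t\<in>T. c t * \<omega> t)"
      using \<open>X \<in> path_functionals\<close> unfolding path_functionals_def by blast
    show ?thesis unfolding X using int(1)[OF ev(1)] by (subst Bochner_Integration.integral_sum) (auto simp: mean)
  qed
  define Q where "Q = distr P borel_C0 (wiener_shift \<tau>)"
  have Q: "prob_space Q" unfolding Q_def by (rule P.prob_space_distr[OF shiftm])
  have law: "distr P borel X = distr Q borel X" if X: "X \<in> path_functionals" for X
  proof -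
    let ?X = "\<lambda>\<omega>. X (wiener_shift \<tau> \<omega>)"
    obtain T c where Xeq: "finite T" "X = (\<lambda>\<omega>. \<Sum>t\<in>T. c t * \<omega> t)"
      using X unfolding path_functionals_def by blast
    have X': "?X \<in> path_functionals" by (rule path_functionals_shift[OF X])
    have XC: "X \<in> borel_measurable borel_C0"
      using Xm[OF X] by (simp add: measurable_cong_sets[OF sets refl])
    have "distr Q borel X = distr P borel ?X"
      unfolding Q_def using distr_distr[OF XC shiftm] by (simp add: o_def)
    also have "distr P borel ?X = distr P borel X"
    proof (rule centered_gaussian_unique[OF gauss[OF X'] gauss[OF X]])
      show "(\<integral>x. x \<partial>distr P borel ?X) = 0" "(\<integral>x. x \<partial>distr P borel X) = 0"
        using meanX[OF X] meanX[OF X'] Xm[OF X] Xm[OF X'] by (simp_all add: integral_distr)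
      have "(\<integral>\<omega>. (?X \<omega>)\<^sup>2 \<partial>P) = (\<integral>\<omega>. (X \<omega>)\<^sup>2 \<partial>P)"
        unfolding Xeq(2)
        by (subst second[of "\<lambda>t \<omega>. wiener_shift \<tau> \<omega> t", OF ev(2) Rshift], subst second[of "\<lambda>t \<omega>. \<omega> t", OF ev(1)])
          (auto simp: cov R_def)
      then show "(\<integral>x. x\<^sup>2 \<partial>distr P borel ?X) = (\<integral>x. x\<^sup>2 \<partial>distr P borel X)"
        using Xm[OF X] Xm[OF X'] by (simp add: integral_distr)
    qed
    finally show ?thesis by simp
  qed
  have setsQ: "sets P = sets Q" by (simp add: Q_def sets)
  interpret Q: prob_space Q by (rule Q)
  have spaceQ: "space Q = C0" by (simp add: Q_def space_borel_C0)
  define E where "E = {{\<omega> \<in> C0. \<forall>t\<in>T. \<omega> t \<in> A t} | T A. finite T \<and> (\<forall>t\<in>T. A t \<in> sets borel)}"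
  have "P = Q"
  proof (rule measure_eqI_generator_eq[where E = E and \<Omega> = C0 and A = "\<lambda>_. C0"])
    show "Int_stable E"
    proof (rule Int_stableI)
      fix B C assume "B \<in> E" "C \<in> E"
      then obtain S A T A' where B: "B = {\<omega> \<in> C0. \<forall>t\<in>S. \<omega> t \<in> A t}" "finite S" "\<forall>t\<in>S. A t \<in> sets borel"
        and C: "C = {\<omega> \<in> C0. \<forall>t\<in>T. \<omega> t \<in> A' t}" "finite T" "\<forall>t\<in>T. A' t \<in> sets borel"
        unfolding E_def by blast
      define A'' where "A'' t = (if t \<in> S then A t else UNIV) \<inter> (if t \<in> T then A' t else UNIV)" for t
      have "B \<inter> C = {\<omega> \<in> C0. \<forall>t\<in>S \<union> T. \<omega> t \<in> A'' t}" by (auto simp: B C A''_def split: if_splits)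
      moreover have "\<forall>t\<in>S \<union> T. A'' t \<in> sets borel" using B C by (auto simp: A''_def)
      ultimately show "B \<inter> C \<in> E" unfolding E_def using B(2) C(2) by blast
    qed
    show EP: "E \<subseteq> Pow C0" by (auto simp: E_def)
    show "emeasure P B = emeasure Q B" if BE: "B \<in> E" for B
    proof -
      obtain T A where B: "B = {\<omega> \<in> C0. \<forall>t\<in>T. \<omega> t \<in> A t}" and T: "finite T" and A: "\<And>t. t \<in> T \<Longrightarrow> A t \<in> sets borel"
        using BE unfolding E_def by blast
      have "measure P {\<omega> \<in> space P. \<forall>t\<in>T. \<omega> t \<in> A t} = measure Q {\<omega> \<in> space Q. \<forall>t\<in>T. \<omega> t \<in> A t}"
        by (rule cramer_wold[OF P Q setsQ Xm path_functionals_lin path_functionals_zero law T ev(1) A])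
      then show ?thesis unfolding B by (simp add: P.emeasure_eq_measure Q.emeasure_eq_measure space spaceQ)
    qed
    have gen: "sigma_sets C0 E = sigma_sets C0 path_cylinders"
    proof (intro equalityI sigma_sets_mono subsetI)
      fix B assume "B \<in> E"
      then obtain T A where B: "B = {\<omega> \<in> C0. \<forall>t\<in>T. \<omega> t \<in> A t}" and T: "finite T" and A: "\<And>t. t \<in> T \<Longrightarrow> A t \<in> sets borel"
        unfolding E_def by blast
      have "{\<omega> \<in> space P. \<forall>t\<in>T. \<omega> t \<in> A t} \<in> sets P"
      proof (rule sets.sets_Collect_finite_All[OF _ T])
        fix t assume "t \<in> T"
        have "(\<lambda>\<omega>. \<omega> t) -` A t \<inter> space P \<in> sets P" by (rule measurable_sets[OF evm A[OF \<open>t \<in> T\<close>]])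
        also have "(\<lambda>\<omega>. \<omega> t) -` A t \<inter> space P = {\<omega> \<in> space P. \<omega> t \<in> A t}" by auto
        finally show "{\<omega> \<in> space P. \<omega> t \<in> A t} \<in> sets P" .
      qed
      then show "B \<in> sigma_sets C0 path_cylinders" by (simp add: B space sets sets_borel_C0)
    next
      fix B assume "B \<in> path_cylinders"
      then obtain t A where B: "B = {\<omega> \<in> C0. \<omega> t \<in> A}" "A \<in> sets borel" by (auto simp: path_cylinders_def)
      have "B = {\<omega> \<in> C0. \<forall>s\<in>{t}. \<omega> s \<in> A}" by (simp add: B)
      then have "B \<in> E" unfolding E_def using B(2) by (intro CollectI) (rule exI[of _ "{t}"], rule exI[of _ "\<lambda>_. A"], simp)
      then show "B \<in> sigma_sets C0 E" by (rule sigma_sets.Basic)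
    qed
    show "sets P = sigma_sets C0 E" by (simp add: gen sets sets_borel_C0)
    then show "sets Q = sigma_sets C0 E" by (simp add: setsQ)
    have "{\<omega> \<in> C0. \<forall>t\<in>{}. \<omega> t \<in> UNIV} \<in> E" unfolding E_def by blast
    then show "range (\<lambda>_. C0) \<subseteq> E" by auto
  qed auto
  then show ?thesis by (simp add: Q_def)
qed

section \<open>Joint measurability of the flow\<close>

context regular_path
begin

lemma uniform_sum_tendsto_young_integral:
  assumes "s \<le> t" shows "uniform_sum exp \<omega> s t \<longlonglongrightarrow> young_integral exp \<omega> s t"
proof -
  obtain G l where G: "\<forall>t. (G has_vector_derivative exp t * \<omega> t) (at t)" "(G \<longlongrightarrow> l) at_bot"
    using OU_representation by blast
  have "has_young_integral exp \<omega> s t (exp t * \<omega> t - G t - (exp s * \<omega> s - G s))"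
    by (rule young_integral_exp[OF _ assms]) (rule G(1)[rule_format])
  then show ?thesis using uniform_sum_tendsto[OF _ assms] young_integral_eq[OF _ assms] by metis
qed

lemma OU_tendsto: "(\<lambda>n. exp (- t) * young_integral exp \<omega> (t - real n) t) \<longlonglongrightarrow> OU t \<omega>"
proof -
  obtain G l where "(\<forall>t. ((\<lambda>s. young_integral exp \<omega> s t) \<longlongrightarrow> exp t * \<omega> t - (G t - l)) at_bot)"
    using OU_representation by blast
  then have lim: "((\<lambda>s. young_integral exp \<omega> s t) \<longlongrightarrow> exp t * \<omega> t - (G t - l)) at_bot" by blast
  then have "((\<lambda>s. young_integral exp \<omega> s t) \<longlongrightarrow> Lim at_bot (\<lambda>s. young_integral exp \<omega> s t)) at_bot"
    by (simp add: tendsto_Lim trivial_limit_at_bot_linorder)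
  moreover have "filterlim (\<lambda>n. t - real n) at_bot sequentially" by real_asymp
  ultimately have "(\<lambda>n. young_integral exp \<omega> (t - real n) t) \<longlonglongrightarrow> Lim at_bot (\<lambda>s. young_integral exp \<omega> s t)"
    by (rule filterlim_compose)
  then show ?thesis unfolding OU_def by (intro tendsto_intros)
qed

end

locale rde_random = rde_family \<alpha> \<Omega> f a b l m \<mu>
  for \<alpha> :: real and \<Omega> :: "(real \<Rightarrow> real) set"
    and f :: "'v::euclidean_space \<Rightarrow> 'v" and a :: real and b :: 'v and l m \<mu> :: real +
  fixes M :: "(real \<Rightarrow> real) measure"
  assumes spaceM: "space M = \<Omega>"
    and evM: "\<And>t. (\<lambda>\<omega>. \<omega> t) \<in> borel_measurable M"
    and shiftM: "\<And>t. wiener_shift t \<in> measurable M M"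
    and f_cont: "continuous_on UNIV f"
    and coefficients: "a \<noteq> 0" "\<mu> > 0"
begin

lemma regular: "\<omega> \<in> \<Omega> \<Longrightarrow> regular_path \<alpha> \<omega>"
  using path unfolding rde_def by blast

text \<open>A continuous path is the limit of its values at times rounded to multiples of \<open>1 / n\<close>, and
  only countably many evaluations occur for each \<open>n\<close>.\<close>

lemma joint_evaluation: "(\<lambda>z. snd z (fst z)) \<in> borel_measurable (borel \<Otimes>\<^sub>M M)"
proof (rule borel_measurable_LIMSEQ_metric)
  fix n :: nat
  let ?N = "real (Suc n)"
  show "(\<lambda>z :: real \<times> (real \<Rightarrow> real). snd z (real_of_int \<lfloor>?N * fst z\<rfloor> / ?N)) \<in> borel_measurable (borel \<Otimes>\<^sub>M M)"
  proof (rule measurable_compose_countable[where f = "\<lambda>i z. snd z (real_of_int i / ?N)" and g = "\<lambda>z :: real \<times> (real \<Rightarrow> real). \<lfloor>?N * fst z\<rfloor>"])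
    show "(\<lambda>z :: real \<times> (real \<Rightarrow> real). snd z (real_of_int i / ?N)) \<in> borel_measurable (borel \<Otimes>\<^sub>M M)" for i
      by (rule measurable_compose[OF measurable_snd evM])
    show "(\<lambda>z :: real \<times> (real \<Rightarrow> real). \<lfloor>?N * fst z\<rfloor>) \<in> measurable (borel \<Otimes>\<^sub>M M) (count_space UNIV)"
      by measurable
  qed
next
  fix z :: "real \<times> (real \<Rightarrow> real)" assume "z \<in> space (borel \<Otimes>\<^sub>M M)"
  then have "snd z \<in> \<Omega>" by (auto simp: space_pair_measure spaceM)
  then interpret regular_path \<alpha> "snd z" by (rule regular)
  have "(\<lambda>n. real_of_int \<lfloor>real (Suc n) * fst z\<rfloor> / real (Suc n) - fst z) \<longlonglongrightarrow> 0"
  proof (rule Lim_null_comparison)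
    show "\<forall>\<^sub>F n in sequentially. norm (real_of_int \<lfloor>real (Suc n) * fst z\<rfloor> / real (Suc n) - fst z) \<le> inverse (real (Suc n))"
    proof (intro always_eventually allI)
      fix n
      let ?N = "real (Suc n)"
      have "\<bar>real_of_int \<lfloor>?N * fst z\<rfloor> - ?N * fst z\<bar> \<le> 1" by linarith
      then have "\<bar>real_of_int \<lfloor>?N * fst z\<rfloor> - ?N * fst z\<bar> / ?N \<le> 1 / ?N" by (rule divide_right_mono) simp
      moreover have "real_of_int \<lfloor>?N * fst z\<rfloor> / ?N - fst z = (real_of_int \<lfloor>?N * fst z\<rfloor> - ?N * fst z) / ?N"
        by (simp add: diff_divide_distrib del: of_nat_Suc)
      ultimately show "norm (real_of_int \<lfloor>?N * fst z\<rfloor> / ?N - fst z) \<le> inverse ?N"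
        by (simp add: inverse_eq_divide del: of_nat_Suc)
    qed
    show "(\<lambda>n. inverse (real (Suc n))) \<longlonglongrightarrow> 0" by (rule LIMSEQ_inverse_real_of_nat)
  qed
  then have "(\<lambda>n. real_of_int \<lfloor>real (Suc n) * fst z\<rfloor> / real (Suc n)) \<longlonglongrightarrow> fst z" by (rule LIM_zero_cancel)
  moreover have "isCont (snd z) (fst z)" using cont by (simp add: continuous_on_eq_continuous_at)
  ultimately show "(\<lambda>n. snd z (real_of_int \<lfloor>real (Suc n) * fst z\<rfloor> / real (Suc n))) \<longlonglongrightarrow> snd z (fst z)"
    by (rule isCont_tendsto_compose[rotated])
qed

lemma evaluation_comp:
  assumes "g \<in> borel_measurable N" "h \<in> measurable N M"
  shows "(\<lambda>z. h z (g z)) \<in> borel_measurable N"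
  using measurable_compose[OF measurable_Pair[OF assms] joint_evaluation] by (simp only: fst_conv snd_conv)

lemma joint_OU: "(\<lambda>z. OU (fst z) (snd z)) \<in> borel_measurable (borel \<Otimes>\<^sub>M M)"
proof (rule borel_measurable_LIMSEQ_metric)
  fix n :: nat
  have "(\<lambda>z. young_integral exp (snd z) (fst z - real n) (fst z)) \<in> borel_measurable (borel \<Otimes>\<^sub>M M)"
  proof (rule borel_measurable_LIMSEQ_metric)
    fix k :: nat
    define node :: "nat \<Rightarrow> real \<times> (real \<Rightarrow> real) \<Rightarrow> real"
      where "node i z = fst z - real n + real i * ((fst z - (fst z - real n)) / real k)" for i z
    have node: "node i \<in> borel_measurable (borel \<Otimes>\<^sub>M M)" for i
      unfolding node_def[abs_def] by measurable
    have val: "(\<lambda>z. snd z (node i z)) \<in> borel_measurable (borel \<Otimes>\<^sub>M M)" for i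
      by (rule evaluation_comp[OF node measurable_snd])
    have "(\<lambda>z. \<Sum>i<k. (snd z (node (Suc i) z) - snd z (node i z)) * exp (node i z)) \<in> borel_measurable (borel \<Otimes>\<^sub>M M)"
      by (intro borel_measurable_sum borel_measurable_times borel_measurable_diff val
          measurable_compose[OF node borel_measurable_exp])
    then show "(\<lambda>z. uniform_sum exp (snd z) (fst z - real n) (fst z) k) \<in> borel_measurable (borel \<Otimes>\<^sub>M M)"
      by (simp only: uniform_sum_def real_scaleR_def node_def)
  next
    fix z :: "real \<times> (real \<Rightarrow> real)" assume "z \<in> space (borel \<Otimes>\<^sub>M M)"
    then have "snd z \<in> \<Omega>" by (auto simp: space_pair_measure spaceM)
    then interpret regular_path \<alpha> "snd z" by (rule regular)
    show "uniform_sum exp (snd z) (fst z - real n) (fst z) \<longlonglongrightarrow> young_integral exp (snd z) (fst z - real n) (fst z)"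
      by (rule uniform_sum_tendsto_young_integral) simp
  qed
  then show "(\<lambda>z. exp (- fst z) * young_integral exp (snd z) (fst z - real n) (fst z)) \<in> borel_measurable (borel \<Otimes>\<^sub>M M)"
    by measurable
next
  fix z :: "real \<times> (real \<Rightarrow> real)" assume "z \<in> space (borel \<Otimes>\<^sub>M M)"
  then have "snd z \<in> \<Omega>" by (auto simp: space_pair_measure spaceM)
  then interpret regular_path \<alpha> "snd z" by (rule regular)
  show "(\<lambda>n. exp (- fst z) * young_integral exp (snd z) (fst z - real n) (fst z)) \<longlonglongrightarrow> OU (fst z) (snd z)"
    by (rule OU_tendsto)
qed

lemma OU_comp:
  assumes "g \<in> borel_measurable N" "h \<in> measurable N M"
  shows "(\<lambda>z. OU (g z) (h z)) \<in> borel_measurable N"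
  using measurable_compose[OF measurable_Pair[OF assms] joint_OU] by (simp only: fst_conv snd_conv)

lemma field_comp:
  assumes [measurable]: "g \<in> borel_measurable N" "h \<in> measurable N M" "u \<in> borel_measurable N"
  shows "(\<lambda>z. rde_field f a b (h z) (g z) (u z)) \<in> borel_measurable N"
proof -
  have [measurable]: "(\<lambda>z. OU (g z) (h z)) \<in> borel_measurable N" by (rule OU_comp; fact)
  have [measurable]: "f \<in> borel_measurable borel" by (rule borel_measurable_continuous_onI[OF f_cont])
  show ?thesis unfolding rde_field_def by measurable
qed

lemma picard_measurable:
  "(\<lambda>z. picard (rde_field f a b (fst (snd z))) (snd (snd z)) n (fst z)) \<in> borel_measurable (borel \<Otimes>\<^sub>M (M \<Otimes>\<^sub>M borel))"
proof (induction n)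
  case (Suc n)
  let ?N = "(borel :: real measure) \<Otimes>\<^sub>M (M \<Otimes>\<^sub>M (borel :: 'v measure))"
  have time: "(\<lambda>(z, \<sigma>). \<sigma> * fst z) \<in> borel_measurable (?N \<Otimes>\<^sub>M lborel)" by measurable
  have path: "(\<lambda>(z, \<sigma>). fst (snd z)) \<in> measurable (?N \<Otimes>\<^sub>M lborel) M" by measurable
  have move: "(\<lambda>(z, \<sigma>). (\<sigma> * fst z, snd z)) \<in> measurable (?N \<Otimes>\<^sub>M lborel) ?N" by measurable
  have "(\<lambda>(z, \<sigma>). rde_field f a b (fst (snd z)) (\<sigma> * fst z)
      (picard (rde_field f a b (fst (snd z))) (snd (snd z)) n (\<sigma> * fst z))) \<in> borel_measurable (?N \<Otimes>\<^sub>M lborel)"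
    using field_comp[OF time path measurable_compose[OF move Suc]] by (simp add: case_prod_beta)
  then have "(\<lambda>(z, \<sigma>). indicator {0..1} \<sigma> *\<^sub>R rde_field f a b (fst (snd z)) (\<sigma> * fst z)
      (picard (rde_field f a b (fst (snd z))) (snd (snd z)) n (\<sigma> * fst z))) \<in> borel_measurable (?N \<Otimes>\<^sub>M lborel)"
    by measurable
  from lborel.borel_measurable_lebesgue_integral[OF this]
  show ?case
    by (simp add: scaled_integral_def set_lebesgue_integral_def)
qed simp

lemma flow_tendsto:
  "\<omega> \<in> \<Omega> \<Longrightarrow> (\<lambda>n. picard (rde_field f a b \<omega>) x n t) \<longlonglongrightarrow> \<psi> t \<omega> x"
proof -
  assume "\<omega> \<in> \<Omega>"
  interpret rde \<alpha> \<omega> f a b l m \<mu> by (rule path[OF \<open>\<omega> \<in> \<Omega>\<close>])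
  show ?thesis unfolding rde_flow_def by (rule ode.picard_tendsto)
qed

lemma joint_flow: "(\<lambda>z. \<psi> (fst z) (fst (snd z)) (snd (snd z))) \<in> borel_measurable (borel \<Otimes>\<^sub>M (M \<Otimes>\<^sub>M borel))"
  by (rule borel_measurable_LIMSEQ_metric[OF picard_measurable])
    (rule flow_tendsto, auto simp: space_pair_measure spaceM)

lemma flow_comp:
  assumes "g \<in> borel_measurable N" "h \<in> measurable N M" "u \<in> borel_measurable N"
  shows "(\<lambda>z. \<psi> (g z) (h z) (u z)) \<in> borel_measurable N"
  using measurable_compose[OF measurable_Pair[OF assms(1) measurable_Pair[OF assms(2,3)]] joint_flow]
  by (simp only: fst_conv snd_conv)

lemma pullback_point_measurable: "p \<in> borel_measurable M"
proof (rule borel_measurable_LIMSEQ_metric)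
  show "(\<lambda>\<omega>. \<psi> (real n) (wiener_shift (- real n) \<omega>) 0) \<in> borel_measurable M" for n
    by (rule flow_comp) (auto intro: shiftM)
  fix \<omega> assume "\<omega> \<in> space M"
  then have "((\<lambda>r. \<psi> r (wiener_shift (- r) \<omega>) 0) \<longlongrightarrow> p \<omega>) at_top"
    by (intro pullback_tendsto) (simp add: spaceM)
  from filterlim_compose[OF this filterlim_real_sequentially]
  show "(\<lambda>n. \<psi> (real n) (wiener_shift (- real n) \<omega>) 0) \<longlonglongrightarrow> p \<omega>" .
qed


section \<open>Tempered random points and singleton attractors\<close>

lemma temperedI:
  assumes "X \<in> borel_measurable M" "\<And>\<omega>. \<omega> \<in> \<Omega> \<Longrightarrow> X \<omega> \<ge> 0"
    and growth: "\<And>\<omega> \<epsilon>. \<omega> \<in> \<Omega> \<Longrightarrow> \<epsilon> > 0 \<Longrightarrow> \<exists>C>0. \<forall>t. X (wiener_shift t \<omega>) \<le> C * exp (\<epsilon> * \<bar>t\<bar>)"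
  shows "tempered M X"
  unfolding tempered_def spaceM
proof (intro conjI ballI)
  fix \<omega> assume \<omega>: "\<omega> \<in> \<Omega>"
  show "((\<lambda>t. max 0 (ln (X (wiener_shift t \<omega>))) / \<bar>t\<bar>) \<longlongrightarrow> 0) at_infinity"
  proof (rule tendstoI)
    fix e :: real assume "e > 0"
    then obtain C where C: "C > 0" "\<And>t. X (wiener_shift t \<omega>) \<le> C * exp (e / 2 * \<bar>t\<bar>)"
      using growth[OF \<omega>, of "e / 2"] by auto
    have bound: "max 0 (ln (X (wiener_shift t \<omega>))) \<le> \<bar>ln C\<bar> + e / 2 * \<bar>t\<bar>" for t
    proof (cases "X (wiener_shift t \<omega>) > 0")
      case True
      have "ln (X (wiener_shift t \<omega>)) \<le> ln (C * exp (e / 2 * \<bar>t\<bar>))"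
        using C True by (subst ln_le_cancel_iff) auto
      also have "\<dots> = ln C + e / 2 * \<bar>t\<bar>" using C(1) by (simp add: ln_mult)
      finally have "ln (X (wiener_shift t \<omega>)) \<le> \<bar>ln C\<bar> + e / 2 * \<bar>t\<bar>" by linarith
      moreover have "0 \<le> \<bar>ln C\<bar> + e / 2 * \<bar>t\<bar>" using \<open>e > 0\<close> by simp
      ultimately show ?thesis by simp
    next
      case False
      then have "X (wiener_shift t \<omega>) = 0" using assms(2)[OF shift[OF \<omega>], of t] by simp
      then show ?thesis using \<open>e > 0\<close> by simp
    qed
    show "\<forall>\<^sub>F t in at_infinity. dist (max 0 (ln (X (wiener_shift t \<omega>))) / \<bar>t\<bar>) 0 < e"
      unfolding eventually_at_infinity
    proof (intro exI[of _ "2 * \<bar>ln C\<bar> / e + 1"] allI impI)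
      fix t :: real assume t: "2 * \<bar>ln C\<bar> / e + 1 \<le> norm t"
      moreover have "0 \<le> 2 * \<bar>ln C\<bar> / e" using \<open>e > 0\<close> by simp
      ultimately have "2 * \<bar>ln C\<bar> / e < \<bar>t\<bar>" "\<bar>t\<bar> > 0" unfolding real_norm_def by linarith+
      then have "\<bar>ln C\<bar> < e / 2 * \<bar>t\<bar>" using \<open>e > 0\<close> by (simp add: field_simps)
      then have "max 0 (ln (X (wiener_shift t \<omega>))) < e * \<bar>t\<bar>" using bound[of t] by linarith
      then show "dist (max 0 (ln (X (wiener_shift t \<omega>))) / \<bar>t\<bar>) 0 < e"
        using \<open>\<bar>t\<bar> > 0\<close> by (simp add: dist_real_def abs_divide divide_less_eq)
    qed
  qed
qed (use assms in auto)

lemma tempered_bound: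
  assumes "tempered M X" "\<omega> \<in> \<Omega>" "\<epsilon> > 0"
  obtains R where "R > 0" "\<And>t. \<bar>t\<bar> \<ge> R \<Longrightarrow> X (wiener_shift t \<omega>) \<le> exp (\<epsilon> * \<bar>t\<bar>)"
proof -
  have "((\<lambda>t. max 0 (ln (X (wiener_shift t \<omega>))) / \<bar>t\<bar>) \<longlongrightarrow> 0) at_infinity"
    using assms unfolding tempered_def spaceM by blast
  then have "\<forall>\<^sub>F t in at_infinity. dist (max 0 (ln (X (wiener_shift t \<omega>))) / \<bar>t\<bar>) 0 < \<epsilon>"
    using \<open>\<epsilon> > 0\<close> by (rule tendstoD)
  then obtain R where R: "\<And>t. R \<le> \<bar>t\<bar> \<Longrightarrow> dist (max 0 (ln (X (wiener_shift t \<omega>))) / \<bar>t\<bar>) 0 < \<epsilon>"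
    by (auto simp: eventually_at_infinity)
  have "X (wiener_shift t \<omega>) \<le> exp (\<epsilon> * \<bar>t\<bar>)" if t: "max R 1 \<le> \<bar>t\<bar>" for t
  proof (cases "X (wiener_shift t \<omega>) > 0")
    case True
    have "\<bar>t\<bar> > 0" using t by auto
    then have "max 0 (ln (X (wiener_shift t \<omega>))) < \<epsilon> * \<bar>t\<bar>"
      using R[of t] t by (simp add: dist_real_def abs_divide divide_less_eq)
    then have "ln (X (wiener_shift t \<omega>)) \<le> \<epsilon> * \<bar>t\<bar>" by simp
    then have "exp (ln (X (wiener_shift t \<omega>))) \<le> exp (\<epsilon> * \<bar>t\<bar>)" by simp
    then show ?thesis using True by simp
  next
    case False
    then show ?thesis using exp_gt_zero[of "\<epsilon> * \<bar>t\<bar>"] by linarith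
  qed
  then show ?thesis using that[of "max R 1"] by simp
qed

text \<open>An exponential rate with linear dependence on the initial value beats the subexponential size
  of any tempered set, so such a rate is all that attraction requires.\<close>

lemma singleton_attractor:
  fixes \<phi> :: "real \<Rightarrow> (real \<Rightarrow> real) \<Rightarrow> 'v \<Rightarrow> 'v"
  assumes q: "q \<in> borel_measurable M"
    and growth: "\<And>\<omega> \<epsilon>. \<omega> \<in> \<Omega> \<Longrightarrow> \<epsilon> > 0 \<Longrightarrow> \<exists>C>0. \<forall>t. norm (q (wiener_shift t \<omega>)) \<le> C * exp (\<epsilon> * \<bar>t\<bar>)"
    and inv: "\<And>\<omega> t. \<omega> \<in> \<Omega> \<Longrightarrow> \<phi> t \<omega> (q \<omega>) = q (wiener_shift t \<omega>)"
    and attr: "\<And>\<omega>. \<omega> \<in> \<Omega> \<Longrightarrow> \<exists>C>0. \<exists>\<delta>>0. \<forall>t x. t \<ge> 0 \<longrightarrow>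
      norm (\<phi> t (wiener_shift (- t) \<omega>) x - q \<omega>) \<le> C * exp (- \<delta> * t) * (norm x + 1)"
  shows "random_attractor M \<phi> (\<lambda>\<omega>. {q \<omega>})"
  unfolding random_attractor_def
proof (intro conjI ballI allI impI)
  have "tempered M (\<lambda>\<omega>. norm (q \<omega>))"
    by (rule temperedI) (use q growth in auto)
  then show "(\<lambda>\<omega>. {q \<omega>}) \<in> tempered_closed_sets M"
    using q unfolding tempered_closed_sets_def random_set_def tempered_set_def by auto
  show "compact {q \<omega>}" for \<omega> by simp
  show "\<phi> t \<omega> ` {q \<omega>} = {q (wiener_shift t \<omega>)}" if "\<omega> \<in> space M" for \<omega> t
    using inv[of \<omega> t] that by (simp add: spaceM)
  fix D :: "(real \<Rightarrow> real) \<Rightarrow> 'v set" and \<omega> assume D: "D \<in> tempered_closed_sets M" and "\<omega> \<in> space M"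
  then have \<omega>: "\<omega> \<in> \<Omega>" by (simp add: spaceM)
  obtain C \<delta> where C: "C > 0" "\<delta> > 0" "\<And>t x. t \<ge> 0 \<Longrightarrow>
      norm (\<phi> t (wiener_shift (- t) \<omega>) x - q \<omega>) \<le> C * exp (- \<delta> * t) * (norm x + 1)"
    using attr[OF \<omega>] by blast
  have "tempered M (\<lambda>\<omega>. SUP x\<in>D \<omega>. norm x)" and bd: "\<And>\<omega>. \<omega> \<in> \<Omega> \<Longrightarrow> bounded (D \<omega>)"
    using D unfolding tempered_closed_sets_def tempered_set_def spaceM by auto
  moreover have "\<delta> / 2 > 0" using C by simp
  ultimately obtain R where R: "R > 0"
    "\<And>t. \<bar>t\<bar> \<ge> R \<Longrightarrow> (SUP x\<in>D (wiener_shift t \<omega>). norm x) \<le> exp (\<delta> / 2 * \<bar>t\<bar>)"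
    using tempered_bound[OF _ \<omega>] by metis
  have bound: "semidist (\<phi> t (wiener_shift (- t) \<omega>) ` D (wiener_shift (- t) \<omega>)) {q \<omega>}
      \<le> ennreal (2 * C * exp (- (\<delta> / 2) * t))" if t: "t \<ge> R" for t
    unfolding semidist_def
  proof (rule SUP_least)
    fix y assume "y \<in> \<phi> t (wiener_shift (- t) \<omega>) ` D (wiener_shift (- t) \<omega>)"
    then obtain x where x: "x \<in> D (wiener_shift (- t) \<omega>)" "y = \<phi> t (wiener_shift (- t) \<omega>) x" by blast
    have "bdd_above (norm ` D (wiener_shift (- t) \<omega>))"
      using bd[OF shift[OF \<omega>]] by (auto simp: bounded_iff bdd_above_def)
    then have "norm x \<le> (SUP x\<in>D (wiener_shift (- t) \<omega>). norm x)"
      using x(1) by (rule cSUP_upper[rotated])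
    also have "\<dots> \<le> exp (\<delta> / 2 * t)" using R(2)[of "- t"] R(1) t by simp
    finally have "norm x \<le> exp (\<delta> / 2 * t)" .
    moreover have "1 \<le> exp (\<delta> / 2 * t)" using R(1) t C(2) by simp
    ultimately have "norm x + 1 \<le> 2 * exp (\<delta> / 2 * t)" by linarith
    then have "C * exp (- \<delta> * t) * (norm x + 1) \<le> C * exp (- \<delta> * t) * (2 * exp (\<delta> / 2 * t))"
      using C(1) by (intro mult_left_mono) auto
    also have "\<dots> = 2 * C * exp (- (\<delta> / 2) * t)"
      by (simp add: field_simps flip: exp_add)
    finally have "norm (y - q \<omega>) \<le> 2 * C * exp (- (\<delta> / 2) * t)"
      using C(3)[of t x] R(1) t x(2) by simp
    then show "ennreal (infdist y {q \<omega>}) \<le> ennreal (2 * C * exp (- (\<delta> / 2) * t))"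
      by (simp add: dist_norm ennreal_leI)
  qed
  show "((\<lambda>t. semidist (\<phi> t (wiener_shift (- t) \<omega>) ` D (wiener_shift (- t) \<omega>)) {q \<omega>}) \<longlongrightarrow> 0) at_top"
  proof (rule tendsto_sandwich[OF _ _ tendsto_const])
    show "\<forall>\<^sub>F t in at_top. semidist (\<phi> t (wiener_shift (- t) \<omega>) ` D (wiener_shift (- t) \<omega>)) {q \<omega>}
        \<le> ennreal (2 * C * exp (- (\<delta> / 2) * t))"
      using eventually_ge_at_top[of R] by eventually_elim (rule bound)
    have "((\<lambda>t. 2 * C * exp (- (\<delta> / 2) * t)) \<longlongrightarrow> 0) at_top" using C(2) by real_asymp
    then show "((\<lambda>t. ennreal (2 * C * exp (- (\<delta> / 2) * t))) \<longlongrightarrow> 0) at_top"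
      using tendsto_ennrealI by fastforce
  qed simp
qed

lemma flow_rds: "rds M \<psi>"
  unfolding rds_def spaceM
proof (intro conjI ballI allI)
  show "(\<lambda>(t, \<omega>, x). \<psi> t \<omega> x) \<in> borel_measurable (borel \<Otimes>\<^sub>M (M \<Otimes>\<^sub>M borel))"
    using joint_flow by (simp add: case_prod_beta)
qed (auto simp: flow_zero cocycle fun_eq_iff)

lemma flow_generated: "generated_by M sol \<psi>"
  unfolding generated_by_def spaceM using sol_flow flow_zero flow_eq_sol by fastforce

lemma flow_growth:
  assumes "\<omega> \<in> \<Omega>" "\<epsilon> > 0"
  shows "\<exists>C>0. \<forall>t. norm (p (wiener_shift t \<omega>)) \<le> C * exp (\<epsilon> * \<bar>t\<bar>)"
proof -
  have "2 * \<epsilon> > 0" using assms(2) by simp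
  then obtain C where C: "C > 0" "\<And>t. (norm (p (wiener_shift t \<omega>)))\<^sup>2 \<le> C * exp (2 * \<epsilon> * \<bar>t\<bar>)"
    using pullback_growth[OF assms(1)] by metis
  have "norm (p (wiener_shift t \<omega>)) \<le> sqrt C * exp (\<epsilon> * \<bar>t\<bar>)" for t
  proof (rule power2_le_imp_le)
    have "exp (2 * \<epsilon> * \<bar>t\<bar>) = (exp (\<epsilon> * \<bar>t\<bar>))\<^sup>2" by (simp add: power2_eq_square flip: exp_add)
    then show "(norm (p (wiener_shift t \<omega>)))\<^sup>2 \<le> (sqrt C * exp (\<epsilon> * \<bar>t\<bar>))\<^sup>2"
      using C(2)[of t] C(1) by (simp add: power_mult_distrib)
  qed (use C in simp)
  then show ?thesis using C(1) by (intro exI[of _ "sqrt C"]) simp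
qed

lemma flow_attracts:
  assumes \<omega>: "\<omega> \<in> \<Omega>"
  shows "\<exists>C>0. \<exists>\<delta>>0. \<forall>t x. t \<ge> 0 \<longrightarrow>
      norm (\<psi> t (wiener_shift (- t) \<omega>) x - p \<omega>) \<le> C * exp (- \<delta> * t) * (norm x + 1)"
proof -
  obtain C where C: "C > 0" "\<And>t x. t \<ge> 0 \<Longrightarrow> (norm (\<psi> t (wiener_shift (- t) \<omega>) x - p \<omega>))\<^sup>2
      \<le> C * exp (- \<mu> * t) * (norm (x - p (wiener_shift (- t) \<omega>)))\<^sup>2"
    using pullback_attracts[OF \<omega>] by metis
  have "\<mu> / 4 > 0" using coefficients by simp
  then obtain D where D: "D > 0" "\<And>t. norm (p (wiener_shift t \<omega>)) \<le> D * exp (\<mu> / 4 * \<bar>t\<bar>)"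
    using flow_growth[OF \<omega>] by blast
  have "norm (\<psi> t (wiener_shift (- t) \<omega>) x - p \<omega>) \<le> (sqrt C * (1 + D)) * exp (- (\<mu> / 4) * t) * (norm x + 1)"
    if t: "t \<ge> 0" for t x
  proof -
    have "norm (\<psi> t (wiener_shift (- t) \<omega>) x - p \<omega>)
        \<le> sqrt C * exp (- (\<mu> / 2) * t) * norm (x - p (wiener_shift (- t) \<omega>))"
    proof (rule power2_le_imp_le)
      have "exp (- \<mu> * t) = (exp (- (\<mu> / 2) * t))\<^sup>2" by (simp add: power2_eq_square flip: exp_add)
      then show "(norm (\<psi> t (wiener_shift (- t) \<omega>) x - p \<omega>))\<^sup>2
          \<le> (sqrt C * exp (- (\<mu> / 2) * t) * norm (x - p (wiener_shift (- t) \<omega>)))\<^sup>2"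
        using C(2)[OF t, of x] C(1) by (simp add: power_mult_distrib)
    qed (use C in simp)
    also have "norm (x - p (wiener_shift (- t) \<omega>)) \<le> norm x + D * exp (\<mu> / 4 * t)"
      using norm_triangle_ineq4[of x "p (wiener_shift (- t) \<omega>)"] D(2)[of "- t"] t by simp
    also have "\<dots> \<le> (1 + D) * exp (\<mu> / 4 * t) * (norm x + 1)"
    proof -
      have e: "1 \<le> exp (\<mu> / 4 * t)" using t coefficients by simp
      have "norm x * 1 \<le> norm x * exp (\<mu> / 4 * t)" using e by (intro mult_left_mono) auto
      moreover have "0 \<le> D * exp (\<mu> / 4 * t) * norm x" "0 \<le> exp (\<mu> / 4 * t)" using D(1) by auto
      moreover have "(1 + D) * exp (\<mu> / 4 * t) * (norm x + 1) = norm x * exp (\<mu> / 4 * t) + exp (\<mu> / 4 * t)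
          + D * exp (\<mu> / 4 * t) * norm x + D * exp (\<mu> / 4 * t)" by (simp add: algebra_simps)
      ultimately show ?thesis by linarith
    qed
    also have "sqrt C * exp (- (\<mu> / 2) * t) * ((1 + D) * exp (\<mu> / 4 * t) * (norm x + 1))
        = (sqrt C * (1 + D)) * (exp (- (\<mu> / 2) * t) * exp (\<mu> / 4 * t)) * (norm x + 1)" by (simp only: mult_ac)
    also have "exp (- (\<mu> / 2) * t) * exp (\<mu> / 4 * t) = exp (- (\<mu> / 4) * t)" by (simp add: field_simps flip: exp_add)
    finally show ?thesis using C(1) by (simp add: mult_left_mono)
  qed
  moreover have "sqrt C * (1 + D) > 0" using C D by simp
  ultimately show ?thesis using \<open>\<mu> / 4 > 0\<close> by blast
qed

lemma flow_attractor: "random_attractor M \<psi> (\<lambda>\<omega>. {p \<omega>})"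
  by (rule singleton_attractor[OF pullback_point_measurable flow_growth pullback_invariant flow_attracts])

end

section \<open>The stochastic differential equation\<close>

text \<open>The change of variables as a function of the path, so that it can be shifted and measured.\<close>

definition to_sde :: "real \<Rightarrow> 'v::real_vector \<Rightarrow> real \<Rightarrow> (real \<Rightarrow> real) \<Rightarrow> 'v \<Rightarrow> 'v" where
  "to_sde a b t \<omega> u = exp (a * OU t \<omega>) *\<^sub>R u + (exp (a * OU t \<omega>) - 1) *\<^sub>R (b /\<^sub>R a)"

definition from_sde :: "real \<Rightarrow> 'v::real_vector \<Rightarrow> real \<Rightarrow> (real \<Rightarrow> real) \<Rightarrow> 'v \<Rightarrow> 'v" where
  "from_sde a b t \<omega> x = exp (- a * OU t \<omega>) *\<^sub>R (x + b /\<^sub>R a) - b /\<^sub>R a"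

lemma to_sde_center: "to_sde a b t \<omega> u = exp (a * OU t \<omega>) *\<^sub>R (u + b /\<^sub>R a) - b /\<^sub>R a"
  by (simp only: to_sde_def scaleR_add_right scaleR_diff_left scaleR_one add_diff_eq)

lemma to_from_sde: "to_sde a b t \<omega> (from_sde a b t \<omega> x) = x"
  unfolding to_sde_center from_sde_def by (simp flip: exp_add)

lemma from_to_sde: "from_sde a b t \<omega> (to_sde a b t \<omega> u) = u"
  unfolding to_sde_center from_sde_def by (simp flip: exp_add)

definition sde_flow ::
    "('v::euclidean_space \<Rightarrow> 'v) \<Rightarrow> real \<Rightarrow> 'v \<Rightarrow> real \<Rightarrow> (real \<Rightarrow> real) \<Rightarrow> 'v \<Rightarrow> 'v" where
  "sde_flow f a b t \<omega> x = to_sde a b t \<omega> (rde_flow f a b t \<omega> (from_sde a b 0 \<omega> x))"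

definition sde_point :: "('v::euclidean_space \<Rightarrow> 'v) \<Rightarrow> real \<Rightarrow> 'v \<Rightarrow> (real \<Rightarrow> real) \<Rightarrow> 'v" where
  "sde_point f a b \<omega> = to_sde a b 0 \<omega> (pullback_point f a b \<omega>)"

context rde_random
begin

abbreviation sde :: "(real \<Rightarrow> real) \<Rightarrow> (real \<Rightarrow> 'v) \<Rightarrow> bool" where
  "sde \<equiv> sde_solution \<alpha> f a b"

abbreviation \<phi> :: "real \<Rightarrow> (real \<Rightarrow> real) \<Rightarrow> 'v \<Rightarrow> 'v" where "\<phi> \<equiv> sde_flow f a b"

abbreviation x\<^sub>0 :: "(real \<Rightarrow> real) \<Rightarrow> 'v" where "x\<^sub>0 \<equiv> sde_point f a b"

lemma sde_iff_sol:
  assumes \<omega>: "\<omega> \<in> \<Omega>"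
  shows "sde \<omega> X \<longleftrightarrow> sol \<omega> (\<lambda>t. from_sde a b t \<omega> (X t))"
proof -
  interpret rde \<alpha> \<omega> f a b l m \<mu> by (rule path[OF \<omega>])
  have "(\<lambda>t. to_state t (from_sde a b t \<omega> (X t))) = X"
    using to_from_sde[unfolded to_sde_def] by blast
  then show ?thesis using sde_iff_rde[of "\<lambda>t. from_sde a b t \<omega> (X t)"] by simp
qed

lemma to_sde_shift: "\<omega> \<in> \<Omega> \<Longrightarrow> to_sde a b t (wiener_shift s \<omega>) = to_sde a b (t + s) \<omega>"
  by (simp add: to_sde_def fun_eq_iff OU_shift_family)

lemma from_sde_shift: "\<omega> \<in> \<Omega> \<Longrightarrow> from_sde a b t (wiener_shift s \<omega>) = from_sde a b (t + s) \<omega>"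
  by (simp add: from_sde_def fun_eq_iff OU_shift_family)

lemma to_sde_comp:
  assumes [measurable]: "g \<in> borel_measurable N" "h \<in> measurable N M" "u \<in> borel_measurable N"
  shows "(\<lambda>z. to_sde a b (g z) (h z) (u z)) \<in> borel_measurable N"
proof -
  have [measurable]: "(\<lambda>z. OU (g z) (h z)) \<in> borel_measurable N" by (rule OU_comp; fact)
  show ?thesis unfolding to_sde_def by measurable
qed

lemma from_sde_comp:
  assumes [measurable]: "g \<in> borel_measurable N" "h \<in> measurable N M" "u \<in> borel_measurable N"
  shows "(\<lambda>z. from_sde a b (g z) (h z) (u z)) \<in> borel_measurable N"
proof -
  have [measurable]: "(\<lambda>z. OU (g z) (h z)) \<in> borel_measurable N" by (rule OU_comp; fact)
  show ?thesis unfolding from_sde_def by measurable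
qed

lemma sde_flow_zero: "\<omega> \<in> \<Omega> \<Longrightarrow> \<phi> 0 \<omega> x = x"
  by (simp add: sde_flow_def flow_zero to_from_sde)

lemma sde_flow_sol: "\<omega> \<in> \<Omega> \<Longrightarrow> sde \<omega> (\<lambda>t. \<phi> t \<omega> x)"
  by (simp add: sde_iff_sol sde_flow_def from_to_sde sol_flow)

lemma sde_sol_eq_flow:
  assumes \<omega>: "\<omega> \<in> \<Omega>" and "sde \<omega> X" shows "X t = \<phi> t \<omega> (X 0)"
proof -
  have "rde_flow f a b t \<omega> (from_sde a b 0 \<omega> (X 0)) = from_sde a b t \<omega> (X t)"
    by (rule flow_eq_sol[OF \<omega>]) (use assms sde_iff_sol in blast)
  then show ?thesis by (simp add: sde_flow_def to_from_sde)
qed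

lemma sde_flow_generated: "generated_by M sde \<phi>"
  unfolding generated_by_def spaceM
proof (intro ballI allI iffI)
  fix \<omega> x X assume \<omega>: "\<omega> \<in> \<Omega>" and "sde \<omega> X \<and> X 0 = x"
  then show "X = (\<lambda>t. \<phi> t \<omega> x)" using sde_sol_eq_flow[OF \<omega>] by blast
qed (auto simp: sde_flow_sol sde_flow_zero)

lemma sde_cocycle:
  assumes \<omega>: "\<omega> \<in> \<Omega>" shows "\<phi> (t + s) \<omega> x = \<phi> t (wiener_shift s \<omega>) (\<phi> s \<omega> x)"
  by (simp add: sde_flow_def to_sde_shift[OF \<omega>] from_sde_shift[OF \<omega>] from_to_sde cocycle[OF \<omega>])

lemma sde_rds: "rds M \<phi>"
  unfolding rds_def spaceM
proof (intro conjI ballI allI)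
  have "(\<lambda>z. \<phi> (fst z) (fst (snd z)) (snd (snd z))) \<in> borel_measurable (borel \<Otimes>\<^sub>M (M \<Otimes>\<^sub>M borel))"
    unfolding sde_flow_def by (intro to_sde_comp flow_comp from_sde_comp) measurable
  then show "(\<lambda>(t, \<omega>, x). \<phi> t \<omega> x) \<in> borel_measurable (borel \<Otimes>\<^sub>M (M \<Otimes>\<^sub>M borel))"
    by (simp add: case_prod_beta)
qed (auto simp: sde_flow_zero sde_cocycle fun_eq_iff)

lemma sde_point_measurable: "x\<^sub>0 \<in> borel_measurable M"
  unfolding sde_point_def[abs_def]
  by (rule to_sde_comp) (auto intro: pullback_point_measurable)

lemma sde_point_shift:
  "\<omega> \<in> \<Omega> \<Longrightarrow> x\<^sub>0 (wiener_shift t \<omega>) = to_sde a b t \<omega> (p (wiener_shift t \<omega>))"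
  by (simp add: sde_point_def to_sde_shift)

lemma sde_point_invariant:
  assumes \<omega>: "\<omega> \<in> \<Omega>" shows "\<phi> t \<omega> (x\<^sub>0 \<omega>) = x\<^sub>0 (wiener_shift t \<omega>)"
  unfolding sde_point_shift[OF \<omega>]
  by (simp add: sde_flow_def sde_point_def from_to_sde pullback_invariant[OF \<omega>])

lemma exp_OU_growth:
  assumes \<omega>: "\<omega> \<in> \<Omega>" and "\<epsilon> > 0"
  obtains C where "C \<ge> 1" "\<And>t. exp (a * OU t \<omega>) \<le> C * exp (\<epsilon> * \<bar>t\<bar>)" "\<And>t. exp (- a * OU t \<omega>) \<le> C * exp (\<epsilon> * \<bar>t\<bar>)"
proof -
  interpret regular_path \<alpha> \<omega> by (rule regular[OF \<omega>])
  obtain c where c: "c > 0" "\<And>t. \<bar>a * OU t \<omega>\<bar> \<le> c + \<epsilon> * \<bar>t\<bar>"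
    using sublinearly_boundedE[OF sublinearly_bounded_cmult[OF OU_bounded] \<open>\<epsilon> > 0\<close>] by metis
  have "a * OU t \<omega> \<le> c + \<epsilon> * \<bar>t\<bar>" "- a * OU t \<omega> \<le> c + \<epsilon> * \<bar>t\<bar>" for t
    using c(2)[of t] by (auto simp: abs_le_iff)
  then have "exp (a * OU t \<omega>) \<le> exp (c + \<epsilon> * \<bar>t\<bar>)" "exp (- a * OU t \<omega>) \<le> exp (c + \<epsilon> * \<bar>t\<bar>)" for t
    by (simp_all only: exp_le_cancel_iff)
  then show ?thesis using that[of "exp c"] c(1) by (simp add: exp_add)
qed

lemma sde_point_growth:
  assumes \<omega>: "\<omega> \<in> \<Omega>" and "\<epsilon> > 0"
  shows "\<exists>C>0. \<forall>t. norm (x\<^sub>0 (wiener_shift t \<omega>)) \<le> C * exp (\<epsilon> * \<bar>t\<bar>)"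
proof -
  define B where "B = norm (b /\<^sub>R a)"
  have "B \<ge> 0" by (simp add: B_def)
  have e2: "\<epsilon> / 2 > 0" using \<open>\<epsilon> > 0\<close> by simp
  obtain C where C: "C \<ge> 1" "\<And>t. exp (a * OU t \<omega>) \<le> C * exp (\<epsilon> / 2 * \<bar>t\<bar>)"
    using exp_OU_growth[OF \<omega> e2] by metis
  obtain D where D: "D > 0" "\<And>t. norm (p (wiener_shift t \<omega>)) \<le> D * exp (\<epsilon> / 2 * \<bar>t\<bar>)"
    using flow_growth[OF \<omega> e2] by blast
  have "norm (x\<^sub>0 (wiener_shift t \<omega>)) \<le> (C * (D + B) + B) * exp (\<epsilon> * \<bar>t\<bar>)" for t
  proof -
    define E where "E = exp (\<epsilon> / 2 * \<bar>t\<bar>)"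
    have E: "E \<ge> 1" using e2 by (simp add: E_def)
    have EE: "exp (\<epsilon> * \<bar>t\<bar>) = E * E" by (simp add: E_def flip: exp_add)
    have "1 * 1 \<le> E * E" using E by (intro mult_mono) auto
    have "norm (x\<^sub>0 (wiener_shift t \<omega>)) \<le> exp (a * OU t \<omega>) * norm (p (wiener_shift t \<omega>) + b /\<^sub>R a) + B"
      unfolding sde_point_shift[OF \<omega>] to_sde_center B_def
      using norm_triangle_ineq4[of "exp (a * OU t \<omega>) *\<^sub>R (p (wiener_shift t \<omega>) + b /\<^sub>R a)" "b /\<^sub>R a"] by simp
    also have "exp (a * OU t \<omega>) * norm (p (wiener_shift t \<omega>) + b /\<^sub>R a) \<le> (C * E) * ((D + B) * E)"
    proof (rule mult_mono)
      show "exp (a * OU t \<omega>) \<le> C * E" using C(2) by (simp add: E_def)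
      have "norm (p (wiener_shift t \<omega>) + b /\<^sub>R a) \<le> D * E + B * 1"
        using norm_triangle_ineq[of "p (wiener_shift t \<omega>)" "b /\<^sub>R a"] D(2)[of t] by (simp add: E_def B_def)
      also have "\<dots> \<le> D * E + B * E" using E \<open>B \<ge> 0\<close> by (intro add_left_mono mult_left_mono) auto
      finally show "norm (p (wiener_shift t \<omega>) + b /\<^sub>R a) \<le> (D + B) * E" by (simp add: distrib_right)
    qed (use C E in auto)
    finally have "norm (x\<^sub>0 (wiener_shift t \<omega>)) \<le> (C * E) * ((D + B) * E) + B" by simp
    moreover have "B \<le> B * (E * E)"
      using \<open>1 * 1 \<le> E * E\<close> \<open>B \<ge> 0\<close> mult_left_mono[of 1 "E * E" B] by simp
    moreover have "(C * (D + B) + B) * (E * E) = (C * E) * ((D + B) * E) + B * (E * E)"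
      by (simp add: algebra_simps)
    ultimately show ?thesis unfolding EE by linarith
  qed
  moreover have "C * (D + B) + B > 0" using C D \<open>B \<ge> 0\<close> by (intro add_pos_nonneg mult_pos_pos) auto
  ultimately show ?thesis by blast
qed

lemma sde_attracts:
  assumes \<omega>: "\<omega> \<in> \<Omega>"
  shows "\<exists>C>0. \<exists>\<delta>>0. \<forall>t x. t \<ge> 0 \<longrightarrow>
      norm (\<phi> t (wiener_shift (- t) \<omega>) x - x\<^sub>0 \<omega>) \<le> C * exp (- \<delta> * t) * (norm x + 1)"
proof -
  define B where "B = norm (b /\<^sub>R a)"
  have "B \<ge> 0" by (simp add: B_def)
  obtain C \<delta> where C: "C > 0" "\<delta> > 0" "\<And>t x. t \<ge> 0 \<Longrightarrow>
      norm (\<psi> t (wiener_shift (- t) \<omega>) x - p \<omega>) \<le> C * exp (- \<delta> * t) * (norm x + 1)"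
    using flow_attracts[OF \<omega>] by blast
  have d2: "\<delta> / 2 > 0" using C by simp
  obtain D where D: "D \<ge> 1" "\<And>t. exp (- a * OU t \<omega>) \<le> D * exp (\<delta> / 2 * \<bar>t\<bar>)"
    using exp_OU_growth[OF \<omega> d2] by metis
  define E0 where "E0 = exp (a * OU 0 \<omega>)"
  have "E0 > 0" by (simp add: E0_def)
  have "norm (\<phi> t (wiener_shift (- t) \<omega>) x - x\<^sub>0 \<omega>) \<le> (E0 * C * (D * (1 + B) + B + 1)) * exp (- (\<delta> / 2) * t) * (norm x + 1)"
    if t: "t \<ge> 0" for t x
  proof -
    define y where "y = from_sde a b (- t) \<omega> x"
    define E where "E = exp (\<delta> / 2 * t)"
    have E: "E \<ge> 1" using d2 t by (simp add: E_def)
    have "norm y \<le> exp (- a * OU (- t) \<omega>) * norm (x + b /\<^sub>R a) + B"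
      unfolding y_def from_sde_def B_def
      using norm_triangle_ineq4[of "exp (- a * OU (- t) \<omega>) *\<^sub>R (x + b /\<^sub>R a)" "b /\<^sub>R a"] by simp
    also have "exp (- a * OU (- t) \<omega>) * norm (x + b /\<^sub>R a) \<le> (D * E) * (norm x + B)"
      using D(2)[of "- t"] D(1) E t norm_triangle_ineq[of x "b /\<^sub>R a"]
      by (intro mult_mono) (auto simp: E_def B_def)
    finally have "norm y + 1 \<le> (D * E) * (norm x + B) + (B + 1)" by simp
    also have "\<dots> \<le> (D * E) * ((1 + B) * (norm x + 1)) + (B + 1) * (E * (norm x + 1))"
    proof (intro add_mono mult_left_mono)
      have "0 \<le> B * norm x" using \<open>B \<ge> 0\<close> by simp
      then show "norm x + B \<le> (1 + B) * (norm x + 1)" by (simp add: algebra_simps)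
      have "1 * 1 \<le> E * (norm x + 1)" using E by (intro mult_mono) auto
      then have "(B + 1) * 1 \<le> (B + 1) * (E * (norm x + 1))" using \<open>B \<ge> 0\<close> by (intro mult_left_mono) auto
      then show "B + 1 \<le> (B + 1) * (E * (norm x + 1))" by simp
    qed (use D E in auto)
    also have "\<dots> = (D * (1 + B) + B + 1) * E * (norm x + 1)" by (simp add: algebra_simps)
    finally have y: "norm y + 1 \<le> (D * (1 + B) + B + 1) * E * (norm x + 1)" .
    have "\<phi> t (wiener_shift (- t) \<omega>) x - x\<^sub>0 \<omega> = E0 *\<^sub>R (\<psi> t (wiener_shift (- t) \<omega>) y - p \<omega>)"
      by (simp add: sde_flow_def sde_point_def to_sde_shift[OF \<omega>] from_sde_shift[OF \<omega>] y_def E0_def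
          to_sde_def scaleR_diff_right)
    then have "norm (\<phi> t (wiener_shift (- t) \<omega>) x - x\<^sub>0 \<omega>) = E0 * norm (\<psi> t (wiener_shift (- t) \<omega>) y - p \<omega>)"
      using \<open>E0 > 0\<close> by simp
    also have "\<dots> \<le> E0 * (C * exp (- \<delta> * t) * (norm y + 1))"
      using \<open>E0 > 0\<close> C(3)[OF t] by (intro mult_left_mono) auto
    also have "\<dots> \<le> E0 * (C * exp (- \<delta> * t) * ((D * (1 + B) + B + 1) * E * (norm x + 1)))"
      using \<open>E0 > 0\<close> C(1) y by (intro mult_left_mono) auto
    also have "\<dots> = (E0 * C * (D * (1 + B) + B + 1)) * (exp (- \<delta> * t) * E) * (norm x + 1)" by (simp only: mult_ac)
    also have "exp (- \<delta> * t) * E = exp (- (\<delta> / 2) * t)" by (simp add: E_def field_simps flip: exp_add)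
    finally show ?thesis .
  qed
  moreover have "E0 * C * (D * (1 + B) + B + 1) > 0"
    using \<open>E0 > 0\<close> C D \<open>B \<ge> 0\<close> by (intro mult_pos_pos add_nonneg_pos) auto
  ultimately show ?thesis using d2 by blast
qed

lemma sde_attractor: "random_attractor M \<phi> (\<lambda>\<omega>. {x\<^sub>0 \<omega>})"
  by (rule singleton_attractor[OF sde_point_measurable sde_point_growth sde_point_invariant sde_attracts])

lemma sde_point_stationary: "stationary_solution M sde x\<^sub>0"
  unfolding stationary_solution_def spaceM
  using sde_point_measurable sde_flow_sol by (simp flip: sde_point_invariant)

text \<open>A stationary solution need not be tempered, so pullback attraction says nothing about it.
  Forward in time, however, its distance from \<open>p\<close> after the change of variables tends to zero along
  every path, while the law of
  this distance does not change; hence the distance is zero almost surely. Truncation by \<open>1\<close> in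
  \<open>d\<close> makes dominated convergence applicable.\<close>

lemma stationary_unique:
  assumes prob: "prob_space M" and inv: "\<And>n::nat. distr M M (wiener_shift (real n)) = M"
    and y: "stationary_solution M sde y"
  shows "AE \<omega> in M. \<forall>t. y (wiener_shift t \<omega>) = x\<^sub>0 (wiener_shift t \<omega>)"
proof -
  interpret prob_space M by fact
  have ym[measurable]: "y \<in> borel_measurable M" and ysol: "\<And>\<omega>. \<omega> \<in> \<Omega> \<Longrightarrow> sde \<omega> (\<lambda>t. y (wiener_shift t \<omega>))"
    using y by (auto simp: stationary_solution_def spaceM)
  define d where "d \<omega> = min 1 (norm (from_sde a b 0 \<omega> (y \<omega>) - p \<omega>))" for \<omega>
  have [measurable]: "(\<lambda>\<omega>. from_sde a b 0 \<omega> (y \<omega>)) \<in> borel_measurable M" "p \<in> borel_measurable M"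
    by (auto intro!: from_sde_comp pullback_point_measurable)
  have dm[measurable]: "d \<in> borel_measurable M" unfolding d_def[abs_def] by measurable
  have orbit: "from_sde a b t \<omega> (y (wiener_shift t \<omega>)) = \<psi> t \<omega> (from_sde a b 0 \<omega> (y \<omega>))"
    if "\<omega> \<in> \<Omega>" for \<omega> t
    using flow_eq_sol[OF that, of "\<lambda>t. from_sde a b t \<omega> (y (wiener_shift t \<omega>))" t] ysol[OF that]
    by (simp add: sde_iff_sol[OF that] shift_0[OF that])
  have lim: "(\<lambda>n. d (wiener_shift (real n) \<omega>)) \<longlonglongrightarrow> 0" if \<omega>: "\<omega> \<in> \<Omega>" for \<omega>
  proof -
    obtain \<rho> where \<rho>: "(\<rho> \<longlongrightarrow> 0) at_top"
      "\<And>t x y. t \<ge> 0 \<Longrightarrow> (norm (\<psi> t \<omega> x - \<psi> t \<omega> y))\<^sup>2 \<le> (norm (x - y))\<^sup>2 * \<rho> t"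
      using forward_contraction[OF \<omega>] by metis
    let ?D = "\<lambda>t. \<psi> t \<omega> (from_sde a b 0 \<omega> (y \<omega>)) - \<psi> t \<omega> (p \<omega>)"
    have "((\<lambda>t. (norm (?D t))\<^sup>2) \<longlongrightarrow> 0) at_top"
    proof (rule Lim_null_comparison)
      show "\<forall>\<^sub>F t in at_top. norm ((norm (?D t))\<^sup>2) \<le> (norm (from_sde a b 0 \<omega> (y \<omega>) - p \<omega>))\<^sup>2 * \<rho> t"
        using eventually_ge_at_top[of 0] by eventually_elim (use \<rho>(2) in simp)
      show "((\<lambda>t. (norm (from_sde a b 0 \<omega> (y \<omega>) - p \<omega>))\<^sup>2 * \<rho> t) \<longlongrightarrow> 0) at_top"
        by (rule tendsto_mult_right_zero[OF \<rho>(1)])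
    qed
    then have "(?D \<longlongrightarrow> 0) at_top" by (rule tendsto_zero_of_norm_power2)
    from tendsto_norm_zero[OF filterlim_compose[OF this filterlim_real_sequentially]]
    have Dn: "(\<lambda>n. norm (?D (real n))) \<longlonglongrightarrow> 0" .
    show ?thesis
    proof (rule Lim_null_comparison[OF _ Dn], intro always_eventually allI)
      fix n
      have "from_sde a b 0 (wiener_shift (real n) \<omega>) (y (wiener_shift (real n) \<omega>)) - p (wiener_shift (real n) \<omega>)
          = \<psi> n \<omega> (from_sde a b 0 \<omega> (y \<omega>)) - \<psi> n \<omega> (p \<omega>)"
        by (simp add: from_sde_shift[OF \<omega>] orbit[OF \<omega>] pullback_invariant[OF \<omega>])
      then show "norm (d (wiener_shift (real n) \<omega>)) \<le> norm (?D (real n))" by (simp add: d_def)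
    qed
  qed
  have "(\<integral>\<omega>. d (wiener_shift (real n) \<omega>) \<partial>M) = (\<integral>\<omega>. d \<omega> \<partial>M)" for n
    using integral_distr[OF shiftM[of "real n"] dm] by (simp add: inv)
  moreover have "(\<lambda>n. \<integral>\<omega>. d (wiener_shift (real n) \<omega>) \<partial>M) \<longlonglongrightarrow> (\<integral>\<omega>. 0 \<partial>M)"
  proof (rule integral_dominated_convergence[where w = "\<lambda>_. 1"])
    show "(\<lambda>\<omega>. d (wiener_shift (real n) \<omega>)) \<in> borel_measurable M" for n
      by (rule measurable_compose[OF shiftM dm])
    show "AE \<omega> in M. (\<lambda>n. d (wiener_shift (real n) \<omega>)) \<longlonglongrightarrow> 0"
      by (rule AE_I2) (use lim spaceM in auto)
  qed (auto simp: d_def)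
  ultimately have "(\<integral>\<omega>. d \<omega> \<partial>M) = 0" by (simp add: LIMSEQ_const_iff)
  moreover have "integrable M d"
    by (rule integrable_const_bound[where B = 1]) (auto simp: d_def)
  ultimately have "AE \<omega> in M. d \<omega> = 0"
    by (subst (asm) integral_nonneg_eq_0_iff_AE) (auto simp: d_def)
  then show ?thesis
  proof (rule AE_mp, intro AE_I2 impI allI)
    fix \<omega> t assume "\<omega> \<in> space M" "d \<omega> = 0"
    then have \<omega>: "\<omega> \<in> \<Omega>" and start: "from_sde a b 0 \<omega> (y \<omega>) = p \<omega>"
      by (auto simp: spaceM d_def min_def split: if_splits)
    have "from_sde a b t \<omega> (y (wiener_shift t \<omega>)) = p (wiener_shift t \<omega>)"
      unfolding orbit[OF \<omega>] start by (rule pullback_invariant[OF \<omega>])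
    then have "y (wiener_shift t \<omega>) = to_sde a b t \<omega> (p (wiener_shift t \<omega>))"
      using to_from_sde[of a b t \<omega> "y (wiener_shift t \<omega>)"] by simp
    then show "y (wiener_shift t \<omega>) = x\<^sub>0 (wiener_shift t \<omega>)" by (simp add: sde_point_shift[OF \<omega>])
  qed
qed

end

theorem mainTheorem1:
  fixes H \<alpha> a :: real
    and b :: "real ^ 'd"
    and f :: "real ^ 'd \<Rightarrow> real ^ 'd"
    and P :: "(real \<Rightarrow> real) measure"
    and \<Omega> :: "(real \<Rightarrow> real) set"
  assumes H: "1/2 < H" "H < 1"
    and \<alpha>: "1/2 < \<alpha>" "\<alpha> < H"
    and P: "fbm_law H P"
    and \<Omega>: "admissible_paths \<alpha> P \<Omega>"
    and a: "a \<noteq> 0"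
    and f_regular: "local_lipschitz (UNIV :: real set) UNIV (\<lambda>_. f)"
    and f_growth: "linear_growth f"
    and f_dissipative: "dissipative_one_sided_lipschitz f"
    and f_integrable: "integrability_condition f"
  defines "M \<equiv> restrict_space P \<Omega>"
  shows
    "(\<forall>\<omega>\<in>\<Omega>. \<forall>t0 U1 U2.
        rde_solution_on {t0..} f a b \<omega> U1 \<and> rde_solution_on {t0..} f a b \<omega> U2 \<longrightarrow>
        ((\<lambda>t. (norm (U1 t - U2 t))\<^sup>2) \<longlongrightarrow> 0) at_top)
     \<and>
     (\<exists>\<psi> p.
        generated_by M (rde_solution_on UNIV f a b) \<psi> \<and> rds M \<psi> \<and>
        p \<in> borel_measurable M \<and> random_attractor M \<psi> (\<lambda>\<omega>. {p \<omega>}) \<and>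
        (\<exists>\<phi> x.
           generated_by M (sde_solution \<alpha> f a b) \<phi> \<and> rds M \<phi> \<and>
           random_attractor M \<phi> (\<lambda>\<omega>. {x \<omega>}) \<and>
           (\<forall>\<omega>\<in>\<Omega>. \<forall>t. x (wiener_shift t \<omega>) =
              exp (a * OU t \<omega>) *\<^sub>R p (wiener_shift t \<omega>) + exp (a * OU t \<omega>) *\<^sub>R (b /\<^sub>R a) - b /\<^sub>R a) \<and>
           stationary_solution M (sde_solution \<alpha> f a b) x \<and>
           (\<forall>y. stationary_solution M (sde_solution \<alpha> f a b) y \<longrightarrow>
              (AE \<omega> in M. \<forall>t. y (wiener_shift t \<omega>) = x (wiener_shift t \<omega>)))))"
proof -
  have Pprob: "prob_space P" and Pspace: "space P = C0" and Psets: "sets P = sets borel_C0"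
    using P by (auto simp: fbm_law_def)
  have \<Omega>set: "\<Omega> \<in> sets P" and \<Omega>full: "measure P \<Omega> = 1" and \<Omega>shift: "\<And>t. wiener_shift t ` \<Omega> = \<Omega>"
    and \<Omega>path: "\<And>\<omega>. \<omega> \<in> \<Omega> \<Longrightarrow> locally_holder \<alpha> \<omega>" "\<And>\<omega>. \<omega> \<in> \<Omega> \<Longrightarrow> sublinear_growth \<omega>"
    using \<Omega> by (auto simp: admissible_paths_def)
  have \<Omega>C0: "\<Omega> \<subseteq> C0" using sets.sets_into_space[OF \<Omega>set] by (simp add: Pspace)
  obtain l m where lm: "l > 0" "m > 0" "\<And>x. norm (f x) \<le> l * norm x + m"
    using f_growth by (auto simp: linear_growth_def)
  obtain \<mu> where \<mu>: "\<mu> > 0" "\<And>x y. (x - y) \<bullet> (f x - f y) \<le> - \<mu> * (norm (x - y))\<^sup>2"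
    using f_dissipative by (auto simp: dissipative_one_sided_lipschitz_def)
  have f_lip: "\<exists>K>0. \<forall>u v. norm u \<le> R \<and> norm v \<le> R \<longrightarrow> norm (f u - f v) \<le> K * norm (u - v)" for R
  proof -
    have "local_lipschitz {0::real} (cball 0 R) (\<lambda>_. f)"
      by (rule local_lipschitz_subset[OF f_regular]) auto
    then obtain K where K: "\<And>t. t \<in> {0::real} \<Longrightarrow> K-lipschitz_on (cball 0 R) f"
      by (rule local_lipschitz_compact_implies_lipschitz[where f = "\<lambda>_. f" and X = "cball 0 R"]) auto
    have "norm (f u - f v) \<le> (K + 1) * norm (u - v)" if "norm u \<le> R" "norm v \<le> R" for u v
    proof -
      have "dist (f u) (f v) \<le> K * dist u v" using K[of 0] that by (intro lipschitz_onD) auto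
      then show ?thesis unfolding dist_norm distrib_right using norm_ge_zero[of "u - v"] by linarith
    qed
    moreover have "K + 1 > 0" using lipschitz_on_nonneg[OF K[of 0]] by simp
    ultimately show ?thesis by blast
  qed
  have f_cont: "continuous_on UNIV f"
  proof -
    have "isCont f x" for x
    proof -
      obtain K where K: "K > 0" "\<And>u v. norm u \<le> norm x + 1 \<Longrightarrow> norm v \<le> norm x + 1 \<Longrightarrow> norm (f u - f v) \<le> K * norm (u - v)"
        using f_lip[of "norm x + 1"] by blast
      have "((\<lambda>y. f y - f x) \<longlongrightarrow> 0) (at x)"
      proof (rule Lim_null_comparison)
        have "\<forall>\<^sub>F y in at x. dist y x < 1" by (auto simp: eventually_at intro: exI[of _ 1])
        then show "\<forall>\<^sub>F y in at x. norm (f y - f x) \<le> K * norm (y - x)"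
        proof eventually_elim
          case (elim y)
          then have "norm y \<le> norm x + 1" using norm_triangle_ineq2[of y x] by (simp add: dist_norm)
          then show ?case by (intro K) auto
        qed
        have "((\<lambda>y. K * norm (y - x)) \<longlongrightarrow> K * norm (x - x)) (at x)" by (intro tendsto_intros)
        then show "((\<lambda>y. K * norm (y - x)) \<longlongrightarrow> 0) (at x)" by simp
      qed
      then show ?thesis by (simp add: isCont_def LIM_zero_iff)
    qed
    then show ?thesis by (simp add: continuous_at_imp_continuous_on)
  qed
  have path: "rde \<alpha> \<omega> f a l m \<mu>" if "\<omega> \<in> \<Omega>" for \<omega>
  proof
    show "continuous_on UNIV \<omega>" using that \<Omega>C0 by (auto simp: C0_def)
    show "\<And>R. \<exists>K>0. \<forall>u v. norm u \<le> R \<and> norm v \<le> R \<longrightarrow> norm (f u - f v) \<le> K * norm (u - v)"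
      by (rule f_lip)
    show "\<And>x. norm (f x) \<le> l * norm x + m" by (rule lm)
    show "\<And>x y. (x - y) \<bullet> (f x - f y) \<le> - \<mu> * (norm (x - y))\<^sup>2" by (rule \<mu>)
  qed (use H \<alpha> a lm \<mu> f_cont \<Omega>path[OF that] in auto)
  have spaceM: "space M = \<Omega>" using \<Omega>C0 by (auto simp: M_def space_restrict_space Pspace)
  have evM: "(\<lambda>\<omega>. \<omega> t) \<in> borel_measurable M" for t
    unfolding M_def using evaluation_measurable[of t]
    by (intro measurable_restrict_space1) (simp add: measurable_cong_sets[OF Psets refl])
  have shiftP: "wiener_shift t \<in> measurable P P" for t
    using wiener_shift_measurable[of t] by (simp add: measurable_cong_sets[OF Psets Psets])
  have shift\<Omega>: "wiener_shift t \<omega> \<in> \<Omega>" if "\<omega> \<in> \<Omega>" for t \<omega> using \<Omega>shift[of t] that by blast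
  have shiftM: "wiener_shift t \<in> measurable M M" for t
    unfolding M_def
    by (intro measurable_restrict_space2 measurable_restrict_space1 shiftP)
      (auto simp: space_restrict_space intro: shift\<Omega>)
  have zero\<Omega>: "\<omega> 0 = 0" if "\<omega> \<in> \<Omega>" for \<omega> using that \<Omega>C0 by (auto simp: C0_def)
  interpret rde_random \<alpha> \<Omega> f a b l m \<mu> M
    by (intro rde_random.intro rde_family.intro rde_random_axioms.intro path shift\<Omega> zero\<Omega> spaceM evM shiftM
        f_cont a \<mu>(1))
  interpret P: prob_space P by fact
  have emeasure_M: "emeasure M B = emeasure P B" if "B \<subseteq> \<Omega>" for B
    unfolding M_def using \<Omega>set that by (intro emeasure_restrict_space) auto
  have Mprob: "prob_space M"
  proof
    show "emeasure M (space M) = 1"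
      unfolding spaceM using emeasure_M[of \<Omega>] \<Omega>full by (simp add: P.emeasure_eq_measure)
  qed
  have inv: "distr M M (wiener_shift t) = M" for t
  proof (rule measure_eqI)
    fix B assume "B \<in> sets (distr M M (wiener_shift t))"
    then have B: "B \<in> sets M" by simp
    then have B\<Omega>: "B \<subseteq> \<Omega>" using sets.sets_into_space spaceM by blast
    have BP: "B \<in> sets P" using B \<Omega>set by (auto simp: M_def sets_restrict_space_iff)
    \<comment> \<open>\<open>\<Omega>\<close> is invariant under the inverse shift as well, so restricting to it loses no preimages.\<close>
    have preimage_C0: "wiener_shift t -` B \<inter> C0 = wiener_shift t -` B \<inter> \<Omega>"
    proof (intro equalityI subsetI)
      fix \<omega> assume \<omega>: "\<omega> \<in> wiener_shift t -` B \<inter> C0"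
      then have "wiener_shift t \<omega> \<in> \<Omega>" using B\<Omega> by blast
      then have "wiener_shift (- t) (wiener_shift t \<omega>) \<in> \<Omega>" by (rule shift\<Omega>)
      moreover have "wiener_shift (- t) (wiener_shift t \<omega>) = \<omega>"
        using \<omega> unfolding wiener_shift_add by (auto simp: wiener_shift_def C0_def)
      ultimately show "\<omega> \<in> wiener_shift t -` B \<inter> \<Omega>" using \<omega> by simp
    qed (use \<Omega>C0 in auto)
    have "emeasure (distr M M (wiener_shift t)) B = emeasure M (wiener_shift t -` B \<inter> \<Omega>)"
      using B by (simp add: emeasure_distr[OF shiftM] spaceM)
    also have "\<dots> = emeasure P (wiener_shift t -` B \<inter> C0)" by (simp add: emeasure_M preimage_C0)
    also have "\<dots> = emeasure (distr P borel_C0 (wiener_shift t)) B"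
    proof -
      have "wiener_shift t \<in> measurable P borel_C0"
        using shiftP[of t] by (simp add: measurable_cong_sets[OF refl Psets])
      then show ?thesis using BP by (simp add: emeasure_distr Pspace Psets)
    qed
    also have "\<dots> = emeasure M B" by (simp add: fbm_stationary_increments[OF P] emeasure_M[OF B\<Omega>])
    finally show "emeasure (distr M M (wiener_shift t)) B = emeasure M B" .
  qed simp
  show ?thesis
  proof (intro conjI ballI allI impI)
    fix \<omega> t0 U1 U2
    assume "\<omega> \<in> \<Omega>" "rde_solution_on {t0..} f a b \<omega> U1 \<and> rde_solution_on {t0..} f a b \<omega> U2"
    then show "((\<lambda>t. (norm (U1 t - U2 t))\<^sup>2) \<longlongrightarrow> 0) at_top"
      by (intro rde.solutions_merge[OF path]) auto
  next
    have formula: "sde_point f a b (wiener_shift t \<omega>) =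
        exp (a * OU t \<omega>) *\<^sub>R pullback_point f a b (wiener_shift t \<omega>) + exp (a * OU t \<omega>) *\<^sub>R (b /\<^sub>R a) - b /\<^sub>R a"
      if "\<omega> \<in> \<Omega>" for \<omega> t
      using sde_point_shift[OF that, of t] by (simp only: to_sde_center scaleR_add_right)
    show "\<exists>\<psi> p.
        generated_by M (rde_solution_on UNIV f a b) \<psi> \<and> rds M \<psi> \<and>
        p \<in> borel_measurable M \<and> random_attractor M \<psi> (\<lambda>\<omega>. {p \<omega>}) \<and>
        (\<exists>\<phi> x.
           generated_by M (sde_solution \<alpha> f a b) \<phi> \<and> rds M \<phi> \<and>
           random_attractor M \<phi> (\<lambda>\<omega>. {x \<omega>}) \<and>
           (\<forall>\<omega>\<in>\<Omega>. \<forall>t. x (wiener_shift t \<omega>) =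
              exp (a * OU t \<omega>) *\<^sub>R p (wiener_shift t \<omega>) + exp (a * OU t \<omega>) *\<^sub>R (b /\<^sub>R a) - b /\<^sub>R a) \<and>
           stationary_solution M (sde_solution \<alpha> f a b) x \<and>
           (\<forall>y. stationary_solution M (sde_solution \<alpha> f a b) y \<longrightarrow>
              (AE \<omega> in M. \<forall>t. y (wiener_shift t \<omega>) = x (wiener_shift t \<omega>))))"
    proof (rule exI[of _ "rde_flow f a b"], rule exI[of _ "pullback_point f a b"], intro conjI)
      show "generated_by M (rde_solution_on UNIV f a b) (rde_flow f a b)" by (rule flow_generated)
      show "rds M (rde_flow f a b)" by (rule flow_rds)
      show "pullback_point f a b \<in> borel_measurable M" by (rule pullback_point_measurable)
      show "random_attractor M (rde_flow f a b) (\<lambda>\<omega>. {pullback_point f a b \<omega>})" by (rule flow_attractor)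
      show "\<exists>\<phi> x.
           generated_by M (sde_solution \<alpha> f a b) \<phi> \<and> rds M \<phi> \<and>
           random_attractor M \<phi> (\<lambda>\<omega>. {x \<omega>}) \<and>
           (\<forall>\<omega>\<in>\<Omega>. \<forall>t. x (wiener_shift t \<omega>) =
              exp (a * OU t \<omega>) *\<^sub>R pullback_point f a b (wiener_shift t \<omega>)
              + exp (a * OU t \<omega>) *\<^sub>R (b /\<^sub>R a) - b /\<^sub>R a) \<and>
           stationary_solution M (sde_solution \<alpha> f a b) x \<and>
           (\<forall>y. stationary_solution M (sde_solution \<alpha> f a b) y \<longrightarrow>
              (AE \<omega> in M. \<forall>t. y (wiener_shift t \<omega>) = x (wiener_shift t \<omega>)))"
        by (rule exI[of _ "sde_flow f a b"], rule exI[of _ "sde_point f a b"], intro conjI ballI allI impI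
            sde_flow_generated sde_rds sde_attractor formula sde_point_stationary stationary_unique[OF Mprob inv])
    qed
  qed
qed

end
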